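(* Let $L>0$ and $\delta\in[0,1)$. There exists a constant $c>0$ such that the following holds for every $h>0$ and every $v$, with $c$ independent of $h$ and $v$. Let $\Omega_h=(0,L)\times(-h,h)$ and let $v\in W^{2,1}(\Omega_h;\mathbb{R}^2)\cap C^1(\overline{\Omega}_h;\mathbb{R}^2)$ satisfy $$\nabla v(y)=R_{\theta(y)}\big(\mathrm{Id}+\gamma(y)\,e_1\otimes e_2\big)\quad\text{for a.e. }y\in\Omega_h$$ with functions $\theta:\Omega_h\to\mathbb{T}^1$ and $\gamma:\Omega_h\to\mathbb{R}$; in particular, $\gamma\in W^{1,1}(\Omega_h;\mathbb{R})\cap C^0(\overline{\Omega}_h;\mathbb{R})$ and $\theta\in W^{1,1}(\Omega_h;\mathbb{T}^1)\cap C^0(\overline{\Omega}_h;\mathbb{T}^1)$. If $$\frac1L\,|v(0,y_2)-v(L,y_2)|\le\delta\quad\text{for all }y_2\in(-h,h),$$ then $$\mathcal{E}_h(v)=\int_{\Omega_h}\gamma^2\,\mathrm{d}y\ \ge\ c\,h.$$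
   Context: $R_\varphi=\begin{pmatrix}\cos\varphi&-\sin\varphi\\ \sin\varphi&\cos\varphi\end{pmatrix}$; $e_1,e_2$ is the standard basis of $\mathbb{R}^2$; $\mathbb{T}^1$ is the one-dimensional flat torus, i.e. $[0,2\pi]$ with endpoints identified. The energy is $\mathcal{E}_h(v)=\int_{\Omega_h}W(\nabla v)\,\mathrm{d}y$, with slip direction $s=\pm e_1$ and $m=s^\perp=\pm e_2$ (so $s\otimes m=e_1\otimes e_2$), where $W(F)=|Fm|^2-1$ if $\det F=1$ and $|Fs|=1$, and $W(F)=\infty$ otherwise. For $F=R(\mathrm{Id}+\gamma\, s\otimes m)$ with $R\in SO(2)$, $\gamma\in\mathbb{R}$, one has $W(F)=\gamma^2$. *)

theory Defs
  imports "HOL-Analysis.Analysis"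
begin

section \<open>Sobolev functions and functions continuous up to the boundary\<close>

definition partial_deriv ::
    "'n::finite \<Rightarrow> (real ^ 'n \<Rightarrow> 'b::real_normed_vector) \<Rightarrow> real ^ 'n \<Rightarrow> 'b" where
  "partial_deriv i f x = frechet_derivative f (at x) (axis i 1)"

text \<open>A list of directions plays the role of a multi-index; its length is the order.\<close>

primrec partial_derivs ::
    "'n::finite list \<Rightarrow> (real ^ 'n \<Rightarrow> 'b::real_normed_vector) \<Rightarrow> real ^ 'n \<Rightarrow> 'b" where
  "partial_derivs [] f = f"
| "partial_derivs (i # is) f = partial_deriv i (partial_derivs is f)"

definition test_functions :: "(real ^ 'n::finite) set \<Rightarrow> (real ^ 'n \<Rightarrow> real) set" where
  "test_functions \<Omega> =
     {\<phi>. (\<forall>is x. partial_derivs is \<phi> differentiable (at x)) \<and>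
         compact (closure {x. \<phi> x \<noteq> 0}) \<and> closure {x. \<phi> x \<noteq> 0} \<subseteq> \<Omega>}"

definition weak_deriv ::
    "(real ^ 'n::finite) set \<Rightarrow> 'n list \<Rightarrow> (real ^ 'n \<Rightarrow> 'b::euclidean_space) \<Rightarrow>
       (real ^ 'n \<Rightarrow> 'b) \<Rightarrow> bool" where
  "weak_deriv \<Omega> is f g \<longleftrightarrow>
     (\<forall>\<phi> \<in> test_functions \<Omega>.
        (LINT x : \<Omega> | lebesgue. partial_derivs is \<phi> x *\<^sub>R f x) =
          (- 1) ^ length is *\<^sub>R (LINT x : \<Omega> | lebesgue. \<phi> x *\<^sub>R g x))"

text \<open>Membership in \<open>W\<^sup>k\<^sup>,\<^sup>1(\<Omega>)\<close>: the function is integrable and has integrable weak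
  derivatives of all orders up to \<open>k\<close>. This does not depend on the representative of the
  function modulo null sets.\<close>

definition sobolev_W1 ::
    "nat \<Rightarrow> (real ^ 'n::finite) set \<Rightarrow> (real ^ 'n \<Rightarrow> 'b::euclidean_space) \<Rightarrow> bool" where
  "sobolev_W1 k \<Omega> f \<longleftrightarrow>
     f absolutely_integrable_on \<Omega> \<and>
     (\<forall>is. length is \<le> k \<longrightarrow> (\<exists>g. g absolutely_integrable_on \<Omega> \<and> weak_deriv \<Omega> is f g))"

text \<open>\<open>C\<^sup>1\<close> up to the boundary: the function itself carries its boundary values,
  and the gradient extends continuously from \<open>\<Omega>\<close> to its closure.\<close>

definition C1_closure :: "(real ^ 'n::finite) set \<Rightarrow> (real ^ 'n \<Rightarrow> real ^ 'm::finite) \<Rightarrow> bool" where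
  "C1_closure \<Omega> v \<longleftrightarrow>
     continuous_on (closure \<Omega>) v \<and>
     (\<forall>x\<in>\<Omega>. v differentiable (at x)) \<and>
     (\<exists>G. continuous_on (closure \<Omega>) G \<and> (\<forall>x\<in>\<Omega>. G x = jacobian v (at x)))"

text \<open>\<open>C\<^sup>0\<close> up to the boundary, for functions that are only determined almost everywhere.\<close>

definition C0_closure_ae ::
    "(real ^ 'n::finite) set \<Rightarrow> (real ^ 'n \<Rightarrow> 'b::euclidean_space) \<Rightarrow> bool" where
  "C0_closure_ae \<Omega> f \<longleftrightarrow>
     (\<exists>g. continuous_on (closure \<Omega>) g \<and> (AE x in lebesgue_on \<Omega>. f x = g x))"

text \<open>A map into the flat torus \<open>\<real>/2\<pi>\<int>\<close> is represented by an arbitrary choice of real angles.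
  Its regularity is that of the associated map into the unit circle, under the isometric
  identification below; no regularity of the chosen angles themselves is involved.\<close>

definition circle_point :: "real \<Rightarrow> real ^ 2" where
  "circle_point t = vector [cos t, sin t]"


section \<open>The energy\<close>

definition rotation :: "real \<Rightarrow> real ^ 2 ^ 2" where
  "rotation t = vector [vector [cos t, - sin t], vector [sin t, cos t]]"

definition tensor :: "real ^ 'm \<Rightarrow> real ^ 'n \<Rightarrow> real ^ 'n ^ 'm" where
  "tensor a b = (\<chi> i j. a $ i * b $ j)"

definition perp :: "real ^ 2 \<Rightarrow> real ^ 2" where
  "perp s = vector [- (s $ 2), s $ 1]"

definition strip :: "real \<Rightarrow> real \<Rightarrow> (real ^ 2) set" where
  "strip L h = {y. 0 < y $ 1 \<and> y $ 1 < L \<and> - h < y $ 2 \<and> y $ 2 < h}"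

text \<open>For a unit vector \<open>s\<close> the conversion to \<open>ennreal\<close> loses nothing: \<open>det F = 1\<close> and
  \<open>norm (F *v s) = 1\<close> force \<open>norm (F *v perp s) \<ge> 1\<close>.\<close>

definition energy_density :: "real ^ 2 \<Rightarrow> real ^ 2 ^ 2 \<Rightarrow> ennreal" where
  "energy_density s F =
     (if det F = 1 \<and> norm (F *v s) = 1 then ennreal ((norm (F *v perp s))\<^sup>2 - 1) else \<infinity>)"

definition energy :: "real ^ 2 \<Rightarrow> (real ^ 2) set \<Rightarrow> (real ^ 2 \<Rightarrow> real ^ 2) \<Rightarrow> ennreal" where
  "energy s \<Omega> v = (\<integral>\<^sup>+ y. energy_density s (jacobian v (at y)) \<partial>lebesgue_on \<Omega>)"

end

theory Submission
  imports Defs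
begin

text \<open>The columns of \<open>\<nabla>v\<close> are \<open>u = \<partial>\<^sub>1v\<close>, a unit vector, and \<open>w = \<partial>\<^sub>2v = \<gamma> u + u\<^sup>\<bottom>\<close>. Both extend
  continuously to the closed strip and both have integrable weak derivatives; moreover
  \<open>\<partial>\<^sub>1w = \<partial>\<^sub>2u\<close>, since both are the mixed second derivative of \<open>v\<close>. Differentiating \<open>|u|\<^sup>2 = 1\<close> gives
  \<open>u \<bullet> \<partial>\<^sub>1u = u \<bullet> \<partial>\<^sub>2u = 0\<close>, hence \<open>\<partial>\<^sub>1u = \<alpha> u\<^sup>\<bottom>\<close> for a scalar \<open>\<alpha>\<close>, and \<open>\<gamma> = u \<bullet> w\<close> satisfies
  \<open>\<partial>\<^sub>1\<gamma> = \<partial>\<^sub>1u \<bullet> w + u \<bullet> \<partial>\<^sub>2u = \<alpha>\<close>. So along almost every horizontal line the direction \<open>u\<close> turns exactly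
  as fast as \<open>\<gamma>\<close> changes: in complex notation \<open>u = e\<^sup>i\<^sup>\<gamma> z\<close> with a constant \<open>z\<close> of modulus one.

  This makes the estimate one-dimensional. Since \<open>v(L,r) - v(0,r) = z \<integral> e\<^sup>i\<^sup>\<gamma>\<close> has norm at most \<open>\<delta> L\<close>,
  \<open>\<delta> L \<ge> \<integral> cos \<gamma> \<ge> L - \<integral> \<gamma>\<^sup>2 / 2\<close>, that is \<open>\<integral> \<gamma>\<^sup>2 \<ge> 2 L (1 - \<delta>)\<close> on almost every horizontal line
  (\<open>rotating_curve_energy_bound\<close>). Integrating over the heights \<open>r \<in> (-h,h)\<close> gives the constant
  \<open>c = 4 L (1 - \<delta>)\<close>.

  The calculus above uses products of Sobolev functions and the composition \<open>e\<^sup>i\<^sup>\<gamma>\<close>. It is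
  justified by reduction to lines: for a bounded continuous function on a rectangle, an integrable Borel
  function \<open>g\<close> is a weak derivative in direction \<open>i\<close> if and only if on almost every line parallel to the \<open>i\<close>-th axis the function is a
  primitive of \<open>g\<close> (\<open>acl_deriv_of_tensor_tests\<close>, \<open>acl_deriv_imp_weak_deriv\<close>). For primitives of
  integrable functions of one variable the product and chain rules are proved directly
  (\<open>ac_density_bilinear\<close>, \<open>ac_density_compose_C1\<close>). The product rule on lines, translated
  back to weak derivatives, also shows that \<open>\<gamma> = u \<bullet> w\<close> is a Sobolev function.\<close>

section \<open>Primitives on an interval\<close>

text \<open>Bisection turns the local bounds into \<open>|w b - w a| \<le> e \<integral> p\<close> for every \<open>e\<close>, because the right-hand
  side is additive over adjacent intervals. To prove that a function is a primitive of \<open>f'\<close> it thus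
  suffices to compare increments with \<open>f'\<close> near each point, up to a small multiple of an integrable
  function; no differentiation almost everywhere is involved.\<close>

lemma increments_locally_small_imp_eq:
  fixes w :: "real \<Rightarrow> 'b::real_normed_vector" and p :: "real \<Rightarrow> real"
  assumes "a \<le> b" and p: "p integrable_on {a..b}"
    and loc: "\<And>x e. \<lbrakk>a \<le> x; x \<le> b; 0 < e\<rbrakk> \<Longrightarrow>
      \<exists>d>0. \<forall>s t. a \<le> s \<and> s \<le> x \<and> x \<le> t \<and> t \<le> b \<and> t - s < d \<longrightarrow>
        norm (w t - w s) \<le> e * integral {s..t} p"
  shows "w b = w a"
proof -
  have bound: "norm (w b - w a) \<le> e * integral {a..b} p" if e: "0 < e" for e
  proof -
    define P where "P s t \<longleftrightarrow> (a \<le> s \<and> t \<le> b \<longrightarrow> norm (w t - w s) \<le> e * integral {s..t} p)" for s t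
    have "P a b" using \<open>a \<le> b\<close>
    proof (induction rule: Bolzano)
      case (trans x y z)
      show ?case unfolding P_def
      proof (intro impI)
        assume az: "a \<le> x \<and> z \<le> b"
        have "norm (w z - w x) \<le> norm (w y - w x) + norm (w z - w y)"
          by (metis add.commute norm_triangle_sub diff_add_cancel norm_triangle_ineq add_diff_eq)
        also have "\<dots> \<le> e * integral {x..y} p + e * integral {y..z} p"
          using trans az unfolding P_def by (intro add_mono) auto
        also have "\<dots> = e * integral {x..z} p"
          using trans az integrable_subinterval_real[OF p, of x z]
          by (subst Henstock_Kurzweil_Integration.integral_combine[symmetric, of x y z]) (auto simp: algebra_simps)
        finally show "norm (w z - w x) \<le> e * integral {x..z} p" .
      qed
    next
      case (local x)
      then show ?case using loc[of x e] e unfolding P_def by fastforce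
    qed
    then show ?thesis by (simp add: P_def)
  qed
  have "norm (w b - w a) \<le> 0"
  proof (rule ccontr)
    assume c: "\<not> norm (w b - w a) \<le> 0"
    let ?I = "\<bar>integral {a..b} p\<bar> + 1" and ?N = "norm (w b - w a)"
    have "?N \<le> ?N / (2 * ?I) * integral {a..b} p" by (rule bound) (use c in auto)
    also have "\<dots> \<le> ?N / (2 * ?I) * ?I" using c by (intro mult_left_mono) auto
    also have "\<dots> = ?N / 2" by (simp add: field_simps)
    finally show False using c by simp
  qed
  then show ?thesis by simp
qed

text \<open>Local absolute continuity on the open interval \<open>(a,b)\<close>, phrased through the density \<open>f'\<close>. The
  density has to be integrable on compact subintervals only, so it may blow up at the ends.\<close>

definition ac_density :: "real \<Rightarrow> real \<Rightarrow> (real \<Rightarrow> 'b::euclidean_space) \<Rightarrow> (real \<Rightarrow> 'b) \<Rightarrow> bool" where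
  "ac_density a b f f' \<longleftrightarrow> continuous_on {a<..<b} f \<and>
     (\<forall>s t. a < s \<longrightarrow> s \<le> t \<longrightarrow> t < b \<longrightarrow>
        f' absolutely_integrable_on {s..t} \<and> integral {s..t} f' = f t - f s)"

lemma ac_densityD:
  assumes "ac_density a b f f'" "a < s" "s \<le> t" "t < b"
  shows "f' absolutely_integrable_on {s..t}" "integral {s..t} f' = f t - f s"
    "continuous_on {s..t} f" "f' integrable_on {s..t}"
  using assms set_lebesgue_integral_eq_integral(1) unfolding ac_density_def
  by (auto intro: continuous_on_subset absolutely_integrable_on_def[THEN iffD1, THEN conjunct1])

lemma ac_density_C1:
  assumes d: "\<And>t. a < t \<Longrightarrow> t < b \<Longrightarrow> (f has_vector_derivative f' t) (at t)"
    and c: "continuous_on {a<..<b} f'"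
  shows "ac_density a b f f'"
  unfolding ac_density_def
proof (intro conjI allI impI)
  show "continuous_on {a<..<b} f"
    by (meson d continuous_at_imp_continuous_on greaterThanLessThan_iff has_vector_derivative_continuous)
  fix s t assume st: "a < s" "s \<le> t" "t < b"
  have "continuous_on {s..t} f'" using c by (rule continuous_on_subset) (use st in auto)
  then show "f' absolutely_integrable_on {s..t}" by (rule absolutely_integrable_continuous_real)
  show "integral {s..t} f' = f t - f s"
    by (intro integral_unique fundamental_theorem_of_calculus)
       (use st in \<open>auto intro: d[THEN has_vector_derivative_at_within]\<close>)
qed

lemma absolutely_integrable_continuous_bilinear:
  fixes f :: "real \<Rightarrow> 'b::euclidean_space" and g :: "real \<Rightarrow> 'c::euclidean_space"
    and prd :: "'b \<Rightarrow> 'c \<Rightarrow> 'd::euclidean_space"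
  assumes "bounded_bilinear prd" "continuous_on {s..t} f" "g absolutely_integrable_on {s..t}"
  shows "(\<lambda>x. prd (f x) (g x)) absolutely_integrable_on {s..t}"
proof (rule absolutely_integrable_bounded_measurable_product[where h = prd, OF _ _ _ _ assms(3)])
  show "bilinear prd" by (rule bilinear_conv_bounded_bilinear[THEN iffD2, OF assms(1)])
  show "f \<in> borel_measurable (lebesgue_on {s..t})"
    by (intro continuous_imp_measurable_on_sets_lebesgue assms(2)) auto
  show "bounded (f ` {s..t})" by (intro compact_imp_bounded compact_continuous_image assms(2)) auto
qed auto

text \<open>The increment of a product over a short interval around \<open>x\<close> is the integral of the
  density with each undifferentiated factor frozen at an endpoint. By continuity at \<open>x\<close> this
  changes the integral by at most a small multiple of \<open>\<integral> |f'| + |g'|\<close>.\<close>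

lemma ac_density_bilinear:
  fixes f :: "real \<Rightarrow> 'b::euclidean_space" and g :: "real \<Rightarrow> 'c::euclidean_space"
    and prd :: "'b \<Rightarrow> 'c \<Rightarrow> 'd::euclidean_space"
  assumes bl: "bounded_bilinear prd" and f: "ac_density a b f f'" and g: "ac_density a b g g'"
  shows "ac_density a b (\<lambda>x. prd (f x) (g x)) (\<lambda>x. prd (f x) (g' x) + prd (f' x) (g x))"
  unfolding ac_density_def
proof (intro conjI allI impI)
  interpret bounded_bilinear prd by fact
  show "continuous_on {a<..<b} (\<lambda>x. prd (f x) (g x))"
    using f g unfolding ac_density_def by (intro continuous_on) auto
  fix s0 t0 assume st: "a < s0" "s0 \<le> t0" "t0 < b"
  let ?h = "\<lambda>x. prd (f x) (g' x) + prd (f' x) (g x)"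
  note fD = ac_densityD[OF f] and gD = ac_densityD[OF g]
  have int: "?h absolutely_integrable_on {s..t}" if "a < s" "s \<le> t" "t < b" for s t
    using absolutely_integrable_continuous_bilinear[OF bl fD(3)[OF that] gD(1)[OF that]]
      absolutely_integrable_continuous_bilinear[OF bounded_bilinear.flip[OF bl] gD(3)[OF that] fD(1)[OF that]]
    by (rule set_integral_add(1))
  show "?h absolutely_integrable_on {s0..t0}" by (rule int[OF st])
  note hint = set_lebesgue_integral_eq_integral(1)[OF int]
  obtain K where K: "0 < K" "\<And>x y. norm (prd x y) \<le> norm x * norm y * K"
    using pos_bounded by blast
  define p where "p x = norm (f' x) + norm (g' x)" for x
  have pint: "p integrable_on {s..t}" if "a < s" "s \<le> t" "t < b" for s t
    using fD(1)[OF that] gD(1)[OF that] unfolding p_def absolutely_integrable_on_def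
    by (intro integrable_add) auto
  define w where "w t = prd (f t) (g t) - integral {s0..t} ?h" for t
  have "w t0 = w s0"
  proof (rule increments_locally_small_imp_eq[OF st(2) pint[OF st]])
    fix x e :: real assume x: "s0 \<le> x" "x \<le> t0" and e: "0 < e"
    let ?e = "e / (2 * K)"
    have e': "0 < ?e" using e K by simp
    have "isCont f x" "isCont g x"
      using f g x st unfolding ac_density_def
      by (auto simp: continuous_on_eq_continuous_at)
    then obtain d1 d2 where d: "d1 > 0" "d2 > 0"
      "\<And>y. \<bar>y - x\<bar> < d1 \<Longrightarrow> norm (f y - f x) < ?e" "\<And>y. \<bar>y - x\<bar> < d2 \<Longrightarrow> norm (g y - g x) < ?e"
      unfolding continuous_at_eps_delta dist_norm real_norm_def using e' by metis
    show "\<exists>d>0. \<forall>s t. s0 \<le> s \<and> s \<le> x \<and> x \<le> t \<and> t \<le> t0 \<and> t - s < d \<longrightarrow>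
        norm (w t - w s) \<le> e * integral {s..t} p"
    proof (intro exI[of _ "min d1 d2"] conjI allI impI)
      show "0 < min d1 d2" using d by simp
      fix s t assume A: "s0 \<le> s \<and> s \<le> x \<and> x \<le> t \<and> t \<le> t0 \<and> t - s < min d1 d2"
      then have B: "a < s" "s \<le> t" "t < b" and B0: "a < s0" "s0 \<le> s" "s0 \<le> t" using st by auto
      have near: "\<bar>y - x\<bar> < d1" "\<bar>y - x\<bar> < d2" if "y \<in> {s..t}" for y
        using A that by auto
      have cf: "norm (f t - f y) \<le> 2 * ?e" if "y \<in> {s..t}" for y
        using d(3)[OF near(1)[OF that]] d(3)[OF near(1), of t] B(2)
          norm_triangle_ineq4[of "f t - f x" "f y - f x"] by auto
      have cg: "norm (g s - g y) \<le> 2 * ?e" if "y \<in> {s..t}" for y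
        using d(4)[OF near(2)[OF that]] d(4)[OF near(2), of s] B(2)
          norm_triangle_ineq4[of "g s - g x" "g y - g x"] by auto
      note fi = fD(4)[OF B] and gi = gD(4)[OF B]
      have "prd (f t) (g t) - prd (f s) (g s) = prd (f t) (g t - g s) + prd (f t - f s) (g s)"
        by (simp add: diff_left diff_right)
      also have "\<dots> = integral {s..t} (\<lambda>y. prd (f t) (g' y)) + integral {s..t} (\<lambda>y. prd (f' y) (g s))"
        using integral_linear[OF gi bounded_linear_right, of "f t"]
          integral_linear[OF fi bounded_linear_left, of "g s"] fD(2)[OF B] gD(2)[OF B] by (simp add: o_def)
      also have "\<dots> = integral {s..t} (\<lambda>y. prd (f t) (g' y) + prd (f' y) (g s))"
        using integrable_linear[OF gi bounded_linear_right, of "f t"]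
          integrable_linear[OF fi bounded_linear_left, of "g s"]
        by (simp add: o_def Henstock_Kurzweil_Integration.integral_add)
      finally have 1: "prd (f t) (g t) - prd (f s) (g s)
          = integral {s..t} (\<lambda>y. prd (f t) (g' y) + prd (f' y) (g s))" .
      have i1: "(\<lambda>y. prd (f t) (g' y) + prd (f' y) (g s)) integrable_on {s..t}"
        using integrable_linear[OF gi bounded_linear_right, of "f t"]
          integrable_linear[OF fi bounded_linear_left, of "g s"]
        by (intro integrable_add) (auto simp: o_def)
      have "integral {s0..t} ?h = integral {s0..s} ?h + integral {s..t} ?h"
        using B B0 hint[of s0 t]
        by (intro Henstock_Kurzweil_Integration.integral_combine[symmetric]) auto
      then have "w t - w s = integral {s..t} (\<lambda>y. prd (f t) (g' y) + prd (f' y) (g s)) - integral {s..t} ?h"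
        unfolding w_def using 1 by (simp add: algebra_simps)
      also have "\<dots> = integral {s..t} (\<lambda>y. (prd (f t) (g' y) + prd (f' y) (g s)) - ?h y)"
        by (rule Henstock_Kurzweil_Integration.integral_diff[symmetric, OF i1 hint[OF B]])
      finally have 2: "w t - w s = integral {s..t} (\<lambda>y. (prd (f t) (g' y) + prd (f' y) (g s)) - ?h y)" .
      have "norm (w t - w s) \<le> integral {s..t} (\<lambda>y. e * p y)"
        unfolding 2
      proof (rule integral_norm_bound_integral)
        show "(\<lambda>y. (prd (f t) (g' y) + prd (f' y) (g s)) - ?h y) integrable_on {s..t}"
          by (rule integrable_diff[OF i1 hint[OF B]])
        show "(\<lambda>y. e * p y) integrable_on {s..t}" using pint[OF B] by (rule integrable_on_mult_right)
        fix y assume y: "y \<in> {s..t}"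
        have "(prd (f t) (g' y) + prd (f' y) (g s)) - ?h y = prd (f t - f y) (g' y) + prd (f' y) (g s - g y)"
          by (simp add: diff_left diff_right)
        also have "norm \<dots> \<le> norm (f t - f y) * norm (g' y) * K + norm (f' y) * norm (g s - g y) * K"
          by (rule order_trans[OF norm_triangle_ineq]) (intro add_mono K)
        also have "\<dots> \<le> (2 * ?e) * norm (g' y) * K + norm (f' y) * (2 * ?e) * K"
          using K by (intro add_mono mult_right_mono mult_left_mono cf[OF y] cg[OF y]) auto
        also have "\<dots> = e * p y" using K by (simp add: p_def field_simps)
        finally show "norm (prd (f t) (g' y) + prd (f' y) (g s) - ?h y) \<le> e * p y" .
      qed
      then show "norm (w t - w s) \<le> e * integral {s..t} p" by simp
    qed
  qed
  then show "integral {s0..t0} ?h = prd (f t0) (g t0) - prd (f s0) (g s0)"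
    by (simp add: w_def algebra_simps)
qed

text \<open>Differentiability of \<open>F\<close> at the single value \<open>g x\<close> controls both half-increments, from \<open>x\<close> to the
  right and from the left to \<open>x\<close>, up to a small multiple of \<open>\<integral> |g'|\<close>.\<close>

lemma ac_density_compose_C1:
  fixes g g' :: "real \<Rightarrow> real" and F F' :: "real \<Rightarrow> 'b::euclidean_space"
  assumes g: "ac_density a b g g'"
    and F: "\<And>z. (F has_vector_derivative F' z) (at z)" and F': "continuous_on UNIV F'"
  shows "ac_density a b (\<lambda>x. F (g x)) (\<lambda>x. g' x *\<^sub>R F' (g x))"
  unfolding ac_density_def
proof (intro conjI allI impI)
  have cF: "continuous_on UNIV F"
    by (intro continuous_at_imp_continuous_on ballI has_vector_derivative_continuous[OF F])
  have cg: "continuous_on {a<..<b} g" using g by (simp add: ac_density_def)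
  show "continuous_on {a<..<b} (\<lambda>x. F (g x))"
    by (rule continuous_on_compose2[OF cF cg]) auto
  have cF'g: "continuous_on {a<..<b} (\<lambda>x. F' (g x))"
    by (rule continuous_on_compose2[OF F' cg]) auto
  fix s0 t0 assume st: "a < s0" "s0 \<le> t0" "t0 < b"
  let ?h = "\<lambda>x. g' x *\<^sub>R F' (g x)"
  note gD = ac_densityD[OF g]
  have int: "?h absolutely_integrable_on {s..t}" if "a < s" "s \<le> t" "t < b" for s t
  proof -
    have "continuous_on {s..t} (\<lambda>x. F' (g x))"
      by (rule continuous_on_subset[OF cF'g]) (use that in auto)
    from absolutely_integrable_continuous_bilinear[OF bounded_bilinear.flip[OF bounded_bilinear_scaleR]
        this gD(1)[OF that]] show ?thesis .
  qed
  show "?h absolutely_integrable_on {s0..t0}" by (rule int[OF st])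
  note hint = set_lebesgue_integral_eq_integral(1)[OF int]
  define p where "p x = \<bar>g' x\<bar>" for x
  have pint: "p integrable_on {s..t}" if "a < s" "s \<le> t" "t < b" for s t
    using gD(1)[OF that] unfolding p_def absolutely_integrable_on_def by auto
  have gle: "\<bar>g t - g s\<bar> \<le> integral {s..t} p" if "a < s" "s \<le> t" "t < b" for s t
    using integral_norm_bound_integral[OF gD(4)[OF that] pint[OF that]] gD(2)[OF that] by (auto simp: p_def)
  define w where "w t = F (g t) - integral {s0..t} ?h" for t
  have "w t0 = w s0"
  proof (rule increments_locally_small_imp_eq[OF st(2) pint[OF st]])
    fix x e :: real assume x: "s0 \<le> x" "x \<le> t0" and e: "0 < e"
    have e': "0 < e / 2" using e by simp
    have gc: "isCont g x" using cg x st by (auto simp: continuous_on_eq_continuous_at)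
    have F'c: "isCont (\<lambda>x. F' (g x)) x" using cF'g x st by (auto simp: continuous_on_eq_continuous_at)
    obtain d0 where d0: "d0 > 0"
      "\<And>z. \<bar>z - g x\<bar> < d0 \<Longrightarrow> norm (F z - F (g x) - (z - g x) *\<^sub>R F' (g x)) \<le> e / 2 * \<bar>z - g x\<bar>"
      using F[of "g x"] e' unfolding has_vector_derivative_def has_derivative_at_alt real_norm_def by metis
    obtain d1 where d1: "d1 > 0" "\<And>y. \<bar>y - x\<bar> < d1 \<Longrightarrow> \<bar>g y - g x\<bar> < d0"
      using gc d0(1) unfolding continuous_at_eps_delta dist_norm real_norm_def by metis
    obtain d2 where d2: "d2 > 0" "\<And>y. \<bar>y - x\<bar> < d2 \<Longrightarrow> norm (F' (g y) - F' (g x)) < e / 2"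
      using F'c e' unfolding continuous_at_eps_delta dist_norm real_norm_def by metis
    have near: "norm (F (g y) - F (g x) - (g y - g x) *\<^sub>R F' (g x)) \<le> e / 2 * \<bar>g y - g x\<bar>"
      if "\<bar>y - x\<bar> < d1" for y
      using d0(2) d1(2)[OF that] by blast
    show "\<exists>d>0. \<forall>s t. s0 \<le> s \<and> s \<le> x \<and> x \<le> t \<and> t \<le> t0 \<and> t - s < d \<longrightarrow>
        norm (w t - w s) \<le> e * integral {s..t} p"
    proof (intro exI[of _ "min d1 d2"] conjI allI impI)
      show "0 < min d1 d2" using d1 d2 by simp
      fix s t assume A: "s0 \<le> s \<and> s \<le> x \<and> x \<le> t \<and> t \<le> t0 \<and> t - s < min d1 d2"
      then have B: "a < s" "s \<le> t" "t < b" "s \<le> x" "x \<le> t" "a < x" "x < b"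
        and B0: "a < s0" "s0 \<le> s" "s0 \<le> t" using st by auto
      let ?c = "F' (g x)"
      note gi = gD(4)[OF B(1-3)]
      have lin: "(g t - g s) *\<^sub>R ?c = integral {s..t} (\<lambda>y. g' y *\<^sub>R ?c)"
        using integral_linear[OF gi bounded_linear_scaleR_left, of ?c] gD(2)[OF B(1-3)] by (simp add: o_def)
      have i1: "(\<lambda>y. g' y *\<^sub>R ?c) integrable_on {s..t}"
        using integrable_linear[OF gi bounded_linear_scaleR_left, of ?c] by (simp add: o_def)
      have "integral {s0..t} ?h = integral {s0..s} ?h + integral {s..t} ?h"
        using B B0 hint[of s0 t]
        by (intro Henstock_Kurzweil_Integration.integral_combine[symmetric]) auto
      then have "w t - w s = (F (g t) - F (g x) - (g t - g x) *\<^sub>R ?c) - (F (g s) - F (g x) - (g s - g x) *\<^sub>R ?c)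
          + ((g t - g s) *\<^sub>R ?c - integral {s..t} ?h)"
        unfolding w_def by (simp add: algebra_simps)
      also have "(g t - g s) *\<^sub>R ?c - integral {s..t} ?h = integral {s..t} (\<lambda>y. g' y *\<^sub>R ?c - ?h y)"
        unfolding lin by (rule Henstock_Kurzweil_Integration.integral_diff[symmetric, OF i1 hint[OF B(1-3)]])
      finally have 2: "w t - w s = (F (g t) - F (g x) - (g t - g x) *\<^sub>R ?c)
          - (F (g s) - F (g x) - (g s - g x) *\<^sub>R ?c) + integral {s..t} (\<lambda>y. g' y *\<^sub>R ?c - ?h y)" .
      have 3: "norm (integral {s..t} (\<lambda>y. g' y *\<^sub>R ?c - ?h y)) \<le> integral {s..t} (\<lambda>y. e / 2 * p y)"
      proof (rule integral_norm_bound_integral)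
        show "(\<lambda>y. g' y *\<^sub>R ?c - ?h y) integrable_on {s..t}" by (rule integrable_diff[OF i1 hint[OF B(1-3)]])
        show "(\<lambda>y. e / 2 * p y) integrable_on {s..t}" using pint[OF B(1-3)] by (rule integrable_on_mult_right)
        fix y assume y: "y \<in> {s..t}"
        then have "\<bar>y - x\<bar> < d2" using A by auto
        from d2(2)[OF this] have "\<bar>g' y\<bar> * norm (F' (g y) - ?c) \<le> \<bar>g' y\<bar> * (e / 2)"
          by (intro mult_left_mono) auto
        then show "norm (g' y *\<^sub>R ?c - ?h y) \<le> e / 2 * p y"
          by (simp add: p_def scaleR_diff_right[symmetric] norm_minus_commute mult.commute)
      qed
      have nt: "norm (F (g t) - F (g x) - (g t - g x) *\<^sub>R ?c) \<le> e / 2 * integral {x..t} p"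
      proof -
        have "\<bar>g t - g x\<bar> \<le> integral {x..t} p" using gle[of x t] B by auto
        then have "e / 2 * \<bar>g t - g x\<bar> \<le> e / 2 * integral {x..t} p" using e by (intro mult_left_mono) auto
        then show ?thesis using near[of t] A by auto
      qed
      have ns: "norm (F (g s) - F (g x) - (g s - g x) *\<^sub>R ?c) \<le> e / 2 * integral {s..x} p"
      proof -
        have "\<bar>g s - g x\<bar> \<le> integral {s..x} p" using gle[of s x] B by auto
        then have "e / 2 * \<bar>g s - g x\<bar> \<le> e / 2 * integral {s..x} p" using e by (intro mult_left_mono) auto
        then show ?thesis using near[of s] A by auto
      qed
      have "integral {s..t} p = integral {s..x} p + integral {x..t} p"
        using B pint[OF B(1-3)] by (intro Henstock_Kurzweil_Integration.integral_combine[symmetric]) auto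
      then have 4: "e / 2 * integral {s..x} p + e / 2 * integral {x..t} p = e / 2 * integral {s..t} p"
        by (simp add: algebra_simps)
      have "norm (w t - w s) \<le> e / 2 * integral {x..t} p + e / 2 * integral {s..x} p + e / 2 * integral {s..t} p"
        unfolding 2
        by (intro order_trans[OF norm_triangle_ineq] order_trans[OF norm_triangle_ineq4] add_mono nt ns)
           (use 3 in simp)
      then show "norm (w t - w s) \<le> e * integral {s..t} p" using 4 by simp
    qed
  qed
  then show "integral {s0..t0} ?h = F (g t0) - F (g s0)"
    by (simp add: w_def algebra_simps)
qed

lemma ac_density_cong:
  assumes "ac_density a b f f'" "negligible N"
    and eq: "\<And>t. a < t \<Longrightarrow> t < b \<Longrightarrow> t \<notin> N \<Longrightarrow> f'' t = f' t"
  shows "ac_density a b f f''"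
  unfolding ac_density_def
proof (intro conjI allI impI)
  show "continuous_on {a<..<b} f" using assms(1) by (simp add: ac_density_def)
  fix s t assume st: "a < s" "s \<le> t" "t < b"
  note D = ac_densityD[OF assms(1) st]
  show "f'' absolutely_integrable_on {s..t}"
    by (rule absolutely_integrable_spike[OF D(1) assms(2)]) (use eq st in auto)
  have "integral {s..t} f'' = integral {s..t} f'"
    by (rule integral_spike[OF assms(2)]) (use eq st in auto)
  then show "integral {s..t} f'' = f t - f s" using D(2) by simp
qed

text \<open>The function \<open>cis (- g) * U\<close> has density zero.\<close>

lemma ac_density_rotating:
  fixes U :: "real \<Rightarrow> complex" and g g' :: "real \<Rightarrow> real"
  assumes U: "ac_density a b U (\<lambda>t. \<i> * complex_of_real (g' t) * U t)" and g: "ac_density a b g g'"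
  obtains z where "\<And>t. a < t \<Longrightarrow> t < b \<Longrightarrow> U t = cis (g t) * z"
proof -
  have "((\<lambda>z. cis (- z)) has_vector_derivative - \<i> * cis (- z)) (at z)" for z
  proof -
    have "((\<lambda>w. exp (- (\<i> * w))) has_field_derivative - \<i> * exp (- (\<i> * of_real z))) (at (of_real z))"
      by (auto intro!: derivative_eq_intros)
    from has_vector_derivative_real_field[OF this] show ?thesis by (simp add: cis_conv_exp)
  qed
  moreover have "continuous_on UNIV (\<lambda>z. - \<i> * cis (- z))"
    by (intro continuous_intros)
  ultimately have "ac_density a b (\<lambda>t. cis (- g t)) (\<lambda>t. g' t *\<^sub>R (- \<i> * cis (- g t)))"
    by (rule ac_density_compose_C1[OF g])
  from ac_density_bilinear[OF bounded_bilinear_mult this U]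
  have w: "ac_density a b (\<lambda>t. cis (- g t) * U t) (\<lambda>t. 0)"
    by (simp add: scaleR_conv_of_real mult_ac)
  define m where "m = (a + b) / 2"
  have const: "cis (- g t) * U t = cis (- g s) * U s" if "a < s" "s \<le> t" "t < b" for s t
    using ac_densityD(2)[OF w that] by simp
  show ?thesis
  proof (rule that)
    fix t assume t: "a < t" "t < b"
    have "cis (- g t) * U t = cis (- g m) * U m"
      using const[of t m] const[of m t] t by (cases "t \<le> m") (auto simp: m_def)
    then have "cis (g t) * (cis (- g t) * U t) = cis (g t) * (cis (- g m) * U m)" by simp
    then show "U t = cis (g t) * (cis (- g m) * U m)"
      by (simp add: mult.assoc[symmetric] cis_mult)
  qed
qed

section \<open>Smooth cutoff functions\<close>

text \<open>Counting derivatives by recursion makes closure under sums and products a plain induction,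
  without a Leibniz formula for higher derivatives.\<close>

primrec times_differentiable :: "nat \<Rightarrow> (real \<Rightarrow> real) \<Rightarrow> bool" where
  "times_differentiable 0 f \<longleftrightarrow> True"
| "times_differentiable (Suc n) f \<longleftrightarrow>
     (\<exists>f'. (\<forall>x. (f has_real_derivative f' x) (at x)) \<and> times_differentiable n f')"

lemma times_differentiable_SucD: "times_differentiable (Suc n) f \<Longrightarrow> times_differentiable n f"
  by (induction n arbitrary: f) auto

lemma times_differentiable_add:
  "times_differentiable n f \<Longrightarrow> times_differentiable n g \<Longrightarrow> times_differentiable n (\<lambda>x. f x + g x)"
proof (induction n arbitrary: f g)
  case (Suc n)
  then obtain f' g' where *: "\<And>x. (f has_real_derivative f' x) (at x)" "times_differentiable n f'"
    "\<And>x. (g has_real_derivative g' x) (at x)" "times_differentiable n g'" by auto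
  have "\<forall>x. ((\<lambda>x. f x + g x) has_real_derivative f' x + g' x) (at x)"
    by (intro allI DERIV_add *)
  then show ?case unfolding times_differentiable.simps
    using Suc.IH[OF *(2,4)] by (intro exI[of _ "\<lambda>x. f' x + g' x"] conjI)
qed simp

lemma times_differentiable_mult:
  "times_differentiable n f \<Longrightarrow> times_differentiable n g \<Longrightarrow> times_differentiable n (\<lambda>x. f x * g x)"
proof (induction n arbitrary: f g)
  case (Suc n)
  then obtain f' g' where *: "\<And>x. (f has_real_derivative f' x) (at x)" "times_differentiable n f'"
    "\<And>x. (g has_real_derivative g' x) (at x)" "times_differentiable n g'" by auto
  have "times_differentiable n (\<lambda>x. f' x * g x + g' x * f x)"
    using Suc.prems[THEN times_differentiable_SucD] by (intro times_differentiable_add Suc.IH *)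
  moreover have "\<forall>x. ((\<lambda>x. f x * g x) has_real_derivative f' x * g x + g' x * f x) (at x)"
    by (intro allI DERIV_mult *)
  ultimately show ?case unfolding times_differentiable.simps
    by (intro exI[of _ "\<lambda>x. f' x * g x + g' x * f x"] conjI)
qed simp

lemma times_differentiable_const: "times_differentiable n (\<lambda>x. c)"
  by (induction n arbitrary: c) (auto intro!: exI[of _ "\<lambda>x. 0"])

lemma times_differentiable_affine:
  "times_differentiable n f \<Longrightarrow> times_differentiable n (\<lambda>x. f (k * x + d))"
proof (induction n arbitrary: f)
  case (Suc n)
  then obtain f' where *: "\<And>x. (f has_real_derivative f' x) (at x)" "times_differentiable n f'" by auto
  have "((\<lambda>x. f (k * x + d)) has_real_derivative k * f' (k * x + d)) (at x)" for x
  proof -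
    have "((\<lambda>x. k * x + d) has_real_derivative k) (at x)" by (auto intro!: derivative_eq_intros)
    from DERIV_chain2[where f = f and g = "\<lambda>x. k * x + d", OF *(1) this]
    show ?thesis by (simp add: mult.commute)
  qed
  moreover have "times_differentiable n (\<lambda>x. k * f' (k * x + d))"
    by (intro times_differentiable_mult times_differentiable_const Suc.IH *(2))
  ultimately show ?case by (auto intro!: exI[of _ "\<lambda>x. k * f' (k * x + d)"])
qed simp

definition smooth :: "(real \<Rightarrow> real) \<Rightarrow> bool" where
  "smooth f \<longleftrightarrow> (\<forall>n. times_differentiable n f)"

lemma smooth_has_deriv: "smooth f \<Longrightarrow> (f has_real_derivative deriv f x) (at x)"
proof -
  assume "smooth f"
  then have "times_differentiable (Suc 0) f" unfolding smooth_def by blast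
  then obtain f' where f': "\<And>x. (f has_real_derivative f' x) (at x)" by auto
  then show ?thesis using DERIV_imp_deriv[OF f', of x] by simp
qed

lemma smooth_deriv: "smooth f \<Longrightarrow> smooth (deriv f)"
  unfolding smooth_def
proof
  fix n assume f: "\<forall>n. times_differentiable n f"
  then obtain f' where "\<forall>x. (f has_real_derivative f' x) (at x)" "times_differentiable n f'"
    by (meson times_differentiable.simps(2))
  moreover from this have "deriv f = f'" by (auto intro!: DERIV_imp_deriv)
  ultimately show "times_differentiable n (deriv f)" by simp
qed

lemma smooth_higher_deriv: "smooth f \<Longrightarrow> smooth ((deriv ^^ n) f)"
  by (induction n) (simp_all add: smooth_deriv)

lemma smooth_continuous: "smooth f \<Longrightarrow> continuous_on S f"
  by (intro continuous_at_imp_continuous_on ballI DERIV_isCont[OF smooth_has_deriv])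

lemma smooth_affine: "smooth f \<Longrightarrow> smooth (\<lambda>x. f (k * x + d))"
  by (simp add: smooth_def times_differentiable_affine)

lemma smooth_mult: "smooth f \<Longrightarrow> smooth g \<Longrightarrow> smooth (\<lambda>x. f x * g x)"
  by (simp add: smooth_def times_differentiable_mult)

lemma smooth_const: "smooth (\<lambda>x. c)"
  by (simp add: smooth_def times_differentiable_const)

lemma smooth_diff: "smooth f \<Longrightarrow> smooth g \<Longrightarrow> smooth (\<lambda>x. f x - g x)"
  unfolding smooth_def
proof
  fix n assume "\<forall>n. times_differentiable n f" "\<forall>n. times_differentiable n g"
  then have "times_differentiable n (\<lambda>x. f x + (- 1) * g x)"
    by (intro times_differentiable_add times_differentiable_mult times_differentiable_const) auto
  then show "times_differentiable n (\<lambda>x. f x - g x)" by simp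
qed

lemma smooth_antiderivative:
  assumes "\<And>x. (F has_real_derivative f x) (at x)" "smooth f"
  shows "smooth F"
  unfolding smooth_def
proof
  fix n show "times_differentiable n F"
  proof (cases n)
    case (Suc m)
    have "\<forall>x. (F has_real_derivative f x) (at x)" "times_differentiable m f"
      using assms by (auto simp: smooth_def)
    then show ?thesis unfolding Suc times_differentiable.simps by blast
  qed simp
qed

text \<open>All derivatives have the form \<open>p (1/x) exp (- 1/x)\<close> with a polynomial \<open>p\<close>; this family is closed
  under differentiation, also at the origin, because there \<open>exp (- 1/x)\<close> decays faster than any power of \<open>x\<close>.\<close>

lemma smooth_flat: "smooth (\<lambda>x. if 0 < x then exp (- inverse x) else 0)"
proof -
  define r where "r p x = (if 0 < x then poly p (inverse x) * exp (- inverse x) else 0)" for p and x :: real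
  have lim: "((\<lambda>x. poly p (inverse x) * exp (- inverse x)) \<longlongrightarrow> 0) (at_right 0)" for p :: "real poly"
  proof -
    have "((\<lambda>t. poly p t * exp (- t)) \<longlongrightarrow> 0) at_top"
    proof -
      have "((\<lambda>t. \<Sum>k\<le>degree p. coeff p k * (t ^ k / exp t)) \<longlongrightarrow> (\<Sum>k\<le>degree p. coeff p k * 0)) at_top"
        by (intro tendsto_sum tendsto_mult tendsto_const tendsto_power_div_exp_0)
      moreover have "(\<Sum>k\<le>degree p. coeff p k * (t ^ k / exp t)) = poly p t * exp (- t)" for t
        by (simp add: poly_altdef sum_distrib_left sum_distrib_right exp_minus divide_inverse mult_ac)
      ultimately show ?thesis by simp
    qed
    from filterlim_compose[OF this filterlim_inverse_at_top_right] show ?thesis by simp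
  qed
  have r': "(r p has_real_derivative r (monom 1 2 * (p - pderiv p)) x) (at x)" for p x
  proof -
    consider "0 < x" | "x < 0" | "x = 0" by linarith
    then show ?thesis
    proof cases
      case 1
      have d: "((\<lambda>x. poly p (inverse x) * exp (- inverse x)) has_real_derivative
          poly (monom 1 2 * (p - pderiv p)) (inverse x) * exp (- inverse x)) (at x)"
        using 1 by (auto intro!: derivative_eq_intros DERIV_chain2[OF poly_DERIV]
            simp: poly_monom power2_eq_square algebra_simps)
      show ?thesis
        by (rule has_field_derivative_transform_within_open[where S="{0<..}" and f="\<lambda>x. poly p (inverse x) * exp (- inverse x)"])
           (use 1 d in \<open>auto simp: r_def\<close>)
    next
      case 2
      show ?thesis
        by (rule has_field_derivative_transform_within_open[where S="{..<0}" and f="\<lambda>x. 0"])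
           (use 2 in \<open>auto simp: r_def\<close>)
    next
      case 3
      have "((\<lambda>y. r p y / y) \<longlongrightarrow> 0) (at_left 0)"
        by (rule tendsto_eventually) (auto simp: r_def eventually_at_filter)
      moreover have "((\<lambda>y. r p y / y) \<longlongrightarrow> 0) (at_right 0)"
        by (rule Lim_transform_eventually[OF lim[of "pCons 0 p"]])
           (auto simp: r_def eventually_at_filter field_simps)
      ultimately have "((\<lambda>y. r p y / y) \<longlongrightarrow> 0) (at 0)"
        by (simp add: filterlim_at_split)
      then show ?thesis using 3 by (simp add: has_field_derivative_iff r_def)
    qed
  qed
  have "times_differentiable n (r p)" for n p
    by (induction n arbitrary: p) (use r' in auto)
  then have "smooth (r 1)" by (simp add: smooth_def)
  moreover have "r 1 = (\<lambda>x. if 0 < x then exp (- inverse x) else 0)"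
    by (simp add: fun_eq_iff r_def)
  ultimately show ?thesis by simp
qed

text \<open>The step is the normalized antiderivative of a bump, so that its derivative is a nonnegative
  kernel of mass one supported in the unit interval.\<close>

lemma smooth_step:
  obtains H :: "real \<Rightarrow> real" where "smooth H" "\<And>x. x \<le> 0 \<Longrightarrow> H x = 0" "\<And>x. 1 \<le> x \<Longrightarrow> H x = 1"
    "\<And>x. 0 \<le> H x" "\<And>x. H x \<le> 1" "\<And>x. 0 \<le> deriv H x" "\<And>x. x \<notin> {0..1} \<Longrightarrow> deriv H x = 0"
proof -
  define r :: "real \<Rightarrow> real" where "r x = (if 0 < x then exp (- inverse x) else 0)" for x
  define e where "e x = r x * r (1 - x)" for x
  have "smooth r" using smooth_flat by (simp add: r_def[abs_def])
  then have se: "smooth e"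
    using smooth_mult[of r "\<lambda>x. r ((-1) * x + 1)"] smooth_affine[of r "-1" 1]
    by (simp add: e_def[abs_def] algebra_simps)
  have e0: "0 \<le> e x" for x by (simp add: e_def r_def)
  have epos: "0 < e x" if "0 < x" "x < 1" for x using that by (simp add: e_def r_def)
  have eout: "e x = 0" if "x \<le> 0 \<or> 1 \<le> x" for x using that by (auto simp: e_def r_def)
  obtain F where F: "\<And>x. (F has_vector_derivative e x) (at x)"
    using einterval_antiderivative[of "-\<infinity>" "\<infinity>" e] DERIV_isCont[OF smooth_has_deriv[OF se]]
    by auto
  then have F: "(F has_real_derivative e x) (at x)" for x
    by (simp add: has_real_derivative_iff_has_vector_derivative)
  have mono: "F x \<le> F y" if "x \<le> y" for x y
    using DERIV_nonneg_imp_nondecreasing[OF that] F e0 by blast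
  have "F 0 < F 1"
  proof (rule DERIV_pos_imp_increasing_open[of 0 1 F])
    show "\<exists>y. (F has_real_derivative y) (at x) \<and> 0 < y" if "0 < x" "x < 1" for x
      using F epos[OF that] by blast
    show "continuous_on {0..1} F"
      by (intro continuous_at_imp_continuous_on ballI DERIV_isCont[OF F])
  qed simp
  then have c: "F 1 - F 0 > 0" by simp
  have left: "F x = F 0" if "x \<le> 0" for x
  proof (cases "x = 0")
    case False
    then have "x < 0" using that by simp
    then obtain z where "z < 0" "F 0 - F x = (0 - x) * e z" using MVT2[of x 0 F e] F by blast
    then show ?thesis using eout[of z] by simp
  qed simp
  have right: "F x = F 1" if "1 \<le> x" for x
  proof (cases "x = 1")
    case False
    then have "1 < x" using that by simp
    then obtain z where "1 < z" "F x - F 1 = (x - 1) * e z" using MVT2[of 1 x F e] F by blast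
    then show ?thesis using eout[of z] by simp
  qed simp
  define H where "H x = (F x - F 0) / (F 1 - F 0)" for x
  have H': "(H has_real_derivative e x / (F 1 - F 0)) (at x)" for x
    unfolding H_def[abs_def] using c by (auto intro!: derivative_eq_intros F)
  then have dH: "deriv H x = e x / (F 1 - F 0)" for x by (rule DERIV_imp_deriv)
  show ?thesis
  proof (rule that[of H])
    show "smooth H"
      by (rule smooth_antiderivative[OF H'])
         (use smooth_mult[OF se smooth_const[of "1 / (F 1 - F 0)"]] in simp)
    fix x :: real
    show "H x = 0" if "x \<le> 0" using left[OF that] by (simp add: H_def)
    show "H x = 1" if "1 \<le> x" using right[OF that] c by (simp add: H_def)
    show "0 \<le> H x" using mono[of 0 x] left[of x] c by (cases "x \<le> 0") (auto simp: H_def)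
    show "H x \<le> 1" using mono[of x 1] right[of x] c by (cases "x \<le> 1") (auto simp: H_def)
    show "0 \<le> deriv H x" using e0 c by (simp add: dH)
    show "deriv H x = 0" if "x \<notin> {0..1}" using eout[of x] that by (auto simp: dH)
  qed
qed

text \<open>Choice fixes one step function, so that the cutoffs carry no parameter for it.\<close>

definition step :: "real \<Rightarrow> real" where
  "step = (SOME H. smooth H \<and> (\<forall>x\<le>0. H x = 0) \<and> (\<forall>x\<ge>1. H x = 1) \<and> (\<forall>x. 0 \<le> H x \<and> H x \<le> 1) \<and>
     (\<forall>x. 0 \<le> deriv H x) \<and> (\<forall>x. x \<notin> {0..1} \<longrightarrow> deriv H x = 0))"

lemma step:
  shows step_smooth: "smooth step" and step_le_0: "\<And>x. x \<le> 0 \<Longrightarrow> step x = 0"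
    and step_ge_1: "\<And>x. 1 \<le> x \<Longrightarrow> step x = 1"
    and step_nonneg: "\<And>x. 0 \<le> step x" and step_le_1: "\<And>x. step x \<le> 1"
    and step_deriv_nonneg: "\<And>x. 0 \<le> deriv step x"
    and step_deriv_outside: "\<And>x. x \<notin> {0..1} \<Longrightarrow> deriv step x = 0"
proof -
  have "\<exists>H. smooth H \<and> (\<forall>x\<le>0. H x = 0) \<and> (\<forall>x\<ge>1. H x = 1) \<and> (\<forall>x. 0 \<le> H x \<and> H x \<le> 1) \<and>
     (\<forall>x. 0 \<le> deriv H x) \<and> (\<forall>x. x \<notin> {0..1} \<longrightarrow> deriv H x = 0)"
    by (rule smooth_step) blast
  from someI_ex[OF this, folded step_def]
  show "smooth step" "\<And>x. x \<le> 0 \<Longrightarrow> step x = 0"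
    "\<And>x. 1 \<le> x \<Longrightarrow> step x = 1"
    "\<And>x. 0 \<le> step x" "\<And>x. step x \<le> 1"
    "\<And>x. 0 \<le> deriv step x" "\<And>x. x \<notin> {0..1} \<Longrightarrow> deriv step x = 0"
    by auto
qed

lemma step_deriv_integral: "has_bochner_integral lborel (deriv step) 1"
proof -
  have "has_bochner_integral lborel (\<lambda>x. indicator {0..1} x *\<^sub>R deriv step x) (step 1 - step 0)"
  proof (rule has_bochner_integral_FTC_Icc)
    show "continuous_on {0..1} (deriv step)" by (rule smooth_continuous[OF smooth_deriv[OF step_smooth]])
    show "(step has_vector_derivative deriv step x) (at x within {0..1})" for x
      using smooth_has_deriv[OF step_smooth, of x]
      by (simp add: has_real_derivative_iff_has_vector_derivative has_vector_derivative_at_within)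
  qed simp
  moreover have "(\<lambda>x. indicator {0..1} x *\<^sub>R deriv step x) = deriv step"
    using step_deriv_outside by (force simp: indicator_def)
  ultimately show ?thesis by (simp add: step_le_0 step_ge_1)
qed

lemma borel_measurable_step_deriv [measurable]: "deriv step \<in> borel_measurable borel"
  by (intro borel_measurable_continuous_onI smooth_continuous smooth_deriv step_smooth)

text \<open>A smooth approximation of the indicator of \<open>(c,d)\<close> as \<open>n\<close> grows. The offsets \<open>- 1\<close> and \<open>2\<close> place the
  two transition layers at \<open>[c + 1/n, c + 2/n]\<close> and \<open>[d - 2/n, d - 1/n]\<close>, for large \<open>n\<close> strictly inside
  \<open>(c,d)\<close>; hence the interval may reach the boundary of the domain.\<close>

definition cutoff :: "real \<Rightarrow> real \<Rightarrow> nat \<Rightarrow> real \<Rightarrow> real" where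
  "cutoff c d n y = step (real n * y + (- real n * c - 1)) - step (real n * y + (- real n * d + 2))"

lemma smooth_cutoff: "smooth (cutoff c d n)"
  unfolding cutoff_def[abs_def] by (intro smooth_diff smooth_affine step_smooth)

lemma borel_measurable_cutoff [measurable]: "cutoff c d n \<in> borel_measurable borel"
  by (intro borel_measurable_continuous_onI smooth_continuous smooth_cutoff)

lemma deriv_cutoff:
  "deriv (cutoff c d n) y = real n * deriv step (real n * y + (- real n * c - 1))
     - real n * deriv step (real n * y + (- real n * d + 2))"
proof (rule DERIV_imp_deriv)
  have "((\<lambda>y. step (real n * y + e)) has_real_derivative real n * deriv step (real n * y + e)) (at y)" for e
  proof -
    have "((\<lambda>y. real n * y + e) has_real_derivative real n) (at y)" by (auto intro!: derivative_eq_intros)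
    from DERIV_chain2[where f = step and g = "\<lambda>y. real n * y + e", OF smooth_has_deriv[OF step_smooth] this]
    show ?thesis by (simp add: mult.commute)
  qed
  then show "(cutoff c d n has_real_derivative real n * deriv step (real n * y + (- real n * c - 1))
     - real n * deriv step (real n * y + (- real n * d + 2))) (at y)"
    unfolding cutoff_def[abs_def] by (intro DERIV_diff)
qed

lemma cutoff_abs_le_1: "\<bar>cutoff c d n y\<bar> \<le> 1"
  using step_nonneg step_le_1 by (smt (verit) cutoff_def)

lemma cutoff_support:
  assumes "3 \<le> real n * (d - c)" "0 < n" "cutoff c d n y \<noteq> 0"
  shows "c + 1 / real n \<le> y" "y \<le> d - 1 / real n"
proof -
  have n: "0 < real n" using assms by simp
  have a: "step (real n * y + (- real n * c - 1)) = 0" "step (real n * y + (- real n * d + 2)) = 0"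
    if "real n * (y - c) < 1"
    using that assms by (auto intro!: step_le_0 simp: algebra_simps)
  show "c + 1 / real n \<le> y"
  proof (rule ccontr)
    assume "\<not> ?thesis"
    then have "real n * (y - c) < 1" using n by (simp add: field_simps)
    from a[OF this] assms show False by (simp add: cutoff_def)
  qed
  have b: "step (real n * y + (- real n * c - 1)) = 1" "step (real n * y + (- real n * d + 2)) = 1"
    if "- 1 < real n * (y - d)"
    using that assms by (auto intro!: step_ge_1 simp: algebra_simps)
  show "y \<le> d - 1 / real n"
  proof (rule ccontr)
    assume "\<not> ?thesis"
    then have "- 1 < real n * (y - d)" using n by (simp add: field_simps)
    from b[OF this] assms show False by (simp add: cutoff_def)
  qed
qed

lemma cutoff_tendsto: "(\<lambda>n. cutoff c d n y) \<longlonglongrightarrow> indicator {c<..<d} y" if "c < d"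
proof -
  have 1: "(\<lambda>n. step (real n * y + (- real n * c - 1))) \<longlonglongrightarrow> indicator {c<..} y"
  proof (cases "c < y")
    case True
    then obtain N where N: "2 / (y - c) < real N" using reals_Archimedean2 by blast
    have "step (real n * y + (- real n * c - 1)) = 1" if "N \<le> n" for n
    proof (rule step_ge_1)
      have "2 / (y - c) \<le> real n" using N that by linarith
      then show "1 \<le> real n * y + (- real n * c - 1)" using True by (simp add: field_simps)
    qed
    then show ?thesis using True
      by (intro tendsto_eventually) (auto simp: eventually_sequentially intro!: exI[of _ N])
  next
    case False
    have "step (real n * y + (- real n * c - 1)) = 0" for n
      by (rule step_le_0) (use False mult_left_mono[of y c "real n"] in auto)
    then show ?thesis using False by simp
  qed
  have 2: "(\<lambda>n. step (real n * y + (- real n * d + 2))) \<longlonglongrightarrow> indicator {d..} y"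
  proof (cases "y < d")
    case True
    then obtain N where N: "2 / (d - y) < real N" using reals_Archimedean2 by blast
    have "step (real n * y + (- real n * d + 2)) = 0" if "N \<le> n" for n
    proof (rule step_le_0)
      have "2 / (d - y) \<le> real n" using N that by linarith
      then show "real n * y + (- real n * d + 2) \<le> 0" using True by (simp add: field_simps)
    qed
    then show ?thesis using True
      by (intro tendsto_eventually) (auto simp: eventually_sequentially intro!: exI[of _ N])
  next
    case False
    have "step (real n * y + (- real n * d + 2)) = 1" for n
      by (rule step_ge_1) (use False mult_left_mono[of d y "real n"] in auto)
    then show ?thesis using False by simp
  qed
  have "indicator {c<..} y - indicator {d..} y = (indicator {c<..<d} y :: real)"
    using that by (auto simp: indicator_def)
  then show ?thesis using tendsto_diff[OF 1 2] by (simp add: cutoff_def)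
qed

text \<open>The rescaled derivative of the step is an approximate identity at \<open>c\<close>.\<close>

lemma step_deriv_concentrates:
  fixes F :: "real \<Rightarrow> 'b::euclidean_space"
  assumes [measurable]: "F \<in> borel_measurable borel" and M: "\<And>y. norm (F y) \<le> M"
  shows "0 < n \<Longrightarrow> integrable lborel (\<lambda>y. (real n * deriv step (real n * y + (- real n * c + e))) *\<^sub>R F y)" (is "_ \<Longrightarrow> ?I")
    and "norm (LINT y|lborel. (real n * deriv step (real n * y + (- real n * c + e))) *\<^sub>R F y) \<le> M" (is ?N)
    and "isCont F c \<Longrightarrow>
      (\<lambda>n. LINT y|lborel. (real n * deriv step (real n * y + (- real n * c + e))) *\<^sub>R F y) \<longlonglongrightarrow> F c"
proof -
  have int: "integrable lborel (deriv step)" and int1: "integral\<^sup>L lborel (deriv step) = 1"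
    using step_deriv_integral by (auto simp: has_bochner_integral_iff)
  have bnd: "norm (deriv step z *\<^sub>R F y) \<le> M * deriv step z" for y z
    using mult_right_mono[OF M[of y] step_deriv_nonneg[of z]] step_deriv_nonneg[of z]
    by (simp add: mult.commute)
  have intF: "integrable lborel (\<lambda>z. deriv step z *\<^sub>R F (s + k * z))" for s k
  proof (rule Bochner_Integration.integrable_bound)
    show "integrable lborel (\<lambda>z. M * deriv step z)" using int by simp
    show "AE z in lborel. norm (deriv step z *\<^sub>R F (s + k * z)) \<le> norm (M * deriv step z)"
      by (intro always_eventually allI order_trans[OF bnd]) simp
  qed simp
  have subst: "integrable lborel (\<lambda>y. (real n * deriv step (real n * y + (- real n * c + e))) *\<^sub>R F y)"
    "(LINT y|lborel. (real n * deriv step (real n * y + (- real n * c + e))) *\<^sub>R F y)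
      = (LINT z|lborel. deriv step z *\<^sub>R F ((c - e / real n) + (1 / real n) * z))" if n: "0 < n" for n :: nat
  proof -
    let ?f = "\<lambda>y. (real n * deriv step (real n * y + (- real n * c + e))) *\<^sub>R F y"
    have k: "real n * ((c - e / real n) + (1 / real n) * z) + (- real n * c + e) = z" for z
      using n by (simp add: field_simps)
    have eq: "?f ((c - e / real n) + (1 / real n) * z)
        = real n *\<^sub>R (deriv step z *\<^sub>R F ((c - e / real n) + (1 / real n) * z))" for z
      by (subst k) simp
    show "integrable lborel ?f"
      using lborel_integrable_real_affine_iff[of "1 / real n" ?f "c - e / real n"] n
        Bochner_Integration.integrable_scaleR_right[OF intF[of "c - e / real n" "1 / real n"], of "real n"]
      unfolding eq by simp
    show "integral\<^sup>L lborel ?f = (LINT z|lborel. deriv step z *\<^sub>R F ((c - e / real n) + (1 / real n) * z))"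
    proof -
      have "integral\<^sup>L lborel ?f = (1 / real n) *\<^sub>R (LINT z|lborel. ?f ((c - e / real n) + (1 / real n) * z))"
        using lborel_integral_real_affine[of "1 / real n" ?f "c - e / real n"] n by simp
      also have "\<dots> = (1 / real n) *\<^sub>R (real n *\<^sub>R (LINT z|lborel. deriv step z *\<^sub>R F ((c - e / real n) + (1 / real n) * z)))"
        by (simp only: eq integral_scaleR_right)
      also have "\<dots> = (LINT z|lborel. deriv step z *\<^sub>R F ((c - e / real n) + (1 / real n) * z))"
        using n by (simp only: scaleR_scaleR) simp
      finally show ?thesis .
    qed
  qed
  show "0 < n \<Longrightarrow> ?I" by (rule subst)
  show ?N
  proof (cases "n = 0")
    case True
    have "0 \<le> M" using M[of 0] norm_ge_zero order_trans by blast
    then show ?thesis using True by simp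
  next
    case False
    let ?F = "\<lambda>z. F ((c - e / real n) + (1 / real n) * z)"
    have "norm (LINT z|lborel. deriv step z *\<^sub>R ?F z) \<le> (LINT z|lborel. norm (deriv step z *\<^sub>R ?F z))"
      by (rule integral_norm_bound)
    also have "\<dots> \<le> (LINT z|lborel. M * deriv step z)"
      using int intF[of "c - e / real n" "1 / real n"]
      by (intro integral_mono integrable_norm bnd) auto
    finally show ?thesis using int1 False subst(2)[of n] by simp
  qed
  assume cont: "isCont F c"
  have "(\<lambda>n. LINT z|lborel. deriv step z *\<^sub>R F ((c - e / real n) + (1 / real n) * z)) \<longlonglongrightarrow> (LINT z|lborel. deriv step z *\<^sub>R F c)"
  proof (rule integral_dominated_convergence[where w="\<lambda>z. M * deriv step z"])
    show "integrable lborel (\<lambda>z. M * deriv step z)" using int by simp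
    show "AE z in lborel. (\<lambda>n. deriv step z *\<^sub>R F ((c - e / real n) + (1 / real n) * z)) \<longlonglongrightarrow> deriv step z *\<^sub>R F c"
    proof (intro always_eventually allI tendsto_scaleR tendsto_const isCont_tendsto_compose[OF cont])
      fix z
      have "(\<lambda>n. (c - e * inverse (real n)) + inverse (real n) * z) \<longlonglongrightarrow> (c - e * 0) + 0 * z"
        by (intro tendsto_intros lim_inverse_n)
      then show "(\<lambda>n. (c - e / real n) + (1 / real n) * z) \<longlonglongrightarrow> c" by (simp add: divide_inverse)
    qed
    show "AE z in lborel. norm (deriv step z *\<^sub>R F ((c - e / real n) + (1 / real n) * z)) \<le> M * deriv step z" for n
      by (intro always_eventually allI bnd)
  qed auto
  also have "(LINT z|lborel. deriv step z *\<^sub>R F c) = F c" using int int1 by simp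
  finally show "(\<lambda>n. LINT y|lborel. (real n * deriv step (real n * y + (- real n * c + e))) *\<^sub>R F y) \<longlonglongrightarrow> F c"
    by (rule Lim_transform_eventually)
       (use subst(2)[symmetric] in \<open>auto simp only: eventually_sequentially intro!: exI[of _ 1]\<close>)
qed

lemma cutoff_deriv_concentrates:
  fixes F :: "real \<Rightarrow> 'b::euclidean_space"
  assumes F: "F \<in> borel_measurable borel" and M: "\<And>y. norm (F y) \<le> M"
  shows "norm (LINT y|lborel. deriv (cutoff c d n) y *\<^sub>R F y) \<le> 2 * M"
    and "isCont F c \<Longrightarrow> isCont F d \<Longrightarrow>
      (\<lambda>n. LINT y|lborel. deriv (cutoff c d n) y *\<^sub>R F y) \<longlonglongrightarrow> F c - F d"
proof -
  note conc = step_deriv_concentrates[OF F M]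
  let ?J = "\<lambda>c e n. LINT y|lborel. (real n * deriv step (real n * y + (- real n * c + e))) *\<^sub>R F y"
  have eq: "(LINT y|lborel. deriv (cutoff c d n) y *\<^sub>R F y) = ?J c (-1) n - ?J d 2 n" for n
    using Bochner_Integration.integral_diff[OF conc(1)[of n c "-1"] conc(1)[of n d 2]]
    by (cases "n = 0") (auto simp: deriv_cutoff scaleR_diff_left)
  show "norm (LINT y|lborel. deriv (cutoff c d n) y *\<^sub>R F y) \<le> 2 * M"
    unfolding eq using conc(2)[of n c "-1"] conc(2)[of n d 2]
      norm_triangle_ineq4[of "?J c (-1) n" "?J d 2 n"] by linarith
  show "(\<lambda>n. LINT y|lborel. deriv (cutoff c d n) y *\<^sub>R F y) \<longlonglongrightarrow> F c - F d"
    if "isCont F c" "isCont F d"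
    unfolding eq using that by (intro tendsto_diff conc(3))
qed

section \<open>Coordinate lines in the plane\<close>

definition other :: "2 \<Rightarrow> 2" where
  "other i = (if i = 1 then 2 else 1)"

text \<open>Here \<open>t\<close> runs along the line and \<open>r\<close> numbers the lines. With the direction \<open>i\<close> as a parameter,
  horizontal and vertical lines share all proofs.\<close>

definition pt :: "2 \<Rightarrow> real \<Rightarrow> real \<Rightarrow> real ^ 2" where
  "pt i t r = (\<chi> k. if k = i then t else r)"

lemma other_neq [simp]: "other i \<noteq> i" "i \<noteq> other i"
  using exhaust_2[of i] by (auto simp: other_def)

lemma neq_iff_other: "k \<noteq> i \<longleftrightarrow> k = other i"
  using exhaust_2[of i] exhaust_2[of k] by (auto simp: other_def)

lemma all_coords: "(\<forall>k. P k) \<longleftrightarrow> P i \<and> P (other i)"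
  using neq_iff_other[of _ i] by metis

lemma pt_nth [simp]: "pt i t r $ i = t" "pt i t r $ other i = r"
  by (simp_all add: pt_def)

lemma pt_eta [simp]: "pt i (y $ i) (y $ other i) = y"
  by (simp add: vec_eq_iff all_coords[of _ i])

lemma pt_in_box: "pt i t r \<in> box a b \<longleftrightarrow> t \<in> {a $ i<..<b $ i} \<and> r \<in> {a $ other i<..<b $ other i}"
  by (simp add: mem_box_cart all_coords[of _ i] conj_commute)

lemma pt_axis: "pt i t r = t *\<^sub>R axis i 1 + r *\<^sub>R axis (other i) 1"
  by (simp add: vec_eq_iff all_coords[of _ i] axis_def)

lemma continuous_on_pt: "continuous_on S (\<lambda>(r, t). pt i t r)"
  unfolding pt_axis case_prod_beta by (intro continuous_intros)

lemma borel_measurable_pt [measurable]: "(\<lambda>(r, t). pt i t r) \<in> borel_measurable (lborel \<Otimes>\<^sub>M lborel)"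
  using borel_measurable_continuous_onI[OF continuous_on_pt[of UNIV i]]
  by (simp add: lborel_prod)

lemma borel_measurable_pt_line [measurable]: "(\<lambda>t. pt i t r) \<in> borel_measurable borel"
  unfolding pt_axis by (intro borel_measurable_continuous_onI continuous_intros)

lemma lborel_pt: "lborel = distr (lborel \<Otimes>\<^sub>M lborel) borel (\<lambda>(r, t). pt i t r)"
proof (rule lborel_eqI)
  fix l u :: "real ^ 2" assume lu: "\<And>b. b \<in> Basis \<Longrightarrow> l \<bullet> b \<le> u \<bullet> b"
  have le: "l $ k \<le> u $ k" for k
    using lu[of "axis k 1"] by (auto simp: inner_axis Basis_vec_def)
  have vim: "(\<lambda>(r, t). pt i t r) -` box l u \<inter> space (lborel \<Otimes>\<^sub>M lborel)
      = {l $ other i<..<u $ other i} \<times> {l $ i<..<u $ i}"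
    by (auto simp: pt_in_box space_pair_measure)
  have "emeasure (distr (lborel \<Otimes>\<^sub>M lborel) borel (\<lambda>(r, t). pt i t r)) (box l u)
      = emeasure (lborel \<Otimes>\<^sub>M lborel) ({l $ other i<..<u $ other i} \<times> {l $ i<..<u $ i})"
    by (subst emeasure_distr) (auto simp: vim)
  also have "\<dots> = ennreal ((u $ other i - l $ other i) * (u $ i - l $ i))"
    using le by (subst lborel.emeasure_pair_measure_Times) (auto simp: ennreal_mult)
  also have "(u $ other i - l $ other i) * (u $ i - l $ i) = (\<Prod>b\<in>Basis. (u - l) \<bullet> b)"
  proof -
    have B: "Basis = {axis i 1, axis (other i) (1::real)}"
    proof
      show "Basis \<subseteq> {axis i 1, axis (other i) (1::real)}"
      proof
        fix b :: "real ^ 2" assume "b \<in> Basis"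
        then obtain k where "b = axis k 1" by (auto simp: Basis_vec_def)
        then show "b \<in> {axis i 1, axis (other i) 1}"
          using neq_iff_other[of k i] by (cases "k = i") simp_all
      qed
    qed (auto simp: Basis_vec_def)
    show ?thesis unfolding B
      by (subst prod.insert) (auto simp: axis_eq_axis inner_axis)
  qed
  finally show "emeasure (distr (lborel \<Otimes>\<^sub>M lborel) borel (\<lambda>(r, t). pt i t r)) (box l u)
      = ennreal (\<Prod>b\<in>Basis. (u - l) \<bullet> b)" .
qed simp

lemma integral_lines:
  fixes f :: "real ^ 2 \<Rightarrow> 'b::euclidean_space"
  assumes f: "integrable lborel f"
  shows "AE r in lborel. integrable lborel (\<lambda>t. f (pt i t r))"
    and "integrable lborel (\<lambda>r. LINT t|lborel. f (pt i t r))"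
    and "(LINT y|lborel. f y) = (LINT r|lborel. LINT t|lborel. f (pt i t r))"
proof -
  have fm [measurable]: "f \<in> borel_measurable borel" using f by auto
  have int: "integrable (lborel \<Otimes>\<^sub>M lborel) (\<lambda>z. f ((\<lambda>(r, t). pt i t r) z))"
    using f unfolding lborel_pt[of i]
    by (subst (asm) integrable_distr_eq) auto
  show "AE r in lborel. integrable lborel (\<lambda>t. f (pt i t r))"
    using lborel_pair.AE_integrable_fst'[OF int] by simp
  show "integrable lborel (\<lambda>r. LINT t|lborel. f (pt i t r))"
    using lborel_pair.integrable_fst'[OF int] by simp
  have "(LINT y|lborel. f y) = integral\<^sup>L (distr (lborel \<Otimes>\<^sub>M lborel) borel (\<lambda>(r, t). pt i t r)) f"
    by (simp add: lborel_pt[of i, symmetric])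
  also have "\<dots> = integral\<^sup>L (lborel \<Otimes>\<^sub>M lborel) (\<lambda>z. f ((\<lambda>(r, t). pt i t r) z))"
    by (rule integral_distr) auto
  also have "\<dots> = (LINT r|lborel. LINT t|lborel. f (pt i t r))"
    using lborel_pair.integral_fst'[OF int] by simp
  finally show "(LINT y|lborel. f y) = (LINT r|lborel. LINT t|lborel. f (pt i t r))" .
qed

lemma nn_integral_lines:
  fixes f :: "real ^ 2 \<Rightarrow> ennreal"
  assumes [measurable]: "f \<in> borel_measurable borel"
  shows "(\<integral>\<^sup>+ y. f y \<partial>lborel) = (\<integral>\<^sup>+ r. \<integral>\<^sup>+ t. f (pt i t r) \<partial>lborel \<partial>lborel)"
proof -
  have "(\<integral>\<^sup>+ y. f y \<partial>lborel) = integral\<^sup>N (distr (lborel \<Otimes>\<^sub>M lborel) borel (\<lambda>(r, t). pt i t r)) f"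
    by (simp add: lborel_pt[of i, symmetric])
  also have "\<dots> = (\<integral>\<^sup>+ z. f ((\<lambda>(r, t). pt i t r) z) \<partial>(lborel \<Otimes>\<^sub>M lborel))"
    by (rule nn_integral_distr) auto
  also have "\<dots> = (\<integral>\<^sup>+ r. \<integral>\<^sup>+ t. f (pt i t r) \<partial>lborel \<partial>lborel)"
    using lborel.nn_integral_fst[of "\<lambda>z. f ((\<lambda>(r, t). pt i t r) z)" "lborel"] by simp
  finally show ?thesis .
qed

lemma AE_lines:
  assumes "AE y in lborel. P y"
  shows "AE r in lborel. AE t in lborel. P (pt i t r)"
proof -
  have "AE z in lborel \<Otimes>\<^sub>M lborel. P ((\<lambda>(r, t). pt i t r) z)"
    using AE_distrD[where P = P, OF borel_measurable_pt[of i]] assms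
    unfolding lborel_pt[of i, symmetric] by blast
  from lborel_pair.AE_pair[OF this] show ?thesis by simp
qed

lemma AE_linesI:
  assumes P: "{y. P y} \<in> sets borel" and lines: "AE r in lborel. AE t in lborel. P (pt i t r)"
  shows "AE y in lborel. P y"
proof -
  have [measurable]: "Measurable.pred borel P" using P by (simp add: pred_def)
  have "AE z in lborel \<Otimes>\<^sub>M lborel. P ((\<lambda>(r, t). pt i t r) z)"
  proof (rule lborel_pair.AE_pair_measure)
    have "Measurable.pred (lborel \<Otimes>\<^sub>M lborel) (\<lambda>z. P ((\<lambda>(r, t). pt i t r) z))" by measurable
    then show "{z \<in> space (lborel \<Otimes>\<^sub>M lborel). P ((\<lambda>(r, t). pt i t r) z)} \<in> sets (lborel \<Otimes>\<^sub>M lborel)"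
      by (simp only: pred_def)
  qed (use lines in auto)
  then have "AE y in distr (lborel \<Otimes>\<^sub>M lborel) borel (\<lambda>(r, t). pt i t r). P y"
    by (subst AE_distr_iff) (use P in auto)
  then show ?thesis by (subst lborel_pt[of i])
qed

text \<open>The Borel sets over which the integral vanishes form a Dynkin system that contains the intervals.\<close>

lemma AE_zero_if_interval_integrals_zero:
  fixes f :: "real \<Rightarrow> 'b::euclidean_space"
  assumes f: "integrable lborel f" and out: "\<And>x. x \<notin> {a<..<b} \<Longrightarrow> f x = 0"
    and zero: "\<And>c d. a \<le> c \<Longrightarrow> c < d \<Longrightarrow> d \<le> b \<Longrightarrow> (LINT x|lborel. indicator {c<..<d} x *\<^sub>R f x) = 0"
  shows "AE x in lborel. f x = 0"
proof -
  have set0: "(LINT x:{c<..<d}|lborel. f x) = 0" for c d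
  proof -
    have eq: "(LINT x:{c<..<d}|lborel. f x) = (LINT x|lborel. indicator {max a c<..<min b d} x *\<^sub>R f x)"
      unfolding set_lebesgue_integral_def
      by (intro Bochner_Integration.integral_cong) (use out in \<open>auto simp: indicator_def\<close>)
    show ?thesis
    proof (cases "max a c < min b d")
      case True
      then show ?thesis unfolding eq by (intro zero) auto
    next
      case False
      then have "{max a c<..<min b d} = {}" by auto
      then show ?thesis unfolding eq by simp
    qed
  qed
  have int: "set_integrable lborel A f" if "A \<in> sets borel" for A
    using integrable_mult_indicator[OF _ f, of A] that by (simp add: set_integrable_def)
  have UN: "(LINT x:UNIV|lborel. f x) = 0"
  proof -
    have "(LINT x:UNIV|lborel. f x) = (LINT x:{a<..<b}|lborel. f x)"
      unfolding set_lebesgue_integral_def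
      by (intro Bochner_Integration.integral_cong) (use out in \<open>auto simp: indicator_def\<close>)
    then show ?thesis using set0 by simp
  qed
  have all0: "(LINT x:A|lborel. f x) = 0" if "A \<in> sets borel" for A
  proof -
    let ?G = "range (\<lambda>(c, d). box c d :: real set)"
    have G: "sets borel = sigma_sets UNIV ?G"
      by (subst borel_eq_box) simp
    have stable: "Int_stable ?G"
      by (auto simp: Int_stable_def box_real intro!: image_eqI[of _ _ "(max _ _, min _ _)"])
    have closed: "?G \<subseteq> Pow UNIV" by simp
    show ?thesis
      using stable closed that[unfolded G]
    proof (induction rule: sigma_sets_induct_disjoint)
      case (basic A)
      then show ?case using set0 by (auto simp: box_real)
    next
      case (compl A)
      then have "(LINT x:A \<union> (UNIV - A)|lborel. f x) = (LINT x:A|lborel. f x) + (LINT x:UNIV - A|lborel. f x)"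
        by (intro set_integral_Un int) (auto simp: G[symmetric])
      then show ?case using UN compl by simp
    next
      case (union A)
      then have "(LINT x:(\<Union>i. A i)|lborel. f x) = (\<Sum>i. (LINT x:A i|lborel. f x))"
        by (intro lebesgue_integral_countable_add int) (auto simp: G[symmetric] disjoint_family_on_def)
      then show ?case using union by simp
    qed (simp add: set_lebesgue_integral_def)
  qed
  show ?thesis
    using sigma_finite_measure.density_unique_banach[OF sigma_finite_lborel f, of "\<lambda>_. 0"] all0 by simp
qed

section \<open>Test functions\<close>

lemma partial_derivs_append: "partial_derivs (is @ js) f = partial_derivs is (partial_derivs js f)"
  by (induction "is") auto

lemma partial_deriv_eqI:
  assumes "(f has_derivative f') (at x)"
  shows "partial_deriv i f x = f' (axis i 1)"
  unfolding partial_deriv_def using frechet_derivative_at[OF assms] by simp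

lemma test_function_has_derivative:
  assumes "\<phi> \<in> test_functions \<Omega>"
  shows "(partial_derivs is \<phi> has_derivative frechet_derivative (partial_derivs is \<phi>) (at x)) (at x)"
  using assms by (auto simp: test_functions_def frechet_derivative_works[symmetric])

lemma test_function_continuous:
  assumes "\<phi> \<in> test_functions \<Omega>"
  shows "continuous_on S (partial_derivs is \<phi>)"
  by (intro continuous_at_imp_continuous_on ballI has_derivative_continuous[OF test_function_has_derivative[OF assms]])

lemma partial_deriv_support:
  assumes "x \<notin> closure {x. \<phi> x \<noteq> 0}"
  shows "partial_deriv i \<phi> x = 0"
proof -
  have "(\<phi> has_derivative (\<lambda>h. 0)) (at x)"
    by (rule has_derivative_transform_within_open[of "\<lambda>x. 0" _ _ _ "- closure {x. \<phi> x \<noteq> 0}"])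
       (use assms closure_subset[of "{x. \<phi> x \<noteq> 0}"] in auto)
  from partial_deriv_eqI[OF this] show ?thesis by simp
qed

lemma test_functions_partial_deriv:
  assumes "\<phi> \<in> test_functions \<Omega>"
  shows "partial_deriv i \<phi> \<in> test_functions \<Omega>"
proof -
  have "{x. partial_deriv i \<phi> x \<noteq> 0} \<subseteq> closure {x. \<phi> x \<noteq> 0}"
    using partial_deriv_support[of _ \<phi> i] by blast
  then have sub: "closure {x. partial_deriv i \<phi> x \<noteq> 0} \<subseteq> closure {x. \<phi> x \<noteq> 0}"
    by (rule closure_minimal) simp
  have "compact (closure {x. partial_deriv i \<phi> x \<noteq> 0})"
    using assms sub unfolding test_functions_def
    by (auto simp: compact_eq_bounded_closed intro: bounded_subset)
  moreover have "partial_derivs is (partial_deriv i \<phi>) differentiable at x" for "is" x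
  proof -
    have "partial_derivs is (partial_deriv i \<phi>) = partial_derivs (is @ [i]) \<phi>"
      by (simp add: partial_derivs_append)
    then show ?thesis using assms unfolding test_functions_def by (simp only: mem_Collect_eq)
  qed
  ultimately show ?thesis using assms sub unfolding test_functions_def by blast
qed

lemma test_function_bounded:
  assumes "\<phi> \<in> test_functions \<Omega>"
  shows "\<exists>K. \<forall>x. \<bar>\<phi> x\<bar> \<le> K"
proof -
  let ?S = "closure {x. \<phi> x \<noteq> 0}"
  have "compact (\<phi> ` ?S)"
    using assms test_function_continuous[OF assms, of ?S "[]"]
    by (intro compact_continuous_image) (auto simp: test_functions_def)
  then obtain K where "\<forall>z\<in>\<phi> ` ?S. norm z \<le> K"
    using compact_imp_bounded bounded_iff by metis
  then have K: "\<bar>\<phi> x\<bar> \<le> K" if "x \<in> ?S" for x using that by auto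
  have "\<bar>\<phi> x\<bar> \<le> max K 0" for x
  proof (cases "x \<in> ?S")
    case False
    then have "x \<notin> {x. \<phi> x \<noteq> 0}" using subsetD[OF closure_subset[of "{x. \<phi> x \<noteq> 0}"]] by metis
    then show ?thesis by simp
  qed (use K[of x] in auto)
  then show ?thesis by blast
qed

lemma partial_derivs_tensor:
  fixes f g :: "real \<Rightarrow> real"
  assumes f: "smooth f" and g: "smooth g"
  shows "partial_derivs is (\<lambda>y. f (y $ i) * g (y $ other i))
      = (\<lambda>y. (deriv ^^ count_list is i) f (y $ i) * (deriv ^^ count_list is (other i)) g (y $ other i))"
    and "partial_derivs is (\<lambda>y. f (y $ i) * g (y $ other i)) differentiable at x"
proof -
  have d: "((\<lambda>y. f (y $ i) * g (y $ other i)) has_derivative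
      (\<lambda>h. deriv f (x $ i) * h $ i * g (x $ other i) + f (x $ i) * (deriv g (x $ other i) * h $ other i))) (at x)"
    if "smooth f" "smooth g" for f g and x :: "real ^ 2"
  proof -
    have comp: "((\<lambda>y. f (y $ k)) has_derivative (\<lambda>h. deriv f (x $ k) * h $ k)) (at x)" if "smooth f" for f and k :: 2
    proof -
      have "((\<lambda>y::real^2. y $ k) has_derivative (\<lambda>h. h $ k)) (at x)"
        by (rule bounded_linear_imp_has_derivative[OF bounded_linear_vec_nth])
      from has_derivative_compose[OF this smooth_has_deriv[OF that, unfolded has_field_derivative_def]]
      show ?thesis by simp
    qed
    show ?thesis
      using has_derivative_mult[OF comp[OF that(1), of i] comp[OF that(2), of "other i"]]
      by (simp add: algebra_simps)
  qed
  have pd: "partial_deriv k (\<lambda>y. f (y $ i) * g (y $ other i))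
      = (\<lambda>y. if k = i then deriv f (y $ i) * g (y $ other i) else f (y $ i) * deriv g (y $ other i))"
    if "smooth f" "smooth g" for f g k
    by (rule ext, subst partial_deriv_eqI[OF d[OF that]]) (auto simp: axis_def neq_iff_other[of k i])
  show eq: "partial_derivs is (\<lambda>y. f (y $ i) * g (y $ other i))
      = (\<lambda>y. (deriv ^^ count_list is i) f (y $ i) * (deriv ^^ count_list is (other i)) g (y $ other i))" for "is"
  proof (induction "is")
    case (Cons k "is")
    show ?case
    proof (cases "k = i")
      case True
      then show ?thesis by (simp add: Cons pd[OF smooth_higher_deriv[OF f] smooth_higher_deriv[OF g]])
    next
      case False
      then have "k = other i" by (simp only: neq_iff_other)
      then show ?thesis by (simp add: Cons pd[OF smooth_higher_deriv[OF f] smooth_higher_deriv[OF g]])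
    qed
  qed simp
  show "partial_derivs is (\<lambda>y. f (y $ i) * g (y $ other i)) differentiable at x"
    unfolding eq by (rule differentiableI[OF d[OF smooth_higher_deriv[OF f] smooth_higher_deriv[OF g]]])
qed

text \<open>The factor \<open>3\<close> makes \<open>n\<close> large enough for each cutoff to be supported strictly inside its interval.\<close>

definition admissible_cutoffs :: "real ^ 2 \<Rightarrow> real ^ 2 \<Rightarrow> 2 \<Rightarrow> real \<Rightarrow> real \<Rightarrow> real \<Rightarrow> real \<Rightarrow> nat \<Rightarrow> bool" where
  "admissible_cutoffs a b i s t c d n \<longleftrightarrow> a $ i \<le> s \<and> t \<le> b $ i \<and> a $ other i \<le> c \<and> d \<le> b $ other i \<and>
     0 < n \<and> 3 \<le> real n * (t - s) \<and> 3 \<le> real n * (d - c)"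

definition tensor_cutoff :: "2 \<Rightarrow> real \<Rightarrow> real \<Rightarrow> real \<Rightarrow> real \<Rightarrow> nat \<Rightarrow> real ^ 2 \<Rightarrow> real" where
  "tensor_cutoff i s t c d n y = cutoff s t n (y $ i) * cutoff c d n (y $ other i)"

text \<open>For a product of functions of one variable each, the symmetry of the mixed derivatives can be read off.\<close>

lemma tensor_cutoff_partial_derivs:
  "partial_derivs [i] (tensor_cutoff i s t c d n) y = deriv (cutoff s t n) (y $ i) * cutoff c d n (y $ other i)"
  "partial_derivs [i, other i] (tensor_cutoff i s t c d n) = partial_derivs [other i, i] (tensor_cutoff i s t c d n)"
  unfolding tensor_cutoff_def[abs_def]
  by (simp_all only: partial_derivs_tensor(1)[OF smooth_cutoff smooth_cutoff]) (simp_all)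

lemma tensor_cutoff_test_function:
  assumes "admissible_cutoffs a b i s t c d n"
  shows "tensor_cutoff i s t c d n \<in> test_functions (box a b)"
proof -
  note adm = assms[unfolded admissible_cutoffs_def]
  define l where "l = pt i (s + 1 / real n) (c + 1 / real n)"
  define u where "u = pt i (t - 1 / real n) (d - 1 / real n)"
  have "{y. tensor_cutoff i s t c d n y \<noteq> 0} \<subseteq> cbox l u"
    using cutoff_support[of n t s] cutoff_support[of n d c] adm
    by (auto simp: mem_box_cart all_coords[of _ i] l_def u_def tensor_cutoff_def)
  then have sub: "closure {y. tensor_cutoff i s t c d n y \<noteq> 0} \<subseteq> cbox l u"
    by (rule closure_minimal[OF _ closed_cbox])
  have "0 < 1 / real n" using adm by simp
  then have "cbox l u \<subseteq> box a b"
  proof (intro subsetI)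
    fix y assume "y \<in> cbox l u"
    then have "s + 1 / real n \<le> y $ i" "y $ i \<le> t - 1 / real n"
      "c + 1 / real n \<le> y $ other i" "y $ other i \<le> d - 1 / real n"
      by (auto simp: mem_box_cart all_coords[of _ i] l_def u_def)
    with \<open>0 < 1 / real n\<close> adm have "a $ i < y $ i" "y $ i < b $ i"
      "a $ other i < y $ other i" "y $ other i < b $ other i" by linarith+
    then show "y \<in> box a b" by (simp add: mem_box_cart all_coords[of _ i])
  qed
  moreover have "compact (closure {y. tensor_cutoff i s t c d n y \<noteq> 0})"
    using sub bounded_subset[OF bounded_cbox] by (auto simp: compact_eq_bounded_closed)
  moreover have "partial_derivs is (tensor_cutoff i s t c d n) differentiable at x" for "is" x
    unfolding tensor_cutoff_def[abs_def] by (rule partial_derivs_tensor(2)[OF smooth_cutoff smooth_cutoff])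
  ultimately show ?thesis using sub unfolding test_functions_def by blast
qed

section \<open>From weak derivatives to lines\<close>

text \<open>Absolute continuity on almost every line in direction \<open>i\<close>. The density is a Borel function on the
  whole plane, so that its restriction to every line is measurable.\<close>

definition acl_deriv ::
    "real ^ 2 \<Rightarrow> real ^ 2 \<Rightarrow> 2 \<Rightarrow> (real ^ 2 \<Rightarrow> 'b::euclidean_space) \<Rightarrow> (real ^ 2 \<Rightarrow> 'b) \<Rightarrow> bool" where
  "acl_deriv a b i f g \<longleftrightarrow>
     continuous_on (box a b) f \<and> bounded (f ` box a b) \<and>
     g \<in> borel_measurable borel \<and> set_integrable lborel (box a b) g \<and>
     (AE r in lborel. r \<in> {a $ other i<..<b $ other i} \<longrightarrow>
        ac_density (a $ i) (b $ i) (\<lambda>t. f (pt i t r)) (\<lambda>t. g (pt i t r)))"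

lemma step_deriv_bounded: "\<exists>K\<ge>0. \<forall>x. \<bar>deriv step x\<bar> \<le> K"
proof -
  have "compact (deriv step ` {0..1})"
    by (intro compact_continuous_image smooth_continuous smooth_deriv step_smooth) simp
  then obtain K where K: "\<forall>z\<in>deriv step ` {0..1}. norm z \<le> K"
    using compact_imp_bounded bounded_iff by metis
  have "\<bar>deriv step x\<bar> \<le> max K 0" for x
  proof (cases "x \<in> {0..1}")
    case True
    then have "norm (deriv step x) \<le> K" using K by blast
    then show ?thesis by simp
  qed (simp add: step_deriv_outside)
  then show ?thesis by (intro exI[of _ "max K 0"]) simp
qed

lemma borel_measurable_deriv_cutoff [measurable]: "deriv (cutoff c d n) \<in> borel_measurable borel"
  by (intro borel_measurable_continuous_onI smooth_continuous smooth_deriv smooth_cutoff)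

lemma deriv_cutoff_bounded: "\<exists>K. \<forall>y. \<bar>deriv (cutoff c d n) y\<bar> \<le> K"
proof -
  obtain K where K: "\<And>x. \<bar>deriv step x\<bar> \<le> K" "0 \<le> K" using step_deriv_bounded by blast
  have "\<bar>deriv (cutoff c d n) y\<bar> \<le> real n * K + real n * K" for y
  proof -
    have "\<bar>real n * deriv step z\<bar> \<le> real n * K" for z
      using mult_left_mono[OF K(1)[of z], of "real n"] by (simp add: abs_mult)
    then show ?thesis
      unfolding deriv_cutoff by (intro order_trans[OF abs_triangle_ineq4] add_mono)
  qed
  then show ?thesis by blast
qed

lemma integrable_bounded_times:
  fixes f :: "'a \<Rightarrow> 'b::euclidean_space"
  assumes f: "integrable M f" and c [measurable]: "c \<in> borel_measurable M" and K: "\<And>x. \<bar>c x\<bar> \<le> (K::real)"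
  shows "integrable M (\<lambda>x. c x *\<^sub>R f x)"
proof (rule Bochner_Integration.integrable_bound[of _ "\<lambda>x. K *\<^sub>R f x"])
  show "integrable M (\<lambda>x. K *\<^sub>R f x)" using f by simp
  show "(\<lambda>x. c x *\<^sub>R f x) \<in> borel_measurable M" using f by auto
  have "\<bar>c x\<bar> \<le> \<bar>K\<bar>" for x using K[of x] by linarith
  then show "AE x in M. norm (c x *\<^sub>R f x) \<le> norm (K *\<^sub>R f x)"
    by (auto intro!: mult_right_mono)
qed

lemma integrable_indicator_scaleR:
  fixes A :: "'a::euclidean_space set" and c :: "'b::euclidean_space"
  assumes "bounded A" "A \<in> sets borel"
  shows "integrable lborel (\<lambda>x. indicator A x *\<^sub>R c)"
  by (intro integrable_scaleR_left integrable_real_indicator)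
     (use assms emeasure_bounded_finite in auto)

lemma continuous_zero_if_zero_on_Rats:
  fixes K :: "real \<Rightarrow> 'b::real_normed_vector"
  assumes K: "continuous_on {a<..<b} K" and zero: "\<And>q. q \<in> \<rat> \<Longrightarrow> a < q \<Longrightarrow> q < b \<Longrightarrow> K q = 0"
    and x: "a < x" "x < b"
  shows "K x = 0"
proof (rule ccontr)
  assume "K x \<noteq> 0"
  let ?S = "{a<..<b} \<inter> K -` (- {0})"
  have "open ?S" by (rule continuous_open_preimage[OF K]) auto
  moreover have "x \<in> ?S \<inter> closure \<rat>"
    using x \<open>K x \<noteq> 0\<close> Rats_closure_real by simp
  ultimately have "?S \<inter> \<rat> \<noteq> {}" using open_Int_closure_eq_empty[of ?S \<rat>] by blast
  then show False using zero by auto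
qed

lemma indicator_scaleR_integrable_bounded:
  fixes f :: "real ^ 2 \<Rightarrow> 'b::euclidean_space"
  assumes f: "continuous_on (box a b) f" and bdd: "bounded (f ` box a b)"
  shows "set_integrable lborel (box a b) f"
    and "(\<lambda>y. indicator (box a b) y *\<^sub>R f y) \<in> borel_measurable borel"
proof -
  show m: "(\<lambda>y. indicator (box a b) y *\<^sub>R f y) \<in> borel_measurable borel"
    by (rule borel_measurable_continuous_on_indicator[OF _ f]) simp
  obtain M where M: "\<forall>z\<in>f ` box a b. norm z \<le> M" using bdd bounded_iff by metis
  show "set_integrable lborel (box a b) f"
    unfolding set_integrable_def
  proof (rule Bochner_Integration.integrable_bound[of _ "\<lambda>y. indicator (box a b) y *\<^sub>R M"])
    show "integrable lborel (\<lambda>y. indicator (box a b) y *\<^sub>R M)"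
      by (intro integrable_indicator_scaleR) auto
    show "AE y in lborel. norm (indicator (box a b) y *\<^sub>R f y) \<le> norm (indicator (box a b) y *\<^sub>R M)"
    proof (intro always_eventually allI)
      fix y show "norm (indicator (box a b) y *\<^sub>R f y) \<le> norm (indicator (box a b) y *\<^sub>R M)"
        using M by (cases "y \<in> box a b") fastforce+
    qed
  qed (use m in simp)
qed

lemma continuous_on_box_line:
  assumes "continuous_on (box a b) f" and "r \<in> {a $ other i<..<b $ other i}"
  shows "continuous_on {a $ i<..<b $ i} (\<lambda>t. f (pt i t r))"
proof (rule continuous_on_compose2[OF assms(1)])
  show "continuous_on {a $ i<..<b $ i} (\<lambda>t. pt i t r)" unfolding pt_axis by (intro continuous_intros)
qed (use assms(2) in \<open>auto simp: pt_in_box\<close>)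

text \<open>From the weak derivative to lines: the weak identity is tested with products of cutoffs only.
  Letting the cutoffs converge to the indicator of a rectangle turns it into an identity between the
  difference of \<open>f\<close> on two opposite sides and the integral of \<open>g\<close>; varying the rectangle in the
  transversal direction localizes this identity to almost every line.\<close>

context
  fixes a b :: "real ^ 2" and i :: 2 and f g :: "real ^ 2 \<Rightarrow> 'b::euclidean_space"
  assumes f_cont: "continuous_on (box a b) f" and f_bdd: "bounded (f ` box a b)"
    and g_meas: "g \<in> borel_measurable borel" and g_int: "set_integrable lborel (box a b) g"
    and weak: "\<And>s t c d n. admissible_cutoffs a b i s t c d n \<Longrightarrow>
      (LINT y:box a b|lborel. partial_derivs [i] (tensor_cutoff i s t c d n) y *\<^sub>R f y)
        = - (LINT y:box a b|lborel. tensor_cutoff i s t c d n y *\<^sub>R g y)"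
begin

definition f_ext where "f_ext y = indicator (box a b) y *\<^sub>R f y"
definition g_ext where "g_ext y = indicator (box a b) y *\<^sub>R g y"

lemma f_ext_meas [measurable]: "f_ext \<in> borel_measurable borel"
  unfolding f_ext_def[abs_def] by (rule indicator_scaleR_integrable_bounded(2)[OF f_cont f_bdd])

lemma g_ext_int: "integrable lborel g_ext"
  using g_int by (simp add: g_ext_def[abs_def] set_integrable_def)

lemma f_ext_bound: "\<exists>M\<ge>0. \<forall>y. norm (f_ext y) \<le> M"
proof -
  obtain M where M: "\<forall>z\<in>f ` box a b. norm z \<le> M" using f_bdd bounded_iff by metis
  have "norm (f_ext y) \<le> max M 0" for y
  proof (cases "y \<in> box a b")
    case True
    then have "norm (f y) \<le> M" using M by blast
    then show ?thesis using True by (simp add: f_ext_def)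
  qed (simp add: f_ext_def)
  then show ?thesis by (intro exI[of _ "max M 0"]) simp
qed

lemma f_ext_int: "integrable lborel f_ext"
  using indicator_scaleR_integrable_bounded(1)[OF f_cont f_bdd] by (simp add: f_ext_def[abs_def] set_integrable_def)

lemma f_ext_cont: "s \<in> {a $ i<..<b $ i} \<Longrightarrow> isCont (\<lambda>x. f_ext (pt i x r)) s"
proof (cases "r \<in> {a $ other i<..<b $ other i}")
  case True
  assume s: "s \<in> {a $ i<..<b $ i}"
  have "continuous_on {a $ i<..<b $ i} (\<lambda>x. f (pt i x r))"
    by (rule continuous_on_box_line[OF f_cont True])
  moreover have "f_ext (pt i x r) = f (pt i x r)" if "x \<in> {a $ i<..<b $ i}" for x
    using that True by (simp add: f_ext_def pt_in_box)
  ultimately have "continuous_on {a $ i<..<b $ i} (\<lambda>x. f_ext (pt i x r))"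
    by (subst continuous_on_cong[OF refl]) auto
  then show ?thesis using s by (simp add: continuous_on_eq_continuous_at)
next
  case False
  then have "(\<lambda>x. f_ext (pt i x r)) = (\<lambda>x. 0)" by (auto simp: f_ext_def pt_in_box fun_eq_iff)
  then show ?thesis by simp
qed

text \<open>In the limit the derivative of the first cutoff evaluates \<open>f\<close> on the two sides \<open>s\<close> and \<open>t\<close>, and
  everything else converges boundedly.\<close>

lemma rectangle_identity:
  assumes st: "a $ i < s" "s < t" "t < b $ i" and cd: "a $ other i \<le> c" "c < d" "d \<le> b $ other i"
  shows "(LINT r|lborel. indicator {c<..<d} r *\<^sub>R (f_ext (pt i s r) - f_ext (pt i t r)))
    = - (LINT y|lborel. (indicator {s<..<t} (y $ i) * indicator {c<..<d} (y $ other i)) *\<^sub>R g_ext y)"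
proof -
  obtain M where M: "\<And>y. norm (f_ext y) \<le> M" "0 \<le> M" using f_ext_bound by blast
  \<comment> \<open>from index \<open>N\<close> on the cutoffs are admissible; the sequences below start there\<close>
  obtain N where N: "0 < N" "3 \<le> real N * (t - s)" "3 \<le> real N * (d - c)"
  proof -
    obtain N where N: "max (3 / (t - s)) (3 / (d - c)) < real N" using reals_Archimedean2 by blast
    then have "3 / (t - s) < real N" "3 / (d - c) < real N" by auto
    then have "3 \<le> real N * (t - s)" "3 \<le> real N * (d - c)" using st cd by (auto simp: field_simps)
    moreover from this have "0 < N" by (cases N) auto
    ultimately show ?thesis using that by blast
  qed
  have big: "3 \<le> real (n + N) * (t - s)" "3 \<le> real (n + N) * (d - c)" for n
  proof -
    have "0 \<le> real n * (t - s)" "0 \<le> real n * (d - c)" using st cd by simp_all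
    with N show "3 \<le> real (n + N) * (t - s)" "3 \<le> real (n + N) * (d - c)"
      unfolding of_nat_add distrib_right by linarith+
  qed
  let ?I = "\<lambda>n r. LINT x|lborel. deriv (cutoff s t n) x *\<^sub>R f_ext (pt i x r)"
  have Fm [measurable]: "(\<lambda>x. f_ext (pt i x r)) \<in> borel_measurable borel" for r by measurable
  have lhs: "(LINT r|lborel. cutoff c d (n + N) r *\<^sub>R ?I (n + N) r)
      = - (LINT y|lborel. tensor_cutoff i s t c d (n + N) y *\<^sub>R g_ext y)" for n
  proof -
    let ?n = "n + N"
    have "admissible_cutoffs a b i s t c d ?n"
      using st cd N big[of n] by (simp add: admissible_cutoffs_def)
    from weak[OF this]
    have w: "(LINT y|lborel. (deriv (cutoff s t ?n) (y $ i) * cutoff c d ?n (y $ other i)) *\<^sub>R f_ext y)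
      = - (LINT y|lborel. tensor_cutoff i s t c d ?n y *\<^sub>R g_ext y)"
      unfolding set_lebesgue_integral_def tensor_cutoff_partial_derivs
      by (simp add: f_ext_def g_ext_def mult_ac scaleR_left_commute)
    obtain K where K: "\<And>y. \<bar>deriv (cutoff s t ?n) y\<bar> \<le> K" using deriv_cutoff_bounded by blast
    have "\<bar>deriv (cutoff s t ?n) x * cutoff c d ?n z\<bar> \<le> K" for x z
      using mult_mono[OF K[of x] cutoff_abs_le_1[of c d ?n z]] K[of x] by (simp add: abs_mult)
    then have "integrable lborel (\<lambda>y. (deriv (cutoff s t ?n) (y $ i) * cutoff c d ?n (y $ other i)) *\<^sub>R f_ext y)"
      by (intro integrable_bounded_times[OF f_ext_int]) auto
    from integral_lines(3)[OF this, of i] show ?thesis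
      unfolding w by (simp add: mult.commute[of "deriv _ _"] scaleR_scaleR[symmetric] del: scaleR_scaleR)
  qed
  have "(\<lambda>n. LINT r|lborel. cutoff c d (n + N) r *\<^sub>R ?I (n + N) r)
      \<longlonglongrightarrow> (LINT r|lborel. indicator {c<..<d} r *\<^sub>R (f_ext (pt i s r) - f_ext (pt i t r)))"
  proof (rule integral_dominated_convergence[where w="\<lambda>r. indicator {c<..<d} r *\<^sub>R (2 * M)"])
    show "integrable lborel (\<lambda>r. indicator {c<..<d} r *\<^sub>R (2 * M))"
      by (intro integrable_indicator_scaleR) auto
    show "AE r in lborel. (\<lambda>n. cutoff c d (n + N) r *\<^sub>R ?I (n + N) r)
        \<longlonglongrightarrow> indicator {c<..<d} r *\<^sub>R (f_ext (pt i s r) - f_ext (pt i t r))"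
    proof (intro always_eventually allI tendsto_scaleR)
      fix r
      show "(\<lambda>n. cutoff c d (n + N) r) \<longlonglongrightarrow> indicator {c<..<d} r"
        using LIMSEQ_ignore_initial_segment[OF cutoff_tendsto[OF cd(2)]] .
      show "(\<lambda>n. ?I (n + N) r) \<longlonglongrightarrow> f_ext (pt i s r) - f_ext (pt i t r)"
        by (rule LIMSEQ_ignore_initial_segment[OF cutoff_deriv_concentrates(2)[OF Fm M(1)]])
           (use st in \<open>auto intro: f_ext_cont\<close>)
    qed
    show "AE r in lborel. norm (cutoff c d (n + N) r *\<^sub>R ?I (n + N) r) \<le> indicator {c<..<d} r *\<^sub>R (2 * M)" for n
    proof (intro always_eventually allI)
      fix r
      show "norm (cutoff c d (n + N) r *\<^sub>R ?I (n + N) r) \<le> indicator {c<..<d} r *\<^sub>R (2 * M)"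
      proof (cases "r \<in> {c<..<d}")
        case True
        have "\<bar>cutoff c d (n + N) r\<bar> * norm (?I (n + N) r) \<le> 1 * (2 * M)"
          using cutoff_deriv_concentrates(1)[OF Fm M(1)] by (intro mult_mono cutoff_abs_le_1) auto
        then show ?thesis using True by simp
      next
        case False
        have "0 < 1 / real (n + N)" using N by simp
        moreover have "c + 1 / real (n + N) \<le> r \<and> r \<le> d - 1 / real (n + N)" if "cutoff c d (n + N) r \<noteq> 0"
          using cutoff_support[OF big(2) _ that] N by simp
        ultimately have "cutoff c d (n + N) r = 0"
          using False unfolding greaterThanLessThan_iff by linarith
        then show ?thesis using M by simp
      qed
    qed
    show "(\<lambda>r. cutoff c d (n + N) r *\<^sub>R ?I (n + N) r) \<in> borel_measurable lborel" for n
      by measurable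
    show "(\<lambda>r. indicator {c<..<d} r *\<^sub>R (f_ext (pt i s r) - f_ext (pt i t r))) \<in> borel_measurable lborel"
      by measurable
  qed
  moreover have "(\<lambda>n. LINT y|lborel. tensor_cutoff i s t c d (n + N) y *\<^sub>R g_ext y)
      \<longlonglongrightarrow> (LINT y|lborel. (indicator {s<..<t} (y $ i) * indicator {c<..<d} (y $ other i)) *\<^sub>R g_ext y)"
  proof (rule integral_dominated_convergence[where w="\<lambda>y. norm (g_ext y)"])
    show "integrable lborel (\<lambda>y. norm (g_ext y))" using g_ext_int by simp
    show "AE y in lborel. (\<lambda>n. tensor_cutoff i s t c d (n + N) y *\<^sub>R g_ext y)
        \<longlonglongrightarrow> (indicator {s<..<t} (y $ i) * indicator {c<..<d} (y $ other i)) *\<^sub>R g_ext y"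
      unfolding tensor_cutoff_def
      by (intro always_eventually allI tendsto_scaleR tendsto_mult tendsto_const
          LIMSEQ_ignore_initial_segment[OF cutoff_tendsto] st cd)
    show "AE y in lborel. norm (tensor_cutoff i s t c d (n + N) y *\<^sub>R g_ext y) \<le> norm (g_ext y)" for n
    proof (intro always_eventually allI)
      fix y
      have "\<bar>tensor_cutoff i s t c d (n + N) y\<bar> \<le> 1 * 1"
        unfolding tensor_cutoff_def abs_mult by (intro mult_mono cutoff_abs_le_1) auto
      then show "norm (tensor_cutoff i s t c d (n + N) y *\<^sub>R g_ext y) \<le> norm (g_ext y)"
        using mult_right_mono[of _ 1 "norm (g_ext y)"] by simp
    qed
    show "(\<lambda>y. tensor_cutoff i s t c d (n + N) y *\<^sub>R g_ext y) \<in> borel_measurable lborel" for n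
      using borel_measurable_integrable[OF g_ext_int] unfolding tensor_cutoff_def by measurable
    show "(\<lambda>y. (indicator {s<..<t} (y $ i) * indicator {c<..<d} (y $ other i)) *\<^sub>R g_ext y) \<in> borel_measurable lborel"
      using borel_measurable_integrable[OF g_ext_int] by measurable
  qed
  then have "(\<lambda>n. LINT r|lborel. cutoff c d (n + N) r *\<^sub>R ?I (n + N) r)
      \<longlonglongrightarrow> - (LINT y|lborel. (indicator {s<..<t} (y $ i) * indicator {c<..<d} (y $ other i)) *\<^sub>R g_ext y)"
    unfolding lhs by (rule tendsto_minus)
  ultimately show ?thesis by (rule LIMSEQ_unique)
qed

text \<open>The transversal interval \<open>(c,d)\<close> in the rectangle identity is arbitrary.\<close>

lemma line_identity:
  assumes st: "a $ i < s" "s < t" "t < b $ i"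
  shows "AE r in lborel. f_ext (pt i t r) - f_ext (pt i s r) = (LINT x|lborel. indicator {s<..<t} x *\<^sub>R g_ext (pt i x r))"
proof -
  define D where "D r = f_ext (pt i t r) - f_ext (pt i s r) - (LINT x|lborel. indicator {s<..<t} x *\<^sub>R g_ext (pt i x r))" for r
  have Gi: "integrable lborel (\<lambda>y. (indicator {s<..<t} (y $ i) * C (y $ other i)) *\<^sub>R g_ext y)"
    if "C \<in> borel_measurable borel" "\<And>z. \<bar>C z\<bar> \<le> 1" for C
    by (rule integrable_bounded_times[where K = 1, OF g_ext_int]) (use that in \<open>auto simp: indicator_def\<close>)
  obtain M where M: "\<And>y. norm (f_ext y) \<le> M" "0 \<le> M" using f_ext_bound by blast
  have Fi: "integrable lborel (\<lambda>r. f_ext (pt i x r))" for x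
  proof (rule Bochner_Integration.integrable_bound[of _ "\<lambda>r. indicator {a $ other i<..<b $ other i} r *\<^sub>R M"])
    show "integrable lborel (\<lambda>r. indicator {a $ other i<..<b $ other i} r *\<^sub>R M)"
      by (intro integrable_indicator_scaleR) auto
    have "norm (f_ext (pt i x r)) \<le> norm (indicator {a $ other i<..<b $ other i} r *\<^sub>R M)" for r
      using M(1)[of "pt i x r"] M(2) by (auto simp: indicator_def f_ext_def pt_in_box)
    then show "AE r in lborel. norm (f_ext (pt i x r)) \<le> norm (indicator {a $ other i<..<b $ other i} r *\<^sub>R M)"
      by simp
  qed measurable
  have Gl: "integrable lborel (\<lambda>r. LINT x|lborel. indicator {s<..<t} x *\<^sub>R g_ext (pt i x r))"
    using integral_lines(2)[where i = i, OF Gi[of "\<lambda>_. 1"]] by simp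
  have "AE r in lborel. D r = 0"
  proof (rule AE_zero_if_interval_integrals_zero)
    show "integrable lborel D"
      unfolding D_def[abs_def] by (intro Bochner_Integration.integrable_diff Fi Gl)
    show "D r = 0" if "r \<notin> {a $ other i<..<b $ other i}" for r
      using that by (auto simp: D_def f_ext_def g_ext_def pt_in_box)
    fix c d assume cd: "a $ other i \<le> c" "c < d" "d \<le> b $ other i"
    let ?C = "indicator {c<..<d} :: real \<Rightarrow> real"
    have "(LINT y|lborel. (indicator {s<..<t} (y $ i) * ?C (y $ other i)) *\<^sub>R g_ext y)
        = (LINT r|lborel. LINT x|lborel. (indicator {s<..<t} x * ?C r) *\<^sub>R g_ext (pt i x r))"
      using integral_lines(3)[where i = i, OF Gi[of ?C]] by (simp add: indicator_def)
    also have "\<dots> = (LINT r|lborel. ?C r *\<^sub>R (LINT x|lborel. indicator {s<..<t} x *\<^sub>R g_ext (pt i x r)))"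
      by (simp add: mult.commute[of "indicator {s<..<t} _"] scaleR_scaleR[symmetric] del: scaleR_scaleR)
    finally have 1: "(LINT r|lborel. ?C r *\<^sub>R (f_ext (pt i s r) - f_ext (pt i t r)))
        = - (LINT r|lborel. ?C r *\<^sub>R (LINT x|lborel. indicator {s<..<t} x *\<^sub>R g_ext (pt i x r)))"
      using rectangle_identity[OF st cd] by simp
    have ii: "integrable lborel (\<lambda>r. ?C r *\<^sub>R h r)" if "integrable lborel h" for h :: "real \<Rightarrow> 'b"
      by (rule integrable_bounded_times[where K = 1, OF that]) (auto simp: indicator_def)
    have "(LINT r|lborel. ?C r *\<^sub>R D r)
      = (LINT r|lborel. - (?C r *\<^sub>R (f_ext (pt i s r) - f_ext (pt i t r)))
            - ?C r *\<^sub>R (LINT x|lborel. indicator {s<..<t} x *\<^sub>R g_ext (pt i x r)))"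
      by (simp add: D_def algebra_simps)
    also have "\<dots> = 0"
      using 1 by (subst Bochner_Integration.integral_diff)
        (auto intro!: ii Gl Bochner_Integration.integrable_minus Bochner_Integration.integrable_diff Fi)
    finally show "(LINT r|lborel. ?C r *\<^sub>R D r) = 0" .
  qed
  then show ?thesis by (simp add: D_def)
qed

text \<open>The exceptional set of lines depends on the endpoints \<open>s\<close> and \<open>t\<close>. Countably many rational pairs
  give a common null set, and both sides are continuous in the endpoints.\<close>

lemma acl_deriv_of_tensor_tests: "acl_deriv a b i f g"
  unfolding acl_deriv_def
proof (intro conjI f_cont f_bdd g_meas g_int)
  let ?J = "{a $ other i<..<b $ other i}"
  have "AE r in lborel. \<forall>p::rat \<times> rat. a $ i < of_rat (fst p) \<and> of_rat (fst p) < (of_rat (snd p) :: real) \<and> of_rat (snd p) < b $ i \<longrightarrow>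
      f_ext (pt i (of_rat (snd p)) r) - f_ext (pt i (of_rat (fst p)) r)
        = (LINT x|lborel. indicator {of_rat (fst p)<..<of_rat (snd p)} x *\<^sub>R g_ext (pt i x r))"
    unfolding AE_all_countable using line_identity by auto
  moreover note integral_lines(1)[OF g_ext_int, of i]
  ultimately show "AE r in lborel. r \<in> ?J \<longrightarrow>
      ac_density (a $ i) (b $ i) (\<lambda>t. f (pt i t r)) (\<lambda>t. g (pt i t r))"
  proof eventually_elim
    case (elim r)
    show ?case
    proof
      assume r: "r \<in> ?J"
      let ?f = "\<lambda>t. f (pt i t r)" and ?g = "\<lambda>t. g (pt i t r)"
      have ext_eq: "f_ext (pt i t r) = ?f t" "g_ext (pt i t r) = ?g t" if "a $ i < t" "t < b $ i" for t
        using that r by (auto simp: f_ext_def g_ext_def pt_in_box)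
      have rat: "?f t - ?f s = (LINT x|lborel. indicator {s<..<t} x *\<^sub>R g_ext (pt i x r))"
        if st: "s \<in> \<rat>" "t \<in> \<rat>" "a $ i < s" "s < t" "t < b $ i" for s t
      proof -
        obtain p q where pq: "s = of_rat p" "t = of_rat q" using st(1,2) by (auto elim!: Rats_cases)
        show ?thesis
          using elim(1)[rule_format, of "(p, q)"] st ext_eq unfolding pq by simp
      qed
      have Gabs: "(\<lambda>x. g_ext (pt i x r)) absolutely_integrable_on S" if "S \<in> sets borel" for S
        using integrable_mult_indicator[OF _ elim(2), of S] that
        unfolding set_integrable_def by (simp add: integrable_completion)
      have gabs: "?g absolutely_integrable_on {s..t}" if "a $ i < s" "t < b $ i" for s t
        by (rule absolutely_integrable_spike[OF Gabs negligible_empty]) (use that ext_eq in auto)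
      have gint: "?g integrable_on {s..t}" if "a $ i < s" "t < b $ i" for s t
        by (rule set_lebesgue_integral_eq_integral(1)[OF gabs[OF that]])
      have ratg: "integral {s..t} ?g = ?f t - ?f s"
        if "s \<in> \<rat>" "t \<in> \<rat>" "a $ i < s" "s < t" "t < b $ i" for s t
      proof -
        have "set_integrable lborel {s<..<t} (\<lambda>x. g_ext (pt i x r))"
          using integrable_mult_indicator[OF _ elim(2), of "{s<..<t}"] by (simp add: set_integrable_def)
        from set_borel_integral_eq_integral(2)[OF this]
        have "(LINT x|lborel. indicator {s<..<t} x *\<^sub>R g_ext (pt i x r)) = integral {s<..<t} (\<lambda>x. g_ext (pt i x r))"
          by (simp add: set_lebesgue_integral_def)
        also have "\<dots> = integral {s<..<t} ?g"
          by (rule Henstock_Kurzweil_Integration.integral_cong) (use ext_eq that in auto)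
        also have "\<dots> = integral {s..t} ?g"
          by (simp add: integral_open_interval_real)
        finally show ?thesis using rat[OF that] by simp
      qed
      have fc: "continuous_on {a $ i<..<b $ i} ?f"
        by (rule continuous_on_box_line[OF f_cont r])
      show "ac_density (a $ i) (b $ i) ?f ?g"
        unfolding ac_density_def
      proof (intro conjI allI impI fc gabs)
        fix s t assume st: "a $ i < s" "s \<le> t" "t < b $ i"
        obtain \<alpha> where \<alpha>: "\<alpha> \<in> \<rat>" "a $ i < \<alpha>" "\<alpha> < s" using Rats_dense_in_real[OF st(1)] by blast
        obtain \<beta> where \<beta>: "\<beta> \<in> \<rat>" "t < \<beta>" "\<beta> < b $ i" using Rats_dense_in_real[OF st(3)] by blast
        define K where "K x = ?f x - ?f \<alpha> - integral {\<alpha>..x} ?g" for x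
        have "continuous_on {\<alpha><..<\<beta>} K"
        proof -
          have "continuous_on {\<alpha>..\<beta>} (\<lambda>x. integral {\<alpha>..x} ?g)"
            by (intro indefinite_integral_continuous_1 gint) (use \<alpha> \<beta> in auto)
          then have "continuous_on {\<alpha><..<\<beta>} (\<lambda>x. integral {\<alpha>..x} ?g)"
            by (rule continuous_on_subset) auto
          moreover have "continuous_on {\<alpha><..<\<beta>} ?f"
            by (rule continuous_on_subset[OF fc]) (use \<alpha> \<beta> in auto)
          ultimately show ?thesis unfolding K_def[abs_def] by (intro continuous_intros)
        qed
        moreover have "K q = 0" if "q \<in> \<rat>" "\<alpha> < q" "q < \<beta>" for q
          using ratg[of \<alpha> q] that \<alpha> \<beta> by (simp add: K_def)
        ultimately have K0: "K x = 0" if "\<alpha> < x" "x < \<beta>" for x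
          using continuous_zero_if_zero_on_Rats that by blast
        have "integral {\<alpha>..s} ?g + integral {s..t} ?g = integral {\<alpha>..t} ?g"
          by (intro Henstock_Kurzweil_Integration.integral_combine gint) (use \<alpha> st in auto)
        then show "integral {s..t} ?g = ?f t - ?f s"
          using K0[of s] K0[of t] \<alpha> \<beta> st by (simp add: K_def algebra_simps)
      qed
    qed
  qed
qed

end

lemma LINT_lebesgue_eq_lborel:
  fixes f :: "real ^ 2 \<Rightarrow> 'b::euclidean_space"
  assumes "(\<lambda>y. indicator S y *\<^sub>R f y) \<in> borel_measurable borel"
  shows "(LINT y:S|lebesgue. f y) = (LINT y|lborel. indicator S y *\<^sub>R f y)"
  unfolding set_lebesgue_integral_def by (rule integral_completion) (use assms in simp)

section \<open>From lines to weak derivatives\<close>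

lemma has_vector_derivative_line:
  fixes v :: "real ^ 2 \<Rightarrow> 'b::real_normed_vector"
  assumes "v differentiable (at (pt i t r))"
  shows "((\<lambda>t. v (pt i t r)) has_vector_derivative partial_deriv i v (pt i t r)) (at t)"
proof -
  have l: "((\<lambda>t. pt i t r) has_derivative (\<lambda>h. h *\<^sub>R axis i 1)) (at t)"
    unfolding pt_axis by (auto intro!: derivative_eq_intros)
  have D: "(v has_derivative frechet_derivative v (at (pt i t r))) (at (pt i t r))"
    using assms by (simp add: frechet_derivative_works[symmetric])
  show ?thesis
    using has_derivative_compose[OF l D] linear_cmul[OF has_derivative_linear[OF D]]
    unfolding has_vector_derivative_def partial_deriv_def by simp
qed

lemma test_function_line:
  assumes "\<phi> \<in> test_functions \<Omega>"
  shows "((\<lambda>t. \<phi> (pt i t r)) has_vector_derivative partial_deriv i \<phi> (pt i t r)) (at t)"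
  using test_function_has_derivative[OF assms, of "[]"]
  by (intro has_vector_derivative_line) (auto simp: differentiable_def)

text \<open>The support is compact, so it keeps a positive distance from both sides of the box, the same for all lines.\<close>

lemma test_function_line_support:
  assumes \<phi>: "\<phi> \<in> test_functions (box a b)" and r: "a $ i < b $ i"
  obtains s t where "a $ i < s" "s < t" "t < b $ i"
    "\<And>x r. x \<notin> {s<..<t} \<Longrightarrow> \<phi> (pt i x r) = 0 \<and> partial_deriv i \<phi> (pt i x r) = 0"
proof -
  let ?S = "closure {x. \<phi> x \<noteq> 0}"
  have S: "compact ?S" "?S \<subseteq> box a b" using \<phi> by (auto simp: test_functions_def)
  have out: "\<phi> y = 0 \<and> partial_deriv i \<phi> y = 0" if "y \<notin> ?S" for y
    using that partial_deriv_support[OF that] subsetD[OF closure_subset[of "{x. \<phi> x \<noteq> 0}"], of y] by auto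
  show ?thesis
  proof (cases "?S = {}")
    case True
    obtain s where "a $ i < s" "s < b $ i" using dense[OF r] by blast
    moreover obtain t where "s < t" "t < b $ i" using dense[OF \<open>s < b $ i\<close>] by blast
    ultimately show ?thesis using that[of s t] out True by auto
  next
    case False
    have c: "compact ((\<lambda>y. y $ i) ` ?S)"
      by (intro compact_continuous_image S continuous_intros)
    obtain y0 where y0: "y0 \<in> ?S" "\<And>y. y \<in> ?S \<Longrightarrow> y0 $ i \<le> y $ i"
      using compact_attains_inf[OF c] False by blast
    obtain y1 where y1: "y1 \<in> ?S" "\<And>y. y \<in> ?S \<Longrightarrow> y $ i \<le> y1 $ i"
      using compact_attains_sup[OF c] False by blast
    have "a $ i < y0 $ i" "y1 $ i < b $ i" using S(2) y0(1) y1(1) by (auto simp: mem_box_cart)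
    then obtain s t where st: "a $ i < s" "s < y0 $ i" "y1 $ i < t" "t < b $ i"
      using dense by meson
    show ?thesis
    proof (rule that[of s t])
      fix x r assume x: "x \<notin> {s<..<t}"
      have "pt i x r \<notin> ?S"
        using y0(2)[of "pt i x r"] y1(2)[of "pt i x r"] x st by auto
      from out[OF this] show "\<phi> (pt i x r) = 0 \<and> partial_deriv i \<phi> (pt i x r) = 0" .
    qed (use st y0(2)[OF y1(1)] in auto)
  qed
qed

text \<open>On a line the product of \<open>f\<close> with a test function is a primitive that vanishes near both ends, so
  its density integrates to zero; then integrate over all lines.\<close>

lemma acl_deriv_imp_weak_deriv:
  fixes f g :: "real ^ 2 \<Rightarrow> 'b::euclidean_space"
  assumes "acl_deriv a b i f g"
  shows "weak_deriv (box a b) [i] f g"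
  unfolding weak_deriv_def
proof
  fix \<phi> assume \<phi>: "\<phi> \<in> test_functions (box a b)"
  note acl = assms[unfolded acl_deriv_def]
  let ?I = "\<lambda>y. indicator (box a b) y :: real"
  let ?d = "partial_deriv i \<phi>"
  have \<phi>m [measurable]: "\<phi> \<in> borel_measurable borel" "?d \<in> borel_measurable borel"
    using test_function_continuous[OF \<phi>, of UNIV "[]"] test_function_continuous[OF \<phi>, of UNIV "[i]"]
    by (auto intro: borel_measurable_continuous_onI)
  obtain K where K: "\<And>y. \<bar>\<phi> y\<bar> \<le> K" using test_function_bounded[OF \<phi>] by blast
  obtain K' where K': "\<And>y. \<bar>?d y\<bar> \<le> K'"
    using test_function_bounded[OF test_functions_partial_deriv[OF \<phi>]] by blast
  have fi: "integrable lborel (\<lambda>y. ?d y *\<^sub>R (?I y *\<^sub>R f y))"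
  proof (rule integrable_bounded_times[where c = ?d, OF _ _ K'])
    show "integrable lborel (\<lambda>y. ?I y *\<^sub>R f y)"
      using indicator_scaleR_integrable_bounded(1)[of a b f] acl by (simp add: set_integrable_def)
  qed simp
  have gi: "integrable lborel (\<lambda>y. \<phi> y *\<^sub>R (?I y *\<^sub>R g y))"
  proof (rule integrable_bounded_times[where c = \<phi>, OF _ _ K])
    show "integrable lborel (\<lambda>y. ?I y *\<^sub>R g y)" using acl by (simp add: set_integrable_def)
  qed simp
  have sum: "integrable lborel (\<lambda>y. ?d y *\<^sub>R (?I y *\<^sub>R f y) + \<phi> y *\<^sub>R (?I y *\<^sub>R g y))"
    using fi gi by simp
  have conv: "(LINT y:box a b|lebesgue. c y *\<^sub>R k y) = (LINT y|lborel. c y *\<^sub>R (?I y *\<^sub>R k y))"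
    if "integrable lborel (\<lambda>y. c y *\<^sub>R (?I y *\<^sub>R k y))" for c and k :: "real ^ 2 \<Rightarrow> 'b"
  proof -
    have "(\<lambda>y. ?I y *\<^sub>R (c y *\<^sub>R k y)) = (\<lambda>y. c y *\<^sub>R (?I y *\<^sub>R k y))"
      by (simp add: fun_eq_iff mult.commute)
    moreover have "(\<lambda>y. c y *\<^sub>R (?I y *\<^sub>R k y)) \<in> borel_measurable borel"
      using borel_measurable_integrable[OF that] by simp
    ultimately show ?thesis
      using LINT_lebesgue_eq_lborel[of "box a b" "\<lambda>y. c y *\<^sub>R k y"] by (simp only:)
  qed
  note eq = conv[OF fi] conv[OF gi]
  have "(LINT y|lborel. ?d y *\<^sub>R (?I y *\<^sub>R f y) + \<phi> y *\<^sub>R (?I y *\<^sub>R g y)) = 0"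
  proof -
    have "AE r in lborel. (LINT t|lborel. ?d (pt i t r) *\<^sub>R (?I (pt i t r) *\<^sub>R f (pt i t r))
        + \<phi> (pt i t r) *\<^sub>R (?I (pt i t r) *\<^sub>R g (pt i t r))) = 0"
      using acl[THEN conjunct2, THEN conjunct2, THEN conjunct2, THEN conjunct2] integral_lines(1)[OF sum, of i]
    proof eventually_elim
      case (elim r)
      let ?h = "\<lambda>t. ?d (pt i t r) *\<^sub>R (?I (pt i t r) *\<^sub>R f (pt i t r)) + \<phi> (pt i t r) *\<^sub>R (?I (pt i t r) *\<^sub>R g (pt i t r))"
      let ?k = "\<lambda>t. \<phi> (pt i t r) *\<^sub>R g (pt i t r) + ?d (pt i t r) *\<^sub>R f (pt i t r)"
      show ?case
      proof (cases "r \<in> {a $ other i<..<b $ other i} \<and> a $ i < b $ i")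
        case False
        then have "?h = (\<lambda>t. 0)" by (auto simp: pt_in_box fun_eq_iff)
        then show ?thesis by simp
      next
        case True
        then have r: "r \<in> {a $ other i<..<b $ other i}" and ab: "a $ i < b $ i" by auto
        from elim(1) r have fg: "ac_density (a $ i) (b $ i) (\<lambda>t. f (pt i t r)) (\<lambda>t. g (pt i t r))" by blast
        have "continuous_on UNIV (\<lambda>t. ?d (pt i t r))"
          by (rule continuous_on_compose2[OF test_function_continuous[OF \<phi>, of UNIV "[i]", simplified]])
             (auto simp: pt_axis intro!: continuous_intros)
        then have "ac_density (a $ i) (b $ i) (\<lambda>t. \<phi> (pt i t r)) (\<lambda>t. ?d (pt i t r))"
          by (intro ac_density_C1 test_function_line[OF \<phi>]) (auto intro: continuous_on_subset)
        note prod = ac_density_bilinear[OF bounded_bilinear_scaleR this fg]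
        obtain s t where st: "a $ i < s" "s < t" "t < b $ i"
          "\<And>x r. x \<notin> {s<..<t} \<Longrightarrow> \<phi> (pt i x r) = 0 \<and> ?d (pt i x r) = 0"
          by (rule test_function_line_support[OF \<phi> ab]) blast
        have h: "?h = (\<lambda>x. indicator {s..t} x *\<^sub>R ?h x)"
          using st(4) by (auto simp: fun_eq_iff indicator_def)
        have hi: "set_integrable lborel {s..t} ?h"
          unfolding set_integrable_def by (rule integrable_mult_indicator[OF _ elim(2)]) simp
        have "(LINT x|lborel. ?h x) = (LINT x:{s..t}|lborel. ?h x)"
          by (subst h) (simp add: set_lebesgue_integral_def)
        also have "\<dots> = integral {s..t} ?h"
          by (rule set_borel_integral_eq_integral(2)[OF hi])
        also have "\<dots> = integral {s..t} ?k"
          by (rule Henstock_Kurzweil_Integration.integral_cong) (use st r in \<open>auto simp: pt_in_box\<close>)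
        also have "\<dots> = 0"
          using ac_densityD(2)[OF prod, of s t] st by simp
        finally show ?thesis .
      qed
    qed
    then have "(LINT r|lborel. LINT t|lborel. ?d (pt i t r) *\<^sub>R (?I (pt i t r) *\<^sub>R f (pt i t r))
        + \<phi> (pt i t r) *\<^sub>R (?I (pt i t r) *\<^sub>R g (pt i t r))) = 0"
      by (rule integral_eq_zero_AE)
    then show ?thesis using integral_lines(3)[OF sum, of i] by simp
  qed
  then have "(LINT y|lborel. ?d y *\<^sub>R (?I y *\<^sub>R f y)) = - (LINT y|lborel. \<phi> y *\<^sub>R (?I y *\<^sub>R g y))"
    using fi gi by (simp add: eq_neg_iff_add_eq_0)
  then show "(LINT x:box a b|lebesgue. partial_derivs [i] \<phi> x *\<^sub>R f x)
      = (- 1) ^ length [i] *\<^sub>R (LINT x:box a b|lebesgue. \<phi> x *\<^sub>R g x)"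
    by (simp add: eq)
qed

section \<open>Second derivatives, products and unit fields\<close>

text \<open>Weak derivatives are Lebesgue measurable only, and restrictions of such functions to lines need
  not be measurable.\<close>

lemma borel_representative:
  fixes g :: "real ^ 2 \<Rightarrow> 'b::euclidean_space"
  assumes g: "g absolutely_integrable_on S" and S: "S \<in> sets borel"
  shows "\<exists>g'. g' \<in> borel_measurable borel \<and> set_integrable lborel S g' \<and>
    (AE y in lebesgue. indicator S y *\<^sub>R g y = g' y) \<and> (\<forall>y. y \<notin> S \<longrightarrow> g' y = 0)"
proof -
  have int: "integrable lebesgue (\<lambda>y. indicator S y *\<^sub>R g y)"
    using g by (simp add: set_integrable_def)
  have "\<exists>h\<in>borel_measurable lborel. AE y in lborel. (indicator S y *\<^sub>R g y) \<bullet> e = h y" for e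
    by (rule completion_ex_borel_measurable_real)
       (use borel_measurable_integrable[OF int] in measurable)
  then obtain h where h: "\<And>e. h e \<in> borel_measurable lborel"
    "\<And>e. AE y in lborel. (indicator S y *\<^sub>R g y) \<bullet> e = h e y" by metis
  define g' where "g' y = indicator S y *\<^sub>R (\<Sum>e\<in>Basis. h e y *\<^sub>R e)" for y
  have [measurable]: "h e \<in> borel_measurable borel" for e using h(1) by simp
  have m: "g' \<in> borel_measurable borel" unfolding g'_def[abs_def] using S by measurable
  have "AE y in lborel. \<forall>e\<in>Basis. (indicator S y *\<^sub>R g y) \<bullet> e = h e y"
    using h(2) by (subst AE_finite_all) auto
  then have "AE y in lborel. indicator S y *\<^sub>R g y = g' y"
  proof eventually_elim
    case (elim y)
    have "indicator S y *\<^sub>R g y = (\<Sum>e\<in>Basis. ((indicator S y *\<^sub>R g y) \<bullet> e) *\<^sub>R e)"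
      by (rule euclidean_representation[symmetric])
    also have "\<dots> = (\<Sum>e\<in>Basis. h e y *\<^sub>R e)"
      by (intro sum.cong refl) (use elim in simp)
    finally show ?case by (cases "y \<in> S") (auto simp: g'_def)
  qed
  then have ae: "AE y in lebesgue. indicator S y *\<^sub>R g y = g' y" by (rule AE_completion)
  have out: "g' y = 0" if "y \<notin> S" for y using that by (simp add: g'_def)
  have "integrable lebesgue g'"
    by (rule Bochner_Integration.integrable_cong_AE_imp[OF int _ AE_mp[OF ae]])
       (use m in \<open>auto intro: measurable_completion\<close>)
  then have "integrable lborel g'" using m by (simp add: integrable_completion)
  moreover have "(\<lambda>y. indicator S y *\<^sub>R g' y) = g'" using out by (auto simp: fun_eq_iff indicator_def)
  ultimately have "set_integrable lborel S g'" by (simp add: set_integrable_def)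
  with m ae out show ?thesis by blast
qed

lemma LINT_cong_representative:
  fixes g g' :: "real ^ 2 \<Rightarrow> 'b::euclidean_space" and \<phi> :: "real ^ 2 \<Rightarrow> real"
  assumes m: "\<phi> \<in> borel_measurable borel" and g: "g absolutely_integrable_on S"
    and g': "g' \<in> borel_measurable borel" "\<And>y. y \<notin> S \<Longrightarrow> g' y = 0"
    and ae: "AE y in lebesgue. indicator S y *\<^sub>R g y = g' y"
  shows "(LINT y:S|lebesgue. \<phi> y *\<^sub>R g y) = (LINT y|lborel. \<phi> y *\<^sub>R g' y)"
proof -
  have [measurable]: "(\<lambda>y. indicator S y *\<^sub>R g y) \<in> borel_measurable lebesgue"
    using g borel_measurable_integrable unfolding set_integrable_def by blast
  have [measurable]: "\<phi> \<in> borel_measurable lebesgue" "g' \<in> borel_measurable lebesgue"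
    using m g' by (auto intro: measurable_completion)
  have "(LINT y:S|lebesgue. \<phi> y *\<^sub>R g y) = (LINT y|lebesgue. \<phi> y *\<^sub>R (indicator S y *\<^sub>R g y))"
    by (simp add: set_lebesgue_integral_def mult.commute)
  also have "\<dots> = (LINT y|lebesgue. \<phi> y *\<^sub>R g' y)"
  proof (rule integral_cong_AE)
    show "(\<lambda>y. \<phi> y *\<^sub>R (indicator S y *\<^sub>R g y)) \<in> borel_measurable lebesgue"
      "(\<lambda>y. \<phi> y *\<^sub>R g' y) \<in> borel_measurable lebesgue" by measurable
    show "AE y in lebesgue. \<phi> y *\<^sub>R (indicator S y *\<^sub>R g y) = \<phi> y *\<^sub>R g' y"
      using ae by eventually_elim simp
  qed
  also have "\<dots> = (LINT y|lborel. \<phi> y *\<^sub>R g' y)"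
    by (rule integral_completion) (use m g' in measurable)
  finally show ?thesis .
qed


text \<open>The weak identity is given for \<open>g\<close> and the Lebesgue measure, whereas lines require the Borel function \<open>g'\<close>.\<close>

lemma acl_deriv_representative:
  fixes f g g' :: "real ^ 2 \<Rightarrow> 'b::euclidean_space"
  assumes f: "continuous_on (box a b) f" "bounded (f ` box a b)"
    and g: "g absolutely_integrable_on box a b"
    and g': "g' \<in> borel_measurable borel" "set_integrable lborel (box a b) g'"
      "AE y in lebesgue. indicator (box a b) y *\<^sub>R g y = g' y" "\<And>y. y \<notin> box a b \<Longrightarrow> g' y = 0"
    and weak: "\<And>s t c d n. admissible_cutoffs a b i s t c d n \<Longrightarrow>
      (LINT y:box a b|lebesgue. partial_derivs [i] (tensor_cutoff i s t c d n) y *\<^sub>R f y)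
        = - (LINT y:box a b|lebesgue. tensor_cutoff i s t c d n y *\<^sub>R g y)"
  shows "acl_deriv a b i f g'"
proof (rule acl_deriv_of_tensor_tests[OF f g'(1,2)])
  fix s t c d n assume adm: "admissible_cutoffs a b i s t c d n"
  note \<phi> = tensor_cutoff_test_function[OF adm]
  have m: "tensor_cutoff i s t c d n \<in> borel_measurable borel"
    "partial_derivs [i] (tensor_cutoff i s t c d n) \<in> borel_measurable borel"
    using test_function_continuous[OF \<phi>, of UNIV "[]"] test_function_continuous[OF \<phi>, of UNIV "[i]"]
    by (auto intro: borel_measurable_continuous_onI)
  have "(\<lambda>y. indicator (box a b) y *\<^sub>R (partial_derivs [i] (tensor_cutoff i s t c d n) y *\<^sub>R f y))
      = (\<lambda>y. partial_derivs [i] (tensor_cutoff i s t c d n) y *\<^sub>R (indicator (box a b) y *\<^sub>R f y))"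
    by (simp add: fun_eq_iff mult.commute del: partial_derivs.simps)
  also have "\<dots> \<in> borel_measurable borel"
    by (rule borel_measurable_scaleR[OF m(2) indicator_scaleR_integrable_bounded(2)[OF f]])
  finally have "(LINT y:box a b|lborel. partial_derivs [i] (tensor_cutoff i s t c d n) y *\<^sub>R f y)
      = (LINT y:box a b|lebesgue. partial_derivs [i] (tensor_cutoff i s t c d n) y *\<^sub>R f y)"
    by (subst LINT_lebesgue_eq_lborel) (simp_all only: set_lebesgue_integral_def)
  also have "\<dots> = - (LINT y:box a b|lebesgue. tensor_cutoff i s t c d n y *\<^sub>R g y)" by (rule weak[OF adm])
  also have "(LINT y:box a b|lebesgue. tensor_cutoff i s t c d n y *\<^sub>R g y)
      = (LINT y|lborel. tensor_cutoff i s t c d n y *\<^sub>R g' y)"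
    by (rule LINT_cong_representative[OF m(1) g g'(1) g'(4) g'(3)])
  also have "\<dots> = (LINT y:box a b|lborel. tensor_cutoff i s t c d n y *\<^sub>R g' y)"
    unfolding set_lebesgue_integral_def
    by (rule Bochner_Integration.integral_cong) (use g'(4) in \<open>auto simp: indicator_def\<close>)
  finally show "(LINT y:box a b|lborel. partial_derivs [i] (tensor_cutoff i s t c d n) y *\<^sub>R f y)
      = - (LINT y:box a b|lborel. tensor_cutoff i s t c d n y *\<^sub>R g' y)" .
qed

lemma acl_deriv_C1:
  fixes v u :: "real ^ 2 \<Rightarrow> 'b::euclidean_space"
  assumes v: "bounded (v ` box a b)" and d: "\<And>y. y \<in> box a b \<Longrightarrow> v differentiable (at y)"
    and u: "continuous_on (box a b) u" "bounded (u ` box a b)"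
    and uv: "\<And>y. y \<in> box a b \<Longrightarrow> partial_deriv i v y = u y"
  shows "acl_deriv a b i v (\<lambda>y. indicator (box a b) y *\<^sub>R u y)"
  unfolding acl_deriv_def
proof (intro conjI v)
  show "continuous_on (box a b) v"
    by (intro continuous_at_imp_continuous_on ballI differentiable_imp_continuous_within d)
  show "(\<lambda>y. indicator (box a b) y *\<^sub>R u y) \<in> borel_measurable borel"
    by (rule indicator_scaleR_integrable_bounded(2)[OF u])
  have "(\<lambda>y. indicator (box a b) y *\<^sub>R (indicator (box a b) y *\<^sub>R u y)) = (\<lambda>y. indicator (box a b) y *\<^sub>R u y)"
    by (auto simp: fun_eq_iff indicator_def)
  then show "set_integrable lborel (box a b) (\<lambda>y. indicator (box a b) y *\<^sub>R u y)"
    using indicator_scaleR_integrable_bounded(1)[OF u] by (simp only: set_integrable_def)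
  have "ac_density (a $ i) (b $ i) (\<lambda>t. v (pt i t r)) (\<lambda>t. indicator (box a b) (pt i t r) *\<^sub>R u (pt i t r))"
    if r: "r \<in> {a $ other i<..<b $ other i}" for r
  proof (rule ac_density_cong[OF ac_density_C1 negligible_empty])
    show "continuous_on {a $ i<..<b $ i} (\<lambda>t. u (pt i t r))" by (rule continuous_on_box_line[OF u(1) r])
    fix t assume t: "a $ i < t" "t < b $ i"
    then have box: "pt i t r \<in> box a b" using r by (simp add: pt_in_box)
    then show "indicator (box a b) (pt i t r) *\<^sub>R u (pt i t r) = u (pt i t r)" by simp
    show "((\<lambda>t. v (pt i t r)) has_vector_derivative u (pt i t r)) (at t)"
      using has_vector_derivative_line[OF d[OF box]] uv[OF box] by simp
  qed
  then show "AE r in lborel. r \<in> {a $ other i<..<b $ other i} \<longrightarrow>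
      ac_density (a $ i) (b $ i) (\<lambda>t. v (pt i t r)) (\<lambda>t. indicator (box a b) (pt i t r) *\<^sub>R u (pt i t r))"
    by simp
qed

text \<open>Integrating by parts once, classically, moves one derivative from the test function to \<open>v\<close>. Applied to
  \<open>\<partial>\<^sub>l\<phi>\<close> this gives the first claim; the second follows from the symmetry of the mixed derivatives of the
  tensor cutoffs, and these suffice as test functions.\<close>

lemma second_weak_derivative:
  fixes v :: "real ^ 2 \<Rightarrow> 'b::euclidean_space" and u :: "2 \<Rightarrow> real ^ 2 \<Rightarrow> 'b"
  assumes v: "bounded (v ` box a b)" and d: "\<And>y. y \<in> box a b \<Longrightarrow> v differentiable (at y)"
    and u: "\<And>k. continuous_on (box a b) (u k)" "\<And>k. bounded (u k ` box a b)"
    and uv: "\<And>k y. y \<in> box a b \<Longrightarrow> partial_deriv k v y = u k y"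
    and g: "weak_deriv (box a b) [k, l] v g" "g absolutely_integrable_on box a b"
  obtains g' where "acl_deriv a b l (u k) g'" "acl_deriv a b k (u l) g'"
proof -
  obtain g' where g': "g' \<in> borel_measurable borel" "set_integrable lborel (box a b) g'"
    "AE y in lebesgue. indicator (box a b) y *\<^sub>R g y = g' y" "\<And>y. y \<notin> box a b \<Longrightarrow> g' y = 0"
    using borel_representative[OF g(2) borel_open[OF open_box]] by blast
  have ind: "(LINT y:box a b|lebesgue. \<phi> y *\<^sub>R (indicator (box a b) y *\<^sub>R h y))
      = (LINT y:box a b|lebesgue. \<phi> y *\<^sub>R h y)" for \<phi> :: "real ^ 2 \<Rightarrow> real" and h :: "real ^ 2 \<Rightarrow> 'b"
    unfolding set_lebesgue_integral_def
    by (rule Bochner_Integration.integral_cong) (auto simp: indicator_def)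
  have parts: "(LINT y:box a b|lebesgue. partial_deriv j \<phi> y *\<^sub>R v y) = - (LINT y:box a b|lebesgue. \<phi> y *\<^sub>R u j y)"
    if "\<phi> \<in> test_functions (box a b)" for j \<phi>
    using acl_deriv_imp_weak_deriv[OF acl_deriv_C1[OF v d u(1) u(2) uv[where k = j]]] that
    unfolding weak_deriv_def ind by simp
  have second: "(LINT y:box a b|lebesgue. partial_derivs [k, l] \<phi> y *\<^sub>R v y) = (LINT y:box a b|lebesgue. \<phi> y *\<^sub>R g y)"
    if "\<phi> \<in> test_functions (box a b)" for \<phi>
    using g(1) that unfolding weak_deriv_def by simp
  have first: "(LINT y:box a b|lebesgue. partial_derivs [i] \<phi> y *\<^sub>R u j y)
      = - (LINT y:box a b|lebesgue. \<phi> y *\<^sub>R g y)"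
    if \<phi>: "\<phi> \<in> test_functions (box a b)" and eq: "partial_derivs [j, i] \<phi> = partial_derivs [k, l] \<phi>" for i j \<phi>
  proof -
    have "(LINT y:box a b|lebesgue. partial_derivs [j, i] \<phi> y *\<^sub>R v y)
        = - (LINT y:box a b|lebesgue. partial_derivs [i] \<phi> y *\<^sub>R u j y)"
      using parts[OF test_functions_partial_deriv[OF \<phi>, of i], of j] by (simp only: partial_derivs.simps)
    then have "- (LINT y:box a b|lebesgue. partial_derivs [i] \<phi> y *\<^sub>R u j y)
        = (LINT y:box a b|lebesgue. \<phi> y *\<^sub>R g y)"
      unfolding eq second[OF \<phi>] by (rule sym)
    then show ?thesis by (simp only: equation_minus_iff)
  qed
  have "acl_deriv a b l (u k) g'"
  proof (rule acl_deriv_representative[OF u g(2) g'])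
    fix s t c d n assume "admissible_cutoffs a b l s t c d n"
    from first[OF tensor_cutoff_test_function[OF this] refl]
    show "(LINT y:box a b|lebesgue. partial_derivs [l] (tensor_cutoff l s t c d n) y *\<^sub>R u k y)
        = - (LINT y:box a b|lebesgue. tensor_cutoff l s t c d n y *\<^sub>R g y)" .
  qed
  moreover have "acl_deriv a b k (u l) g'"
  proof (rule acl_deriv_representative[OF u g(2) g'])
    fix s t c d n assume adm: "admissible_cutoffs a b k s t c d n"
    have "partial_derivs [l, k] (tensor_cutoff k s t c d n) = partial_derivs [k, l] (tensor_cutoff k s t c d n)"
    proof (cases "l = k")
      case True
      show ?thesis unfolding True by (rule refl)
    next
      case False
      then have l: "l = other k" by (simp only: neq_iff_other)
      show ?thesis unfolding l by (rule tensor_cutoff_partial_derivs(2)[symmetric])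
    qed
    from first[OF tensor_cutoff_test_function[OF adm] this]
    show "(LINT y:box a b|lebesgue. partial_derivs [k] (tensor_cutoff k s t c d n) y *\<^sub>R u l y)
        = - (LINT y:box a b|lebesgue. tensor_cutoff k s t c d n y *\<^sub>R g y)" .
  qed
  ultimately show ?thesis by (rule that)
qed

text \<open>The product rule for continuous Sobolev functions, read off from lines. The factors are cut off outside
  the box to obtain Borel functions on the plane.\<close>

lemma acl_deriv_inner:
  fixes f g :: "real ^ 2 \<Rightarrow> 'b::euclidean_space"
  assumes f: "acl_deriv a b i f f'" and g: "acl_deriv a b i g g'"
  shows "acl_deriv a b i (\<lambda>y. f y \<bullet> g y)
    (\<lambda>y. (indicator (box a b) y *\<^sub>R f y) \<bullet> g' y + f' y \<bullet> (indicator (box a b) y *\<^sub>R g y))"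
    and "integrable lborel (\<lambda>y. (indicator (box a b) y *\<^sub>R f y) \<bullet> g' y)"
proof -
  let ?I = "\<lambda>f y. indicator (box a b) y *\<^sub>R f y"
  note F = f[unfolded acl_deriv_def] and G = g[unfolded acl_deriv_def]
  have int: "integrable lborel (\<lambda>y. ?I h y \<bullet> k y)"
    if h: "continuous_on (box a b) h" "bounded (h ` box a b)"
      and k: "k \<in> borel_measurable borel" "set_integrable lborel (box a b) k" for h k :: "real ^ 2 \<Rightarrow> 'b"
  proof -
    obtain M where M: "\<forall>z\<in>h ` box a b. norm z \<le> M" using h(2) bounded_iff by metis
    show ?thesis
    proof (rule Bochner_Integration.integrable_bound[of _ "\<lambda>y. M *\<^sub>R ?I k y"])
      show "integrable lborel (\<lambda>y. M *\<^sub>R ?I k y)"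
        by (rule Bochner_Integration.integrable_scaleR_right) (use k(2) in \<open>simp add: set_integrable_def\<close>)
      show "(\<lambda>y. ?I h y \<bullet> k y) \<in> borel_measurable lborel"
        by (rule borel_measurable_inner) (use indicator_scaleR_integrable_bounded(2)[OF h] k(1) in simp_all)
      show "AE y in lborel. norm (?I h y \<bullet> k y) \<le> norm (M *\<^sub>R ?I k y)"
      proof (intro always_eventually allI)
        fix y show "norm (?I h y \<bullet> k y) \<le> norm (M *\<^sub>R ?I k y)"
        proof (cases "y \<in> box a b")
          case True
          then have "norm (h y) \<le> \<bar>M\<bar>" using M by force
          then have "norm (h y) * norm (k y) \<le> \<bar>M\<bar> * norm (k y)" by (rule mult_right_mono) simp
          with Cauchy_Schwarz_ineq2[of "h y" "k y"] show ?thesis using True by simp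
        qed simp
      qed
    qed
  qed
  have i1: "integrable lborel (\<lambda>y. ?I f y \<bullet> g' y)" and i2: "integrable lborel (\<lambda>y. f' y \<bullet> ?I g y)"
    using int[of f g'] int[of g f'] F G by (auto simp: inner_commute)
  show "integrable lborel (\<lambda>y. ?I f y \<bullet> g' y)" by (rule i1)
  let ?h = "\<lambda>y. ?I f y \<bullet> g' y + f' y \<bullet> ?I g y"
  have hint: "integrable lborel ?h" using i1 i2 by simp
  show "acl_deriv a b i (\<lambda>y. f y \<bullet> g y) ?h"
    unfolding acl_deriv_def
  proof (intro conjI)
    show "continuous_on (box a b) (\<lambda>y. f y \<bullet> g y)" using F G by (intro continuous_intros) auto
    show "bounded ((\<lambda>y. f y \<bullet> g y) ` box a b)"
    proof -
      obtain M N where "\<forall>z\<in>f ` box a b. norm z \<le> M" "\<forall>z\<in>g ` box a b. norm z \<le> N"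
        using F G unfolding bounded_iff by blast
      then have MN: "norm (f y) \<le> M" "norm (g y) \<le> N" if "y \<in> box a b" for y using that by auto
      have "norm (f y \<bullet> g y) \<le> M * N" if y: "y \<in> box a b" for y
      proof -
        have "0 \<le> M" using MN(1)[OF y] norm_ge_zero[of "f y"] by linarith
        then have "norm (f y) * norm (g y) \<le> M * N" by (intro mult_mono MN y) auto
        then show ?thesis using Cauchy_Schwarz_ineq2[of "f y" "g y"] by simp
      qed
      then show ?thesis unfolding bounded_iff by blast
    qed
    show "?h \<in> borel_measurable borel" using borel_measurable_integrable[OF hint] by simp
    show "set_integrable lborel (box a b) ?h"
      unfolding set_integrable_def by (rule integrable_mult_indicator[OF _ hint]) simp
    show "AE r in lborel. r \<in> {a $ other i<..<b $ other i} \<longrightarrow>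
      ac_density (a $ i) (b $ i) (\<lambda>t. f (pt i t r) \<bullet> g (pt i t r)) (\<lambda>t. ?h (pt i t r))"
      using F[THEN conjunct2, THEN conjunct2, THEN conjunct2, THEN conjunct2]
        G[THEN conjunct2, THEN conjunct2, THEN conjunct2, THEN conjunct2]
    proof eventually_elim
      case (elim r)
      show ?case
      proof
        assume r: "r \<in> {a $ other i<..<b $ other i}"
        note ac = ac_density_bilinear[OF bounded_bilinear_inner elim(1)[rule_format, OF r] elim(2)[rule_format, OF r]]
        show "ac_density (a $ i) (b $ i) (\<lambda>t. f (pt i t r) \<bullet> g (pt i t r)) (\<lambda>t. ?h (pt i t r))"
          by (rule ac_density_cong[OF ac negligible_empty]) (use r in \<open>simp add: pt_in_box\<close>)
      qed
    qed
  qed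
qed

text \<open>Every interval in \<open>(a,b)\<close> is exhausted by intervals away from the ends.\<close>

lemma AE_zero_if_inner_interval_integrals_zero:
  fixes f :: "real \<Rightarrow> 'b::euclidean_space"
  assumes f: "integrable lborel f" and out: "\<And>x. x \<notin> {a<..<b} \<Longrightarrow> f x = 0"
    and zero: "\<And>c d. a < c \<Longrightarrow> c < d \<Longrightarrow> d < b \<Longrightarrow> (LINT x|lborel. indicator {c<..<d} x *\<^sub>R f x) = 0"
  shows "AE x in lborel. f x = 0"
proof (rule AE_zero_if_interval_integrals_zero[OF f out])
  fix c d assume cd: "a \<le> c" "c < d" "d \<le> b"
  \<comment> \<open>the shift by three keeps the shrunken interval nonempty from the first index on\<close>
  define e where "e n = (d - c) * inverse (real (Suc (Suc (Suc n))))" for n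
  have e: "0 < e n" "c + e n < d - e n" for n
  proof -
    show "0 < e n" using cd by (simp add: e_def)
    have "2 * inverse (real (Suc (Suc (Suc n)))) < 1" by (simp add: field_simps)
    then have "2 * e n < d - c" using cd mult_strict_left_mono[of _ 1 "d - c"] by (fastforce simp: e_def)
    then show "c + e n < d - e n" by simp
  qed
  have e0: "e \<longlonglongrightarrow> 0"
  proof -
    have "(\<lambda>n. inverse (real (Suc (Suc (Suc n))))) \<longlonglongrightarrow> 0"
      using LIMSEQ_ignore_initial_segment[OF LIMSEQ_inverse_real_of_nat, of 2] by simp
    from tendsto_mult_right_zero[OF this, of "d - c"] show ?thesis by (simp add: e_def[abs_def])
  qed
  have "(\<lambda>n. LINT x|lborel. indicator {c + e n<..<d - e n} x *\<^sub>R f x) \<longlonglongrightarrow> (LINT x|lborel. indicator {c<..<d} x *\<^sub>R f x)"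
  proof (rule integral_dominated_convergence[where w = "\<lambda>x. norm (f x)"])
    show "AE x in lborel. (\<lambda>n. indicator {c + e n<..<d - e n} x *\<^sub>R f x) \<longlonglongrightarrow> indicator {c<..<d} x *\<^sub>R f x"
    proof (intro always_eventually allI tendsto_scaleR tendsto_const)
      fix x
      show "(\<lambda>n. indicator {c + e n<..<d - e n} x) \<longlonglongrightarrow> (indicator {c<..<d} x :: real)"
      proof (cases "x \<in> {c<..<d}")
        case True
        then have "eventually (\<lambda>n. e n < x - c) sequentially" "eventually (\<lambda>n. e n < d - x) sequentially"
          using order_tendstoD(2)[OF e0] by auto
        then have "eventually (\<lambda>n. indicator {c + e n<..<d - e n} x = (1::real)) sequentially"
          by eventually_elim (auto simp: indicator_def)
        then show ?thesis using True by (simp add: tendsto_eventually)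
      next
        case False
        then have "x \<notin> {c + e n<..<d - e n}" for n using e(1)[of n] by auto
        then show ?thesis using False by simp
      qed
    qed
    show "AE x in lborel. norm (indicator {c + e n<..<d - e n} x *\<^sub>R f x) \<le> norm (f x)" for n
      by (auto simp: indicator_def)
  qed (use f in \<open>auto intro: borel_measurable_integrable\<close>)
  moreover have "(LINT x|lborel. indicator {c + e n<..<d - e n} x *\<^sub>R f x) = 0" for n
    using zero[of "c + e n" "d - e n"] e[of n] cd by simp
  ultimately have "(\<lambda>n::nat. 0) \<longlonglongrightarrow> (LINT x|lborel. indicator {c<..<d} x *\<^sub>R f x)"
    by (simp only:)
  from LIMSEQ_unique[OF this tendsto_const] show "(LINT x|lborel. indicator {c<..<d} x *\<^sub>R f x) = 0" .
qed

text \<open>The derivative of \<open>|f|\<^sup>2 = 1\<close> vanishes.\<close>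

lemma acl_deriv_unit:
  fixes f g :: "real ^ 2 \<Rightarrow> 'b::euclidean_space"
  assumes f: "acl_deriv a b i f g" and unit: "\<And>y. y \<in> box a b \<Longrightarrow> norm (f y) = 1"
  shows "AE y in lborel. y \<in> box a b \<longrightarrow> f y \<bullet> g y = 0"
proof -
  let ?q = "\<lambda>y. (indicator (box a b) y *\<^sub>R f y) \<bullet> g y"
  note int = acl_deriv_inner(2)[OF f f]
  have "AE y in lborel. ?q y = 0"
  proof (rule AE_linesI)
    show "{y. ?q y = 0} \<in> sets borel"
      using borel_measurable_integrable[OF int] by measurable
    show "AE r in lborel. AE t in lborel. ?q (pt i t r) = 0"
      using acl_deriv_inner(1)[OF f f, unfolded acl_deriv_def, THEN conjunct2, THEN conjunct2, THEN conjunct2, THEN conjunct2]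
        integral_lines(1)[OF int, of i]
    proof eventually_elim
      case (elim r)
      show ?case
      proof (cases "r \<in> {a $ other i<..<b $ other i}")
        case False
        then show ?thesis by (simp add: pt_in_box)
      next
        case True
        note ac = elim(1)[rule_format, OF True]
        show ?thesis
        proof (rule AE_zero_if_inner_interval_integrals_zero[OF elim(2)])
          show "?q (pt i t r) = 0" if "t \<notin> {a $ i<..<b $ i}" for t
            using that by (auto simp: pt_in_box)
          fix c d assume cd: "a $ i < c" "c < d" "d < b $ i"
          have box: "pt i t r \<in> box a b" if "t \<in> {c..d}" for t using that cd True by (simp add: pt_in_box)
          have "set_integrable lborel {c<..<d} (\<lambda>t. ?q (pt i t r))"
            unfolding set_integrable_def by (rule integrable_mult_indicator[OF _ elim(2)]) simp
          from set_borel_integral_eq_integral(2)[OF this]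
          have "(LINT t|lborel. indicator {c<..<d} t *\<^sub>R ?q (pt i t r)) = integral {c..d} (\<lambda>t. ?q (pt i t r))"
            by (simp add: set_lebesgue_integral_def integral_open_interval_real)
          also have "2 * \<dots> = integral {c..d} (\<lambda>t. 2 * ?q (pt i t r))" by simp
          also have "\<dots> = integral {c..d} (\<lambda>t. ?q (pt i t r) + g (pt i t r) \<bullet> (indicator (box a b) (pt i t r) *\<^sub>R f (pt i t r)))"
            by (rule Henstock_Kurzweil_Integration.integral_cong) (simp add: inner_commute)
          also have "\<dots> = f (pt i d r) \<bullet> f (pt i d r) - f (pt i c r) \<bullet> f (pt i c r)"
            by (rule ac_densityD(2)[OF ac]) (use cd in auto)
          also have "\<dots> = 0"
            using unit[OF box, of c] unit[OF box, of d] cd by (simp add: norm_eq_1)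
          finally show "(LINT t|lborel. indicator {c<..<d} t *\<^sub>R ?q (pt i t r)) = 0" by simp
        qed
      qed
    qed
  qed
  then show ?thesis by eventually_elim auto
qed

section \<open>Gradients with a single slip system\<close>

lemma strip_eq_box: "strip L h = box (pt 1 0 (- h)) (pt 1 L h)"
proof -
  have "pt 1 t r $ 1 = t" "pt 1 t r $ 2 = r" for t r
    by (simp_all add: pt_def)
  then show ?thesis by (auto simp: strip_def mem_box_cart forall_2)
qed

lemma vector_eq_pt: "vector [t, r] = pt 1 t r"
  by (simp add: vec_eq_iff forall_2 pt_def)

definition slip_gradient :: "real \<Rightarrow> real \<Rightarrow> real ^ 2 ^ 2" where
  "slip_gradient t g = rotation t ** (mat 1 + g *\<^sub>R tensor (axis 1 1) (axis 2 1))"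

lemma slip_gradient_nth:
  "slip_gradient t g $ 1 $ 1 = cos t" "slip_gradient t g $ 2 $ 1 = sin t"
  "slip_gradient t g $ 1 $ 2 = g * cos t - sin t" "slip_gradient t g $ 2 $ 2 = g * sin t + cos t"
  by (simp_all add: slip_gradient_def rotation_def tensor_def matrix_matrix_mult_def mat_def axis_def sum_2 mult.commute)

lemma energy_density_slip_gradient:
  assumes "s = axis 1 1 \<or> s = - axis 1 1"
  shows "energy_density s (slip_gradient t g) = ennreal (g\<^sup>2)"
proof -
  let ?F = "slip_gradient t g"
  have det: "det ?F = 1"
    unfolding det_2 slip_gradient_nth using sin_cos_squared_add[of t] by (simp add: algebra_simps power2_eq_square)
  have e1: "?F *v axis 1 1 = vector [cos t, sin t]" and e2: "?F *v axis 2 1 = vector [g * cos t - sin t, g * sin t + cos t]"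
    by (simp_all add: vec_eq_iff forall_2 matrix_vector_mult_basis column_def slip_gradient_nth)
  have n1: "norm (?F *v axis 1 1) = 1" unfolding e1 by (simp add: norm_vec_def L2_set_def sum_2)
  have "(norm (?F *v axis 2 1))\<^sup>2 = (g * cos t - sin t)\<^sup>2 + (g * sin t + cos t)\<^sup>2"
    unfolding e2 power2_norm_eq_inner by (simp add: inner_vec_def sum_2 power2_eq_square)
  also have "\<dots> = 1 + g\<^sup>2" using sin_cos_squared_add[of t] by algebra
  finally have n2: "(norm (?F *v axis 2 1))\<^sup>2 = 1 + g\<^sup>2" .
  have p: "perp (axis 1 1) = axis 2 1" "perp (- axis 1 1) = - axis 2 1"
    by (simp_all add: perp_def vec_eq_iff forall_2 axis_def)
  have neg: "?F *v (- w) = - (?F *v w)" for w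
    by (simp add: vec_eq_iff matrix_vector_mult_def sum_negf)
  show ?thesis using assms n1 n2 det by (auto simp: energy_density_def p neg)
qed

lemma AE_lebesgue_on_iff: "S \<in> sets lebesgue \<Longrightarrow> (AE y in lebesgue_on S. P y) \<longleftrightarrow> (AE y in lebesgue. y \<in> S \<longrightarrow> P y)"
  by (rule AE_restrict_space_iff) simp

text \<open>The exceptional set is open and negligible, hence empty.\<close>

lemma AE_eq_const_continuous:
  fixes f :: "'a::euclidean_space \<Rightarrow> real"
  assumes S: "open S" and f: "continuous_on S f" and ae: "AE y in lebesgue. y \<in> S \<longrightarrow> f y = c" and y: "y \<in> S"
  shows "f y = c"
proof (rule ccontr)
  assume "f y \<noteq> c"
  let ?N = "S \<inter> f -` (- {c})"
  have "open ?N" by (rule continuous_open_preimage[OF f S]) auto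
  moreover have "?N \<noteq> {}" using y \<open>f y \<noteq> c\<close> by auto
  moreover have "negligible ?N"
  proof -
    obtain N where N: "N \<in> null_sets lebesgue" "{y \<in> space lebesgue. \<not> (y \<in> S \<longrightarrow> f y = c)} \<subseteq> N"
      using ae unfolding eventually_ae_filter by blast
    have "?N \<subseteq> N" using N(2) by auto
    moreover have "negligible N" using N(1) by (simp add: negligible_iff_null_sets)
    ultimately show ?thesis by (rule negligible_subset[rotated])
  qed
  ultimately show False using open_not_negligible by blast
qed

text \<open>Only integrals of \<open>f\<close> enter the definition, so \<open>f\<close> may be replaced by its continuous representative \<open>k\<close>.\<close>

lemma sobolev_W1_of_acl_deriv:
  fixes f k :: "real ^ 2 \<Rightarrow> 'b::euclidean_space"
  assumes k: "continuous_on (box a b) k" "bounded (k ` box a b)"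
    and ae: "AE y in lebesgue. y \<in> box a b \<longrightarrow> f y = k y"
    and acl: "\<And>i. \<exists>g. acl_deriv a b i k g"
  shows "sobolev_W1 1 (box a b) f"
proof -
  let ?k = "\<lambda>y. indicator (box a b) y *\<^sub>R k y"
  have km: "?k \<in> borel_measurable borel" by (rule indicator_scaleR_integrable_bounded(2)[OF k])
  have kint: "k absolutely_integrable_on box a b"
    using indicator_scaleR_integrable_bounded(1)[OF k] km
    by (simp add: set_integrable_def integrable_completion)
  obtain N where N: "N \<in> null_sets lebesgue" "{y \<in> space lebesgue. \<not> (y \<in> box a b \<longrightarrow> f y = k y)} \<subseteq> N"
    using ae unfolding eventually_ae_filter by blast
  have fint: "f absolutely_integrable_on box a b"
  proof (rule absolutely_integrable_spike[OF kint])
    show "negligible N" using N(1) by (simp add: negligible_iff_null_sets)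
  qed (use N(2) in auto)
  have aef: "AE y in lebesgue. indicator (box a b) y *\<^sub>R f y = ?k y"
    using ae by eventually_elim (auto simp: indicator_def)
  have LINT_eq: "(LINT y:box a b|lebesgue. c y *\<^sub>R f y) = (LINT y:box a b|lebesgue. c y *\<^sub>R k y)"
    if "c \<in> borel_measurable borel" for c
    using LINT_cong_representative[OF that fint km _ aef] LINT_cong_representative[OF that kint km]
    by simp
  show ?thesis
    unfolding sobolev_W1_def
  proof (intro conjI allI impI fint)
    fix "is" :: "2 list" assume "length is \<le> 1"
    then consider "is = []" | i where "is = [i]" by (cases "is") auto
    then show "\<exists>g. g absolutely_integrable_on box a b \<and> weak_deriv (box a b) is f g"
    proof cases
      case 1
      then show ?thesis using fint by (intro exI[of _ f]) (simp add: weak_deriv_def)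
    next
      case 2
      obtain g where g: "acl_deriv a b i k g" using acl by blast
      have "g absolutely_integrable_on box a b"
      proof -
        have "integrable lborel (\<lambda>y. indicator (box a b) y *\<^sub>R g y)"
          using g by (simp add: acl_deriv_def set_integrable_def)
        then show ?thesis
          using borel_measurable_integrable by (simp add: set_integrable_def integrable_completion)
      qed
      moreover have "weak_deriv (box a b) [i] f g"
        unfolding weak_deriv_def
      proof
        fix \<phi> assume \<phi>: "\<phi> \<in> test_functions (box a b)"
        have "partial_derivs [i] \<phi> \<in> borel_measurable borel"
          by (intro borel_measurable_continuous_onI test_function_continuous[OF \<phi>])
        from LINT_eq[OF this] acl_deriv_imp_weak_deriv[OF g, unfolded weak_deriv_def, rule_format, OF \<phi>]
        show "(LINT y:box a b|lebesgue. partial_derivs [i] \<phi> y *\<^sub>R f y)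
            = (- 1) ^ length [i] *\<^sub>R (LINT y:box a b|lebesgue. \<phi> y *\<^sub>R g y)" by (simp only:)
      qed
      ultimately show ?thesis using 2 by blast
    qed
  qed
qed

lemma ac_density_linear:
  assumes T: "bounded_linear T" and f: "ac_density a b f f'"
  shows "ac_density a b (\<lambda>t. T (f t)) (\<lambda>t. T (f' t))"
  unfolding ac_density_def
proof (intro conjI allI impI)
  interpret bounded_linear T by fact
  show "continuous_on {a<..<b} (\<lambda>t. T (f t))"
    using f unfolding ac_density_def by (intro continuous_on) auto
  fix s t assume st: "a < s" "s \<le> t" "t < b"
  note D = ac_densityD[OF f st]
  show "(\<lambda>t. T (f' t)) absolutely_integrable_on {s..t}"
    using absolutely_integrable_linear[OF D(1) T] by (simp add: o_def)
  show "integral {s..t} (\<lambda>t. T (f' t)) = T (f t) - T (f s)"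
    using integral_linear[OF D(4) T] D(2) by (simp add: o_def diff)
qed

definition complex_of_vec :: "real ^ 2 \<Rightarrow> complex" where
  "complex_of_vec w = Complex (w $ 1) (w $ 2)"

lemma bounded_linear_complex_of_vec: "bounded_linear complex_of_vec"
proof -
  have "complex_of_vec = (\<lambda>w. complex_of_real (w $ 1) + \<i> * complex_of_real (w $ 2))"
    by (simp add: fun_eq_iff complex_of_vec_def Complex_eq)
  moreover have "bounded_linear (\<lambda>w::real^2. complex_of_real (w $ 1) + \<i> * complex_of_real (w $ 2))"
    by (intro bounded_linear_add bounded_linear_const_mult bounded_linear_compose[OF bounded_linear_of_real]
        bounded_linear_vec_nth)
  ultimately show ?thesis by simp
qed

lemma complex_of_vec_perp: "complex_of_vec (c *\<^sub>R perp w) = \<i> * complex_of_real c * complex_of_vec w"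
  by (simp add: complex_of_vec_def perp_def complex_eq_iff)

lemma norm_complex_of_vec [simp]: "norm (complex_of_vec w) = norm w"
  by (simp add: complex_of_vec_def cmod_def norm_vec_def L2_set_def sum_2)

lemma eq_inner_perp:
  fixes u g :: "real ^ 2"
  assumes "norm u = 1" "u \<bullet> g = 0"
  shows "g = (g \<bullet> perp u) *\<^sub>R perp u"
proof -
  have n: "u $ 1 * u $ 1 + u $ 2 * u $ 2 = 1"
    using assms(1) by (simp add: norm_eq_1 inner_vec_def sum_2)
  have o: "u $ 1 * g $ 1 + u $ 2 * g $ 2 = 0" using assms(2) by (simp add: inner_vec_def sum_2)
  have "g $ 1 = (g $ 1 * (- (u $ 2)) + g $ 2 * u $ 1) * (- (u $ 2))"
    using n o by algebra
  moreover have "g $ 2 = (g $ 1 * (- (u $ 2)) + g $ 2 * u $ 1) * u $ 1"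
    using n o by algebra
  ultimately show ?thesis
    by (simp add: vec_eq_iff forall_2 perp_def inner_vec_def sum_2)
qed

lemma cos_ge_one_minus_half_square: "1 - x\<^sup>2 / 2 \<le> cos (x::real)"
proof -
  have "\<bar>sin (x / 2)\<bar> \<le> \<bar>x / 2\<bar>" by (rule abs_sin_x_le_abs_x)
  then have "(sin (x / 2))\<^sup>2 \<le> (x / 2)\<^sup>2" by (rule abs_le_square_iff[THEN iffD1])
  moreover have "cos x = 1 - 2 * (sin (x / 2))\<^sup>2" using cos_double_sin[of "x / 2"] by simp
  ultimately show ?thesis by (simp add: power_divide)
qed

text \<open>The displacement \<open>V L - V 0\<close> is the integral of the unit tangent \<open>e\<^sup>i\<^sup>g z\<close>. Its component along \<open>z\<close> is
  \<open>\<integral> cos g\<close>, which is nearly \<open>L\<close> unless \<open>g\<close> is large in the quadratic mean.\<close>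

lemma rotating_curve_energy_bound:
  fixes V U :: "real \<Rightarrow> real ^ 2" and g :: "real \<Rightarrow> real"
  assumes L: "0 < L" and V: "continuous_on {0..L} V"
    and VU: "\<And>t. 0 < t \<Longrightarrow> t < L \<Longrightarrow> (V has_vector_derivative U t) (at t)"
    and U: "\<And>t. 0 < t \<Longrightarrow> t < L \<Longrightarrow> complex_of_vec (U t) = cis (g t) * z" and z: "norm z = 1"
    and g: "continuous_on {0..L} g" and short: "norm (V 0 - V L) \<le> \<delta> * L"
  shows "2 * L * (1 - \<delta>) \<le> integral {0..L} (\<lambda>t. (g t)\<^sup>2)"
proof -
  define l where "l w = Re (cnj z * complex_of_vec w)" for w
  have l: "bounded_linear l"
    unfolding l_def[abs_def]
    by (intro bounded_linear_compose[OF bounded_linear_Re] bounded_linear_const_mult bounded_linear_complex_of_vec)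
  have "(U has_integral (V L - V 0)) {0..L}"
    by (rule fundamental_theorem_of_calculus_interior) (use L V VU in auto)
  from has_integral_linear[OF this l]
  have "((\<lambda>t. l (U t)) has_integral l (V L - V 0)) {0..L}" by (simp add: o_def)
  then have cos: "((\<lambda>t. cos (g t)) has_integral l (V L - V 0)) {0..L}"
  proof (rule has_integral_spike_finite[of "{0, L}", rotated 2])
    fix t assume t: "t \<in> {0..L} - {0, L}"
    have eq: "cnj z * (cis (g t) * z) = cis (g t) * complex_of_real ((norm z)\<^sup>2)"
      unfolding complex_norm_square by (simp only: mult_ac)
    have "complex_of_vec (U t) = cis (g t) * z" using U[of t] t by auto
    then have "l (U t) = Re (cis (g t) * complex_of_real ((norm z)\<^sup>2))"
      unfolding l_def by (simp only: eq)
    then show "cos (g t) = l (U t)" using z by simp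
  qed simp
  have g2: "(\<lambda>t. (g t)\<^sup>2) integrable_on {0..L}"
    by (intro integrable_continuous_real continuous_intros g)
  have "((\<lambda>t. 1 - (g t)\<^sup>2 / 2) has_integral (L - integral {0..L} (\<lambda>t. (g t)\<^sup>2) / 2)) {0..L}"
  proof (rule has_integral_diff)
    show "((\<lambda>t. 1::real) has_integral L) {0..L}" using has_integral_const_real[of "1::real" 0 L] L by simp
    show "((\<lambda>t. (g t)\<^sup>2 / 2) has_integral integral {0..L} (\<lambda>t. (g t)\<^sup>2) / 2) {0..L}"
      by (rule has_integral_divide[OF integrable_integral[OF g2]])
  qed
  from has_integral_le[OF this cos] cos_ge_one_minus_half_square
  have "L - integral {0..L} (\<lambda>t. (g t)\<^sup>2) / 2 \<le> l (V L - V 0)" by blast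
  also have "\<dots> \<le> norm (cnj z * complex_of_vec (V L - V 0))"
    unfolding l_def by (rule complex_Re_le_cmod)
  also have "\<dots> \<le> \<delta> * L" using short z by (simp add: norm_mult norm_minus_commute)
  finally show ?thesis by (simp add: algebra_simps)
qed

section \<open>The lower bound\<close>

lemma closure_strip:
  assumes "0 < L" "0 < h"
  shows "closure (box (pt 1 0 (- h)) (pt 1 L h)) = cbox (pt 1 0 (- h)) (pt 1 L h)"
proof -
  have "pt 1 (L / 2) 0 \<in> box (pt 1 0 (- h)) (pt 1 L h)"
    using assms by (simp add: pt_in_box)
  then show ?thesis by (intro closure_box) auto
qed

lemma pt_in_cbox: "pt i t r \<in> cbox a b \<longleftrightarrow> t \<in> {a $ i..b $ i} \<and> r \<in> {a $ other i..b $ other i}"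
  by (simp add: mem_box_cart all_coords[of _ i] conj_commute)

lemma jacobian_nth: "jacobian v (at y) $ i $ k = partial_deriv k v y $ i"
  by (simp add: jacobian_def matrix_def partial_deriv_def)

text \<open>A deformation of the strip as in the theorem; the strip is written as a box. Below, \<open>grad_ext\<close> is the
  continuous extension of the gradient, \<open>column_ext k\<close> its \<open>k\<close>-th column, that is the extension of \<open>\<partial>\<^sub>kv\<close>, and
  \<open>shear\<close> the continuous representative of \<open>\<gamma>\<close>.\<close>

context
  fixes L h :: real and v :: "real ^ 2 \<Rightarrow> real ^ 2" and \<theta> \<gamma> :: "real ^ 2 \<Rightarrow> real"
    and a b :: "real ^ 2"
  assumes L: "0 < L" and h: "0 < h"
  defines "a \<equiv> pt 1 0 (- h)" and "b \<equiv> pt 1 L h"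
  assumes W21: "sobolev_W1 2 (box a b) v" and C1: "C1_closure (box a b) v"
    and grad: "AE y in lebesgue. y \<in> box a b \<longrightarrow> jacobian v (at y) = slip_gradient (\<theta> y) (\<gamma> y)"
begin

lemma ab_nth [simp]: "a $ 1 = 0" "b $ 1 = L" "a $ other 1 = - h" "b $ other 1 = h"
  by (simp_all add: a_def b_def)

lemma closure_ab: "closure (box a b) = cbox a b"
  unfolding a_def b_def by (rule closure_strip[OF L h])

definition grad_ext where "grad_ext = (SOME grad_ext. continuous_on (cbox a b) grad_ext \<and> (\<forall>x\<in>box a b. grad_ext x = jacobian v (at x)))"

lemma grad_ext: "continuous_on (cbox a b) grad_ext" "y \<in> box a b \<Longrightarrow> grad_ext y = jacobian v (at y)"
proof -
  have "\<exists>grad_ext. continuous_on (cbox a b) grad_ext \<and> (\<forall>x\<in>box a b. grad_ext x = jacobian v (at x))"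
    using C1 unfolding C1_closure_def closure_ab by blast
  from someI_ex[OF this, folded grad_ext_def]
  show "continuous_on (cbox a b) grad_ext" "y \<in> box a b \<Longrightarrow> grad_ext y = jacobian v (at y)" by auto
qed

definition column_ext where "column_ext k y = (\<chi> i. grad_ext y $ i $ k)"

lemma column_ext_continuous: "continuous_on (cbox a b) (column_ext k)"
  unfolding column_ext_def[abs_def] by (intro continuous_intros grad_ext)

lemma column_ext_continuous_box: "continuous_on (box a b) (column_ext k)"
  by (rule continuous_on_subset[OF column_ext_continuous box_subset_cbox])

lemma bounded_box_image: "continuous_on (cbox a b) f \<Longrightarrow> bounded (f ` box a b)"
  by (rule bounded_subset[OF compact_imp_bounded[OF compact_continuous_image[OF _ compact_cbox]]])
     (auto intro!: image_mono box_subset_cbox)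

lemma column_ext_partial: "y \<in> box a b \<Longrightarrow> partial_deriv k v y = column_ext k y"
  by (simp add: column_ext_def grad_ext vec_eq_iff jacobian_nth)

lemma v_differentiable: "y \<in> box a b \<Longrightarrow> v differentiable (at y)"
  using C1 by (simp add: C1_closure_def)

lemma v_continuous: "continuous_on (cbox a b) v"
  using C1 unfolding C1_closure_def closure_ab by blast

definition shear where "shear y = column_ext 1 y \<bullet> column_ext 2 y"

lemma shear_continuous: "continuous_on (cbox a b) shear"
  unfolding shear_def[abs_def] by (intro continuous_intros column_ext_continuous)

lemma AE_columns: "AE y in lebesgue. y \<in> box a b \<longrightarrow>
    column_ext 1 y = circle_point (\<theta> y) \<and> column_ext 2 y = \<gamma> y *\<^sub>R circle_point (\<theta> y) + perp (circle_point (\<theta> y))"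
  using grad
proof eventually_elim
  case (elim y)
  show ?case
  proof
    assume y: "y \<in> box a b"
    with elim have "grad_ext y = slip_gradient (\<theta> y) (\<gamma> y)" by (simp add: grad_ext)
    then show "column_ext 1 y = circle_point (\<theta> y) \<and> column_ext 2 y = \<gamma> y *\<^sub>R circle_point (\<theta> y) + perp (circle_point (\<theta> y))"
      by (simp add: column_ext_def vec_eq_iff forall_2 slip_gradient_nth circle_point_def perp_def)
  qed
qed

lemma inner_circle_point: "circle_point t \<bullet> circle_point t = 1" "circle_point t \<bullet> perp (circle_point t) = 0"
  "perp (circle_point t) \<bullet> perp (circle_point t) = 1"
  using sin_cos_squared_add[of t] by (simp_all add: circle_point_def perp_def inner_vec_def sum_2 power2_eq_square)

lemma AE_shear: "AE y in lebesgue. y \<in> box a b \<longrightarrow> \<gamma> y = shear y"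
  using AE_columns by eventually_elim (auto simp: shear_def inner_add_right inner_circle_point)

text \<open>Almost everywhere this is the gradient condition, and both sides are continuous.\<close>

lemma norm_column_ext_1: "y \<in> box a b \<Longrightarrow> norm (column_ext 1 y) = 1"
proof (rule AE_eq_const_continuous[where f = "\<lambda>y. norm (column_ext 1 y)", OF open_box[of a b]])
  show "continuous_on (box a b) (\<lambda>y. norm (column_ext 1 y))" by (intro continuous_intros column_ext_continuous_box)
  show "AE y in lebesgue. y \<in> box a b \<longrightarrow> norm (column_ext 1 y) = 1"
    using AE_columns by eventually_elim (auto simp: norm_eq_1 inner_circle_point)
qed

lemma perp_column_ext_1_2: "y \<in> box a b \<Longrightarrow> perp (column_ext 1 y) \<bullet> column_ext 2 y = 1"
proof (rule AE_eq_const_continuous[where f = "\<lambda>y. perp (column_ext 1 y) \<bullet> column_ext 2 y", OF open_box[of a b]])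
  have "perp w \<bullet> w' = w $ 1 * w' $ 2 - w $ 2 * w' $ 1" for w w'
    by (simp add: perp_def inner_vec_def sum_2)
  then show "continuous_on (box a b) (\<lambda>y. perp (column_ext 1 y) \<bullet> column_ext 2 y)"
    by (simp only:) (intro continuous_intros column_ext_continuous_box)
  show "AE y in lebesgue. y \<in> box a b \<longrightarrow> perp (column_ext 1 y) \<bullet> column_ext 2 y = 1"
    using AE_columns
    by eventually_elim (auto simp: inner_add_right inner_circle_point inner_commute[of "perp _" "circle_point _"])
qed

lemma second_derivatives:
  obtains g where "acl_deriv a b l (column_ext k) g" "acl_deriv a b k (column_ext l) g"
proof -
  obtain w where w: "w absolutely_integrable_on box a b" "weak_deriv (box a b) [k, l] v w"
    using W21 unfolding sobolev_W1_def by force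
  show ?thesis
    by (rule second_weak_derivative[OF bounded_box_image[OF v_continuous] v_differentiable
          column_ext_continuous_box bounded_box_image[OF column_ext_continuous] column_ext_partial w(2,1)])
       (auto intro: that)
qed

lemma regularity:
  "sobolev_W1 1 (box a b) \<gamma>" "C0_closure_ae (box a b) \<gamma>"
  "sobolev_W1 1 (box a b) (\<lambda>y. circle_point (\<theta> y))" "C0_closure_ae (box a b) (\<lambda>y. circle_point (\<theta> y))"
proof -
  have ae_u: "AE y in lebesgue. y \<in> box a b \<longrightarrow> circle_point (\<theta> y) = column_ext 1 y"
    using AE_columns by eventually_elim auto
  have column_ext_acl: "\<exists>g. acl_deriv a b i (column_ext k) g" for i k by (rule second_derivatives) blast
  show "sobolev_W1 1 (box a b) (\<lambda>y. circle_point (\<theta> y))"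
    by (rule sobolev_W1_of_acl_deriv[OF column_ext_continuous_box bounded_box_image[OF column_ext_continuous] ae_u column_ext_acl])
  show "sobolev_W1 1 (box a b) \<gamma>"
  proof (rule sobolev_W1_of_acl_deriv[OF continuous_on_subset[OF shear_continuous box_subset_cbox]
        bounded_box_image[OF shear_continuous] AE_shear])
    fix i
    obtain g1 g2 where "acl_deriv a b i (column_ext 1) g1" "acl_deriv a b i (column_ext 2) g2" using column_ext_acl by meson
    from acl_deriv_inner(1)[OF this] show "\<exists>g. acl_deriv a b i shear g"
      unfolding shear_def[abs_def] by blast
  qed
  show "C0_closure_ae (box a b) \<gamma>"
    unfolding C0_closure_ae_def closure_ab
    using shear_continuous AE_shear by (auto simp: AE_lebesgue_on_iff)
  show "C0_closure_ae (box a b) (\<lambda>y. circle_point (\<theta> y))"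
    unfolding C0_closure_ae_def closure_ab
    using column_ext_continuous ae_u by (auto simp: AE_lebesgue_on_iff)
qed

text \<open>Here \<open>g11\<close> and \<open>g12\<close> are the weak derivatives of the first column; \<open>g12\<close> is also the derivative of the
  second column in the first direction. As the first column \<open>u\<close> has unit length, both are orthogonal to it, so
  \<open>g11\<close> is a multiple of \<open>perp u\<close>. The factor is \<open>g11 \<bullet> w\<close>, where \<open>w\<close> is the second column, because
  \<open>perp u \<bullet> w = 1\<close>; this is exactly the derivative of the shear.\<close>

lemma AE_line_rotating:
  "AE r in lborel. r \<in> {- h<..<h} \<longrightarrow>
     (\<exists>z. \<forall>t\<in>{0<..<L}. complex_of_vec (column_ext 1 (pt 1 t r)) = cis (shear (pt 1 t r)) * z)"
proof -
  obtain g11 where g11: "acl_deriv a b 1 (column_ext 1) g11" by (rule second_derivatives)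
  obtain g12 where g12: "acl_deriv a b 2 (column_ext 1) g12" "acl_deriv a b 1 (column_ext 2) g12" by (rule second_derivatives)
  let ?I = "\<lambda>f y. indicator (box a b) y *\<^sub>R f y"
  let ?d = "\<lambda>y. ?I (column_ext 1) y \<bullet> g12 y + g11 y \<bullet> ?I (column_ext 2) y"
  have shear: "acl_deriv a b 1 shear ?d"
    unfolding shear_def[abs_def] by (rule acl_deriv_inner(1)[OF g11 g12(2)])
  have orth: "AE r in lborel. AE t in lborel. pt 1 t r \<in> box a b \<longrightarrow>
      column_ext 1 (pt 1 t r) \<bullet> g11 (pt 1 t r) = 0 \<and> column_ext 1 (pt 1 t r) \<bullet> g12 (pt 1 t r) = 0"
  proof (rule AE_lines)
    show "AE y in lborel. y \<in> box a b \<longrightarrow> column_ext 1 y \<bullet> g11 y = 0 \<and> column_ext 1 y \<bullet> g12 y = 0"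
    proof -
      have "AE y in lborel. y \<in> box a b \<longrightarrow> column_ext 1 y \<bullet> g11 y = 0"
        by (rule acl_deriv_unit[OF g11]) (rule norm_column_ext_1)
      moreover have "AE y in lborel. y \<in> box a b \<longrightarrow> column_ext 1 y \<bullet> g12 y = 0"
        by (rule acl_deriv_unit[OF g12(1)]) (rule norm_column_ext_1)
      ultimately show ?thesis by eventually_elim auto
    qed
  qed
  note acl_line = acl_deriv_def[THEN iffD1, THEN conjunct2, THEN conjunct2, THEN conjunct2, THEN conjunct2, of a b 1]
  show ?thesis
    using acl_line[OF g11] acl_line[OF shear] orth
  proof eventually_elim
    case (elim r)
    show ?case
    proof
      assume r: "r \<in> {- h<..<h}"
      have box: "pt 1 t r \<in> box a b" if "0 < t" "t < L" for t using that r by (simp add: pt_in_box)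
      have ac_u: "ac_density 0 L (\<lambda>t. complex_of_vec (column_ext 1 (pt 1 t r))) (\<lambda>t. complex_of_vec (g11 (pt 1 t r)))"
        using ac_density_linear[OF bounded_linear_complex_of_vec] elim(1) r by simp
      have ac_s: "ac_density 0 L (\<lambda>t. shear (pt 1 t r)) (\<lambda>t. ?d (pt 1 t r))"
        using elim(2) r by simp
      obtain N where N: "N \<in> null_sets lborel" "{t \<in> space lborel. \<not> (pt 1 t r \<in> box a b \<longrightarrow>
          column_ext 1 (pt 1 t r) \<bullet> g11 (pt 1 t r) = 0 \<and> column_ext 1 (pt 1 t r) \<bullet> g12 (pt 1 t r) = 0)} \<subseteq> N"
        using elim(3) unfolding eventually_ae_filter by blast
      have "negligible N" using N(1) by (simp add: negligible_iff_null_sets null_sets_completionI)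
      have "ac_density 0 L (\<lambda>t. complex_of_vec (column_ext 1 (pt 1 t r)))
          (\<lambda>t. \<i> * complex_of_real (?d (pt 1 t r)) * complex_of_vec (column_ext 1 (pt 1 t r)))"
      proof (rule ac_density_cong[OF ac_u \<open>negligible N\<close>])
        fix t assume t: "0 < t" "t < L" "t \<notin> N"
        let ?y = "pt 1 t r"
        have y: "?y \<in> box a b" using box t by blast
        with N(2) t(3) have o: "column_ext 1 ?y \<bullet> g11 ?y = 0" "column_ext 1 ?y \<bullet> g12 ?y = 0" by auto
        from eq_inner_perp[OF norm_column_ext_1[OF y] o(1)]
        have g: "g11 ?y = (g11 ?y \<bullet> perp (column_ext 1 ?y)) *\<^sub>R perp (column_ext 1 ?y)" .
        then have "g11 ?y \<bullet> column_ext 2 ?y = (g11 ?y \<bullet> perp (column_ext 1 ?y)) * (perp (column_ext 1 ?y) \<bullet> column_ext 2 ?y)"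
          by (metis inner_scaleR_left)
        then have "?d ?y = g11 ?y \<bullet> perp (column_ext 1 ?y)" using perp_column_ext_1_2[OF y] o y by simp
        then show "\<i> * complex_of_real (?d ?y) * complex_of_vec (column_ext 1 ?y) = complex_of_vec (g11 ?y)"
          using g complex_of_vec_perp[of "?d ?y" "column_ext 1 ?y"] by simp
      qed
      from ac_density_rotating[OF this ac_s]
      obtain z where "\<And>t. 0 < t \<Longrightarrow> t < L \<Longrightarrow> complex_of_vec (column_ext 1 (pt 1 t r)) = cis (shear (pt 1 t r)) * z"
        by blast
      then show "\<exists>z. \<forall>t\<in>{0<..<L}. complex_of_vec (column_ext 1 (pt 1 t r)) = cis (shear (pt 1 t r)) * z" by auto
    qed
  qed
qed

lemma line_energy_bound:
  assumes r: "r \<in> {- h<..<h}" and short: "norm (v (pt 1 0 r) - v (pt 1 L r)) \<le> \<delta> * L"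
    and z: "\<forall>t\<in>{0<..<L}. complex_of_vec (column_ext 1 (pt 1 t r)) = cis (shear (pt 1 t r)) * z"
  shows "2 * L * (1 - \<delta>) \<le> integral {0..L} (\<lambda>t. (shear (pt 1 t r))\<^sup>2)"
proof (rule rotating_curve_energy_bound[OF L])
  have line: "continuous_on {0..L} (\<lambda>t. pt 1 t r)" unfolding pt_axis by (intro continuous_intros)
  have img: "(\<lambda>t. pt 1 t r) ` {0..L} \<subseteq> cbox a b" using r by (auto simp: pt_in_cbox)
  show "continuous_on {0..L} (\<lambda>t. v (pt 1 t r))" by (rule continuous_on_compose2[OF v_continuous line img])
  show "continuous_on {0..L} (\<lambda>t. shear (pt 1 t r))" by (rule continuous_on_compose2[OF shear_continuous line img])
  have box: "pt 1 t r \<in> box a b" if "0 < t" "t < L" for t using that r by (simp add: pt_in_box)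
  show "((\<lambda>t. v (pt 1 t r)) has_vector_derivative column_ext 1 (pt 1 t r)) (at t)" if "0 < t" "t < L" for t
    using has_vector_derivative_line[OF v_differentiable[OF box[OF that]]] column_ext_partial[OF box[OF that]] by simp
  show U: "complex_of_vec (column_ext 1 (pt 1 t r)) = cis (shear (pt 1 t r)) * z" if "0 < t" "t < L" for t
    using z that by simp
  have "norm (complex_of_vec (column_ext 1 (pt 1 (L / 2) r))) = 1"
    using norm_column_ext_1[OF box[of "L / 2"]] L by simp
  then show "norm z = 1" using U[of "L / 2"] L by (simp add: norm_mult)
qed (rule short)

lemma energy_eq:
  assumes "s = axis 1 1 \<or> s = - axis 1 1"
  shows "energy s (box a b) v = (\<integral>\<^sup>+ y. ennreal ((\<gamma> y)\<^sup>2) \<partial>lebesgue_on (box a b))"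
  unfolding energy_def
proof (rule nn_integral_cong_AE)
  show "AE y in lebesgue_on (box a b). energy_density s (jacobian v (at y)) = ennreal ((\<gamma> y)\<^sup>2)"
    using grad unfolding AE_lebesgue_on_iff[OF lmeasurable_box[THEN fmeasurableD]]
    by eventually_elim (simp add: energy_density_slip_gradient[OF assms])
qed

lemma energy_lower_bound:
  assumes s: "s = axis 1 1 \<or> s = - axis 1 1" and "\<delta> < 1"
    and short: "\<And>r. r \<in> {- h<..<h} \<Longrightarrow> norm (v (pt 1 0 r) - v (pt 1 L r)) \<le> \<delta> * L"
  shows "ennreal (4 * L * (1 - \<delta>) * h) \<le> energy s (box a b) v"
proof -
  let ?f = "\<lambda>y. ennreal (indicator (box a b) y * (shear y)\<^sup>2)"
  have meas: "(\<lambda>y. indicator (box a b) y * (shear y)\<^sup>2) \<in> borel_measurable borel"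
  proof -
    have "continuous_on (box a b) (\<lambda>y. (shear y)\<^sup>2)"
      by (intro continuous_intros continuous_on_subset[OF shear_continuous box_subset_cbox])
    from borel_measurable_continuous_on_indicator[OF _ this] show ?thesis by simp
  qed
  have line: "AE r in lborel. indicator {- h<..<h} r * ennreal (2 * L * (1 - \<delta>)) \<le> (\<integral>\<^sup>+ t. ?f (pt 1 t r) \<partial>lborel)"
    using AE_line_rotating
  proof eventually_elim
    case (elim r)
    show ?case
    proof (cases "r \<in> {- h<..<h}")
      case True
      have img: "(\<lambda>t. pt 1 t r) ` {0..L} \<subseteq> cbox a b" using True by (auto simp: pt_in_cbox)
      have "continuous_on {0..L} (\<lambda>t. pt 1 t r)" unfolding pt_axis by (intro continuous_intros)
      then have "continuous_on {0..L} (\<lambda>t. (shear (pt 1 t r))\<^sup>2)"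
        by (intro continuous_intros continuous_on_compose2[OF shear_continuous _ img])
      then have "set_integrable lborel {0..L} (\<lambda>t. (shear (pt 1 t r))\<^sup>2)"
        by (rule borel_integrable_atLeastAtMost')
      then have int: "set_integrable lborel {0<..<L} (\<lambda>t. (shear (pt 1 t r))\<^sup>2)"
        by (rule set_integrable_subset) auto
      obtain z where z: "\<forall>t\<in>{0<..<L}. complex_of_vec (column_ext 1 (pt 1 t r)) = cis (shear (pt 1 t r)) * z"
        using elim True by blast
      have "2 * L * (1 - \<delta>) \<le> integral {0<..<L} (\<lambda>t. (shear (pt 1 t r))\<^sup>2)"
        using line_energy_bound[OF True short[OF True] z] by (simp add: integral_open_interval_real)
      also have "\<dots> = (LINT t|lborel. indicator {0<..<L} t * (shear (pt 1 t r))\<^sup>2)"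
        using set_borel_integral_eq_integral(2)[OF int] by (simp add: set_lebesgue_integral_def)
      also have "\<dots> = (LINT t|lborel. indicator (box a b) (pt 1 t r) * (shear (pt 1 t r))\<^sup>2)"
        by (rule Bochner_Integration.integral_cong) (use True in \<open>auto simp: indicator_def pt_in_box\<close>)
      finally have "ennreal (2 * L * (1 - \<delta>)) \<le> ennreal (LINT t|lborel. indicator (box a b) (pt 1 t r) * (shear (pt 1 t r))\<^sup>2)"
        by (rule ennreal_leI)
      also have "\<dots> = (\<integral>\<^sup>+ t. ?f (pt 1 t r) \<partial>lborel)"
      proof (rule nn_integral_eq_integral[symmetric])
        have "(\<lambda>t. indicator {0<..<L} t *\<^sub>R (shear (pt 1 t r))\<^sup>2)
            = (\<lambda>t. indicator (box a b) (pt 1 t r) * (shear (pt 1 t r))\<^sup>2)"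
          using True by (auto simp: fun_eq_iff indicator_def pt_in_box)
        then show "integrable lborel (\<lambda>t. indicator (box a b) (pt 1 t r) * (shear (pt 1 t r))\<^sup>2)"
          using int unfolding set_integrable_def by simp
      qed simp
      finally show ?thesis using True by simp
    qed simp
  qed
  have "ennreal (4 * L * (1 - \<delta>) * h) = ennreal (2 * L * (1 - \<delta>)) * ennreal (2 * h)"
    using L h \<open>\<delta> < 1\<close> by (subst ennreal_mult[symmetric]) (auto simp: algebra_simps)
  also have "\<dots> = (\<integral>\<^sup>+ r. ennreal (2 * L * (1 - \<delta>)) * indicator {- h<..<h} r \<partial>lborel)"
    using h by (subst nn_integral_cmult_indicator) auto
  also have "\<dots> = (\<integral>\<^sup>+ r. indicator {- h<..<h} r * ennreal (2 * L * (1 - \<delta>)) \<partial>lborel)"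
    by (simp add: mult.commute)
  also have "\<dots> \<le> (\<integral>\<^sup>+ r. \<integral>\<^sup>+ t. ?f (pt 1 t r) \<partial>lborel \<partial>lborel)"
    by (rule nn_integral_mono_AE[OF line])
  also have "\<dots> = (\<integral>\<^sup>+ y. ?f y \<partial>lborel)"
    by (rule nn_integral_lines[symmetric]) (use meas in measurable)
  also have "\<dots> = (\<integral>\<^sup>+ y. ?f y \<partial>lebesgue)"
    by (rule nn_integral_completion[symmetric]) (use meas in measurable)
  also have "\<dots> = (\<integral>\<^sup>+ y. ennreal ((shear y)\<^sup>2) * indicator (box a b) y \<partial>lebesgue)"
    by (rule nn_integral_cong) (auto simp: indicator_def)
  also have "\<dots> = (\<integral>\<^sup>+ y. ennreal ((\<gamma> y)\<^sup>2) * indicator (box a b) y \<partial>lebesgue)"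
  proof (rule nn_integral_cong_AE)
    show "AE y in lebesgue. ennreal ((shear y)\<^sup>2) * indicator (box a b) y = ennreal ((\<gamma> y)\<^sup>2) * indicator (box a b) y"
      using AE_shear by eventually_elim (auto simp: indicator_def)
  qed
  also have "\<dots> = energy s (box a b) v"
    unfolding energy_eq[OF s] by (rule nn_integral_restrict_space[symmetric]) simp
  finally show ?thesis .
qed

end

theorem proposition3p3:
  fixes L \<delta> :: real and s :: "real ^ 2"
  assumes "L > 0" and "0 \<le> \<delta>" and "\<delta> < 1"
    and "s = axis 1 1 \<or> s = - axis 1 1"
  shows "\<exists>c>0. \<forall>h>0. \<forall>(v :: real ^ 2 \<Rightarrow> real ^ 2) (\<theta> :: real ^ 2 \<Rightarrow> real) (\<gamma> :: real ^ 2 \<Rightarrow> real).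
    sobolev_W1 2 (strip L h) v \<and> C1_closure (strip L h) v \<and>
    (AE y in lebesgue_on (strip L h).
       jacobian v (at y) =
         rotation (\<theta> y) ** (mat 1 + \<gamma> y *\<^sub>R tensor (axis 1 1) (axis 2 1))) \<longrightarrow>
    (sobolev_W1 1 (strip L h) \<gamma> \<and> C0_closure_ae (strip L h) \<gamma> \<and>
     sobolev_W1 1 (strip L h) (\<lambda>y. circle_point (\<theta> y)) \<and>
     C0_closure_ae (strip L h) (\<lambda>y. circle_point (\<theta> y))) \<and>
    ((\<forall>y\<^sub>2\<in>{-h<..<h}. 1 / L * norm (v (vector [0, y\<^sub>2]) - v (vector [L, y\<^sub>2])) \<le> \<delta>) \<longrightarrow>
       energy s (strip L h) v = (\<integral>\<^sup>+ y. ennreal ((\<gamma> y)\<^sup>2) \<partial>lebesgue_on (strip L h)) \<and>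
       energy s (strip L h) v \<ge> ennreal (c * h))"
proof (intro exI[of _ "4 * L * (1 - \<delta>)"] conjI allI impI)
  show "0 < 4 * L * (1 - \<delta>)" using assms by simp
next
  fix h :: real and v :: "real ^ 2 \<Rightarrow> real ^ 2" and \<theta> \<gamma> :: "real ^ 2 \<Rightarrow> real"
  assume h: "0 < h"
    and v: "sobolev_W1 2 (strip L h) v \<and> C1_closure (strip L h) v \<and>
      (AE y in lebesgue_on (strip L h).
       jacobian v (at y) = rotation (\<theta> y) ** (mat 1 + \<gamma> y *\<^sub>R tensor (axis 1 1) (axis 2 1)))"
  let ?a = "pt 1 0 (- h)" and ?b = "pt 1 L h"
  have W21: "sobolev_W1 2 (box ?a ?b) v" and C1: "C1_closure (box ?a ?b) v"
    using v by (simp_all add: strip_eq_box)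
  have grad: "AE y in lebesgue. y \<in> box ?a ?b \<longrightarrow> jacobian v (at y) = slip_gradient (\<theta> y) (\<gamma> y)"
    using v unfolding strip_eq_box slip_gradient_def by (simp add: AE_lebesgue_on_iff)
  note regular = regularity[OF \<open>L > 0\<close> h W21 C1 grad]
  show "sobolev_W1 1 (strip L h) \<gamma>" "C0_closure_ae (strip L h) \<gamma>"
    "sobolev_W1 1 (strip L h) (\<lambda>y. circle_point (\<theta> y))"
    "C0_closure_ae (strip L h) (\<lambda>y. circle_point (\<theta> y))"
    using regular by (simp_all add: strip_eq_box)
  assume short: "\<forall>y\<^sub>2\<in>{-h<..<h}. 1 / L * norm (v (vector [0, y\<^sub>2]) - v (vector [L, y\<^sub>2])) \<le> \<delta>"
  show "energy s (strip L h) v = (\<integral>\<^sup>+ y. ennreal ((\<gamma> y)\<^sup>2) \<partial>lebesgue_on (strip L h))"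
    unfolding strip_eq_box by (rule energy_eq[OF \<open>L > 0\<close> h W21 C1 grad assms(4)])
  show "ennreal (4 * L * (1 - \<delta>) * h) \<le> energy s (strip L h) v"
    unfolding strip_eq_box
  proof (rule energy_lower_bound[OF \<open>L > 0\<close> h W21 C1 grad assms(4) \<open>\<delta> < 1\<close>])
    fix r assume "r \<in> {- h<..<h}"
    with short have "1 / L * norm (v (pt 1 0 r) - v (pt 1 L r)) \<le> \<delta>"
      unfolding vector_eq_pt by blast
    then show "norm (v (pt 1 0 r) - v (pt 1 L r)) \<le> \<delta> * L"
      using \<open>L > 0\<close> by (simp add: field_simps)
  qed
qed

end
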